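(* Let $A = x^a(x+1)^b \prod_{i\in I} P_i^{h_i} \in \mathbb{F}_2[x]$ be such that each $P_i$ is a Mersenne prime and $a, b, h_i$ are positive integers. Then: (1) $A$ is an indecomposable perfect polynomial if and only if $A \in \mathcal{P} = \{T_1,\ldots,T_9\}$. (2) $A$ is an indecomposable unitary perfect polynomial if and only if $A = B^{2^n}$ for some integer $n \geq 0$ and some $B \in \mathcal{P}_u = \{B_1,\ldots,B_9\}$.
   Context: For nonzero $A \in \mathbb{F}_2[x]$, $\sigma(A)$ denotes the sum of all divisors of $A$ in $\mathbb{F}_2[x]$ (including $1$ and $A$). A divisor $d$ of $A$ is unitary if $\gcd(d, A/d)=1$, and $\sigma^*(A)$ denotes the sum of all unitary divisors of $A$ (including $1$ and $A$). $A$ is perfect if $\sigma(A)=A$, and unitary perfect if $\sigma^*(A)=A$. A perfect (resp. unitary perfect) polynomial is indecomposable if it is not a product of two coprime nonconstant perfect (resp. unitary perfect) polynomials. A Mersenne prime (polynomial) over $\mathbb{F}_2$ is an irreducible polynomial of the form $1+x^c(x+1)^d$ with $c,d$ positive integers. In the product defining $A$, $I$ is a finite index set. For $S \in \mathbb{F}_2[x]$, $\overline{S}(x) = S(x+1)$. For $j\in\{1,2,3\}$, $M_j = 1+x(x+1)^j$. Put $T_1 = x^2(x+1)M_1$, $T_2 = \overline{T_1}$, $T_3 = x^4(x+1)^3M_3$, $T_4 = \overline{T_3}$, $T_5 = x^4(x+1)^4M_3\overline{M_3}$, $T_6 = x^6(x+1)^3M_2\overline{M_2}$, $T_7=\overline{T_6}$,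 $T_8 = x^4(x+1)^6M_2\overline{M_2}M_3$, $T_9 = \overline{T_8}$; $B_1 = x^3(x+1)^3M_1^2$, $B_2 = x^3(x+1)^2M_1$, $B_3 = x^5(x+1)^4M_3$, $B_4 = x^7(x+1)^4M_2\overline{M_2}$, $B_5 = x^5(x+1)^6M_1^2M_3$, $B_6 = x^5(x+1)^5M_3\overline{M_3}$, $B_7 = x^7(x+1)^7M_2^2\overline{M_2}^2$, $B_8 = x^7(x+1)^6M_1^2M_2\overline{M_2}$, $B_9 = x^7(x+1)^5M_2\overline{M_2}\,\overline{M_3}$.
   Formalization: Assumes I nonempty, since x(x+1) is otherwise an exception to (1); in (2), B ranges over B_1,…,B_9 and their images under x→x+1, since e.g. x^2(x+1)^3 M_1 is indecomposable unitary perfect but is not of the form B_i^(2^n). *)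

theory Defs
  imports
    "HOL-Library.Z2"
    "HOL-Computational_Algebra.Computational_Algebra"
begin

text \<open>The field with two elements is the type \<^typ>\<open>bit\<close> of \<^theory>\<open>HOL-Library.Z2\<close>.\<close>

abbreviation pX :: "bit poly" where
  "pX \<equiv> [:0, 1:]"

text \<open>The only unit of \<^typ>\<open>bit poly\<close> is 1, so distinct divisors are never associated and the
  sums below need no normalisation.  The divisor set is finite for nonzero \<open>A\<close>; for \<open>A = 0\<close> the
  sums take the meaningless default value 0, hence the guard \<open>A \<noteq> 0\<close> in the notions of
  perfection.\<close>

definition sigma :: "bit poly \<Rightarrow> bit poly" where
  "sigma A = (\<Sum>d | d dvd A. d)"

definition unitary_divisor :: "bit poly \<Rightarrow> bit poly \<Rightarrow> bool" where
  "unitary_divisor d A \<longleftrightarrow> d dvd A \<and> coprime d (A div d)"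

definition sigma_star :: "bit poly \<Rightarrow> bit poly" where
  "sigma_star A = (\<Sum>d | unitary_divisor d A. d)"

definition perfect :: "bit poly \<Rightarrow> bool" where
  "perfect A \<longleftrightarrow> A \<noteq> 0 \<and> sigma A = A"

definition unitary_perfect :: "bit poly \<Rightarrow> bool" where
  "unitary_perfect A \<longleftrightarrow> A \<noteq> 0 \<and> sigma_star A = A"

definition indecomposable_perfect :: "bit poly \<Rightarrow> bool" where
  "indecomposable_perfect A \<longleftrightarrow> perfect A \<and>
     \<not> (\<exists>B C. A = B * C \<and> coprime B C \<and> degree B > 0 \<and> degree C > 0 \<and> perfect B \<and> perfect C)"

definition indecomposable_unitary_perfect :: "bit poly \<Rightarrow> bool" where
  "indecomposable_unitary_perfect A \<longleftrightarrow> unitary_perfect A \<and>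
     \<not> (\<exists>B C. A = B * C \<and> coprime B C \<and> degree B > 0 \<and> degree C > 0 \<and>
             unitary_perfect B \<and> unitary_perfect C)"

definition mersenne_prime :: "bit poly \<Rightarrow> bool" where
  "mersenne_prime P \<longleftrightarrow> irreducible P \<and> (\<exists>c d. c > 0 \<and> d > 0 \<and> P = 1 + pX ^ c * (pX + 1) ^ d)"

definition bar :: "bit poly \<Rightarrow> bit poly" where
  "bar S = pcompose S (pX + 1)"

definition M :: "nat \<Rightarrow> bit poly" where
  "M j = 1 + pX * (pX + 1) ^ j"

definition T1 :: "bit poly" where "T1 = pX ^ 2 * (pX + 1) * M 1"
definition T2 :: "bit poly" where "T2 = bar T1"
definition T3 :: "bit poly" where "T3 = pX ^ 4 * (pX + 1) ^ 3 * M 3"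
definition T4 :: "bit poly" where "T4 = bar T3"
definition T5 :: "bit poly" where "T5 = pX ^ 4 * (pX + 1) ^ 4 * M 3 * bar (M 3)"
definition T6 :: "bit poly" where "T6 = pX ^ 6 * (pX + 1) ^ 3 * M 2 * bar (M 2)"
definition T7 :: "bit poly" where "T7 = bar T6"
definition T8 :: "bit poly" where "T8 = pX ^ 4 * (pX + 1) ^ 6 * M 2 * bar (M 2) * M 3"
definition T9 :: "bit poly" where "T9 = bar T8"

definition P_set :: "bit poly set" where
  "P_set = {T1, T2, T3, T4, T5, T6, T7, T8, T9}"

definition B1 :: "bit poly" where "B1 = pX ^ 3 * (pX + 1) ^ 3 * M 1 ^ 2"
definition B2 :: "bit poly" where "B2 = pX ^ 3 * (pX + 1) ^ 2 * M 1"
definition B3 :: "bit poly" where "B3 = pX ^ 5 * (pX + 1) ^ 4 * M 3"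
definition B4 :: "bit poly" where "B4 = pX ^ 7 * (pX + 1) ^ 4 * M 2 * bar (M 2)"
definition B5 :: "bit poly" where "B5 = pX ^ 5 * (pX + 1) ^ 6 * M 1 ^ 2 * M 3"
definition B6 :: "bit poly" where "B6 = pX ^ 5 * (pX + 1) ^ 5 * M 3 * bar (M 3)"
definition B7 :: "bit poly" where "B7 = pX ^ 7 * (pX + 1) ^ 7 * M 2 ^ 2 * bar (M 2) ^ 2"
definition B8 :: "bit poly" where "B8 = pX ^ 7 * (pX + 1) ^ 6 * M 1 ^ 2 * M 2 * bar (M 2)"
definition B9 :: "bit poly" where "B9 = pX ^ 7 * (pX + 1) ^ 5 * M 2 * bar (M 2) * bar (M 3)"

text \<open>The list is a list of representatives up to \<^const>\<open>bar\<close>: \<^const>\<open>bar\<close> preserves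
  unitary perfection, but for instance \<open>bar B2\<close> is not a power of any of the nine polynomials.\<close>

definition Pu_set :: "bit poly set" where
  "Pu_set = {B1, B2, B3, B4, B5, B6, B7, B8, B9}"

end

theory Submission
  imports Defs
begin

text \<open>
  The key device is a logarithmic derivative.  Put \<open>D F = X (X + 1) F'\<close> and
  \<open>dlog F = D F mod F\<close>; then \<open>dlog (F G) = dlog F G + F dlog G\<close>, and for a Mersenne prime
  \<open>Q = 1 + X\<^sup>c (X + 1)\<^sup>d\<close> the value \<open>dlog Q\<close> is one of \<open>1\<close>, \<open>X\<close>, \<open>X + 1\<close>.  So if all prime
  factors of \<open>W\<close> are Mersenne primes of large degree, \<open>dlog W / W\<close> has very negative degree.  For
  \<open>W = 1 + P + \<dots> + P\<^sup>m\<^sup>-\<^sup>1\<close> with \<open>m\<close> odd and \<open>P\<close> a Mersenne prime one has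
  \<open>P dlog W = dlog P (W + 1)\<close>, and \<open>dlog W = 1\<close> for \<open>P = X\<close>.  If \<open>W\<close> is a product of Mersenne
  primes, it therefore has factors of degree at most \<open>deg P + 1\<close>, or, for \<open>P = X\<close>, its factors of
  least degree must cancel in \<open>dlog W\<close>.  For the five Mersenne primes of degree at most 4 and for
  \<open>X\<close>, \<open>X + 1\<close> this leaves only small \<open>m\<close>.

  Write a perfect \<open>A\<close> as \<open>B C\<close>, where \<open>C\<close> collects the powers of these seven primes.  The prime
  factors of \<open>\<sigma>(C)\<close> are again among the seven, so \<open>B\<close> divides \<open>\<sigma>(B)\<close>; both have the same degree,
  so \<open>B\<close> and \<open>C\<close> are perfect, and \<open>B = 1\<close> if \<open>A\<close> is indecomposable.  Comparing the exponents in
  \<open>\<sigma>(A) = A\<close> leaves finitely many cases, up to squaring in the unitary case.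
\<close>

section \<open>Polynomials over the field with two elements\<close>

text \<open>The factor X (X + 1) in D makes D act diagonally on monomials: X^c (X + 1)^d is
  multiplied by c (X + 1) + d X. Only the parities of c and d survive, so dlog Q has degree at most
  1 however large Q is, and nothing has to be known about which forms 1 + X^c (X + 1)^d are
  irreducible.

  No bound on \<open>m\<close> is proved for primes P of larger degree. The analysis is therefore
  confined to a set of primes closed under passing from p to the prime factors of the divisor sum of
  a power of p. Starting from X and X + 1, the sums with 3, 5 and 7 terms produce
  \<open>M 1\<close>, \<open>M 3\<close>, \<open>M 2\<close> and their conjugates; the only new
  sums, with 3 terms over \<open>M 2\<close> and its conjugate, lead back to these. This is where
  the seven primes come from.

  Even numbers of terms cost nothing: by Frobenius a power of 2 dividing the number of terms becomes
  an outer exponent. The usual and the unitary divisor sum differ only in a shift \<delta> of the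
  exponent by 1 or 0, so both halves run through one argument. The listed polynomials are
  indecomposable because each of their nonconstant perfect unitary factors is divisible by X, which
  two coprime factors cannot both be.\<close>

instantiation bit :: "{unique_euclidean_ring, normalization_euclidean_semiring, normalization_semidom_multiplicative}"
begin

definition normalize_bit :: "bit \<Rightarrow> bit" where [simp]: "normalize_bit x = x"
definition unit_factor_bit :: "bit \<Rightarrow> bit" where [simp]: "unit_factor_bit x = x"
definition euclidean_size_bit :: "bit \<Rightarrow> nat" where
  [simp]: "euclidean_size_bit x = (if x = 0 then 0 else 1)"
definition division_segment_bit :: "bit \<Rightarrow> bit" where [simp]: "division_segment_bit x = 1"

instance
  by standard (auto simp: dvd_field_iff field_split_simps split: if_splits)

end

text \<open>These instances provide gcds and unique factorisation in
  \<open>bit poly\<close>.\<close>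

instantiation bit :: euclidean_ring_gcd
begin

definition gcd_bit :: "bit \<Rightarrow> bit \<Rightarrow> bit" where "gcd_bit = Euclidean_Algorithm.gcd"
definition lcm_bit :: "bit \<Rightarrow> bit \<Rightarrow> bit" where "lcm_bit = Euclidean_Algorithm.lcm"
definition Gcd_bit :: "bit set \<Rightarrow> bit" where "Gcd_bit = Euclidean_Algorithm.Gcd"
definition Lcm_bit :: "bit set \<Rightarrow> bit" where "Lcm_bit = Euclidean_Algorithm.Lcm"

instance by standard (simp_all add: gcd_bit_def lcm_bit_def Gcd_bit_def Lcm_bit_def)

end

instance bit :: field_gcd ..

lemma bit_poly_add_self [simp]: "(p :: bit poly) + p = 0"
proof (rule poly_eqI)
  fix n show "coeff (p + p) n = coeff 0 n"
    unfolding coeff_add coeff_0 by (cases "coeff p n") simp_all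
qed

lemma bit_poly_add_self_left [simp]: "(p :: bit poly) + (p + q) = q"
  by (simp flip: add.assoc)

lemma bit_poly_uminus [simp]: "- (p :: bit poly) = p"
  by (rule poly_eqI) simp

lemma bit_poly_diff [simp]: "(p :: bit poly) - q = p + q"
  by (rule poly_eqI) simp

lemma bit_poly_add_eq_0_iff: "(p :: bit poly) + q = 0 \<longleftrightarrow> p = q"
  by (metis add_right_imp_eq bit_poly_add_self)

lemma bit_poly_numeral [simp]:
  "numeral (Num.Bit0 n) = (0 :: bit poly)" "numeral (Num.Bit1 n) = (1 :: bit poly)"
  by (simp_all only: numeral_Bit0 numeral_Bit1 bit_poly_add_self add_0_left)

lemma of_nat_bit_poly: "(of_nat n :: bit poly) = of_bool (odd n)"
  by (induction n) auto

lemma lead_coeff_bit_poly [simp]: "p \<noteq> 0 \<Longrightarrow> coeff (p :: bit poly) (degree p) = 1"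
  by (metis leading_coeff_0_iff bit_not_zero_iff)

lemma degree_eq_0_bit_poly_iff: "degree (p :: bit poly) = 0 \<longleftrightarrow> p = 0 \<or> p = 1"
proof
  assume "degree p = 0"
  then obtain c where "p = [:c:]" by (rule degree_eq_zeroE)
  then show "p = 0 \<or> p = 1" by (cases c) (simp_all add: one_pCons)
qed auto

lemma is_unit_bit_poly_iff [simp]: "is_unit (p :: bit poly) \<longleftrightarrow> p = 1"
  by (cases "p = 0") (auto simp: is_unit_iff_degree degree_eq_0_bit_poly_iff)

lemma normalize_bit_poly [simp]: "normalize (p :: bit poly) = p"
proof (cases "p = 0")
  case False
  then have "unit_factor p = 1"
    using unit_factor_is_unit[of p] is_unit_bit_poly_iff by blast
  then show ?thesis using unit_factor_mult_normalize[of p] by simp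
qed simp

lemma prime_bit_poly_iff: "prime (p :: bit poly) \<longleftrightarrow> irreducible p"
  by (auto simp: prime_def prime_elem_iff_irreducible)

lemma prod_prime_factors_bit_poly:
  "(A :: bit poly) \<noteq> 0 \<Longrightarrow> (\<Prod>p\<in>prime_factors A. p ^ multiplicity p A) = A"
  by (simp add: prod_prime_factors)

lemma power2_add_bit_poly: "((p :: bit poly) + q) ^ 2 = p ^ 2 + q ^ 2"
  by (simp add: power2_eq_square algebra_simps)

lemma power_2_power_add_bit_poly: "((p :: bit poly) + q) ^ (2 ^ k) = p ^ (2 ^ k) + q ^ (2 ^ k)"
proof (induction k)
  case (Suc k)
  then show ?case by (simp add: power_mult mult.commute[of 2] power2_add_bit_poly)
qed simp

lemma degree_power_bit_poly [simp]: "degree ((p :: bit poly) ^ n) = n * degree p"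
  by (metis degree_power_eq power_0_left degree_0 degree_1 mult_0 mult_0_right)

lemma exists_irreducible_dvd_bit_poly:
  assumes "(A :: bit poly) \<noteq> 0" "A \<noteq> 1" obtains q where "irreducible q" "q dvd A"
  using assms prime_divisor_exists[of A] prime_bit_poly_iff by auto

section \<open>Mersenne primes and the logarithmic derivative\<close>

text \<open>A constant of its own keeps the simplifier from multiplying out products of \<^const>\<open>pCons\<close>.\<close>

definition X :: "bit poly" where "X = pX"

lemma pX_eq: "pX = X" by (simp add: X_def)

lemma X_nonzero [simp]: "X \<noteq> 0" "X + 1 \<noteq> 0" "X \<noteq> 1" "X + 1 \<noteq> 1"
  and degree_X [simp]: "degree X = 1" "degree (X + 1) = 1"
  and poly_X [simp]: "poly X a = a"
  and pderiv_X [simp]: "pderiv X = 1"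
  by (simp_all add: X_def one_pCons pderiv_pCons)

lemma X_dvd_iff: "X dvd p \<longleftrightarrow> poly p 0 = 0"
  by (simp add: X_def poly_eq_0_iff_dvd)

lemma X1_dvd_iff: "X + 1 dvd p \<longleftrightarrow> poly p 1 = 0"
  by (simp add: X_def poly_eq_0_iff_dvd one_pCons)

lemma irreducible_X [simp]: "irreducible X" "irreducible (X + 1)"
  by (simp_all add: X_def one_pCons irreducible_linear_field_poly)

lemma degree_X_power_X1_power: "degree (X ^ c * (X + 1) ^ d) = c + d"
  by (simp add: degree_mult_eq)

definition mform :: "nat \<Rightarrow> nat \<Rightarrow> bit poly" where
  "mform c d = 1 + X ^ c * (X + 1) ^ d"

text \<open>This is c (X + 1) + d X with coefficients reduced modulo 2: the factor by which
  \<open>euler_deriv\<close> multiplies X^c (X + 1)^d.\<close>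

definition lform :: "nat \<Rightarrow> nat \<Rightarrow> bit poly" where
  "lform c d = (if odd c then X + 1 else 0) + (if odd d then X else 0)"

lemma degree_mform: "c > 0 \<Longrightarrow> degree (mform c d) = c + d"
  unfolding mform_def by (subst degree_add_eq_right) (simp_all add: degree_X_power_X1_power)

lemma mform_nonzero: "c > 0 \<Longrightarrow> mform c d \<noteq> 0"
  using degree_mform[of c d] by force

lemma mform_neq_1: "c > 0 \<Longrightarrow> mform c d \<noteq> 1"
  using degree_mform[of c d] by force

lemma mersenne_prime_iff:
  "mersenne_prime Q \<longleftrightarrow> irreducible Q \<and> (\<exists>c d. c > 0 \<and> d > 0 \<and> Q = mform c d)"
  by (simp add: mersenne_prime_def mform_def pX_eq)

text \<open>With both exponents even, \<open>Q\<close> would be the square of the form with halved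
  exponents.\<close>

lemma mersenne_primeE:
  assumes "mersenne_prime Q"
  obtains c d where "c > 0" "d > 0" "Q = mform c d" "irreducible Q" "odd c \<or> odd d"
proof -
  obtain c d where cd: "c > 0" "d > 0" "Q = mform c d" and irr: "irreducible Q"
    using assms by (auto simp: mersenne_prime_iff)
  have "odd c \<or> odd d"
  proof (rule ccontr)
    assume "\<not> (odd c \<or> odd d)"
    then obtain c' d' where e: "c = 2 * c'" "d = 2 * d'" by (auto elim!: evenE)
    have "Q = mform c' d' * mform c' d'"
      unfolding cd e mform_def
      by (simp add: power_mult algebra_simps power2_eq_square power_mult_distrib)
    then show False
      using irr irreducibleD[OF irr] mform_neq_1[of c' d'] e cd(1) by auto
  qed
  then show thesis using cd irr that by blast
qed

definition euler_deriv :: "bit poly \<Rightarrow> bit poly" where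
  "euler_deriv F = X * (X + 1) * pderiv F"

text \<open>\<open>dlog F / F\<close> is the proper fractional part of
  \<open>euler_deriv F / F\<close>. Fractional parts are additive, so the Leibniz rule survives the
  reduction, and the degree of the fraction becomes meaningful.\<close>

definition dlog :: "bit poly \<Rightarrow> bit poly" where
  "dlog F = euler_deriv F mod F"

lemma euler_deriv_add: "euler_deriv (F + G) = euler_deriv F + euler_deriv G"
  by (simp add: euler_deriv_def pderiv_add algebra_simps)

lemma euler_deriv_mult: "euler_deriv (F * G) = euler_deriv F * G + F * euler_deriv G"
  by (simp add: euler_deriv_def pderiv_mult algebra_simps)

lemma euler_deriv_1 [simp]: "euler_deriv 1 = 0"
  by (simp add: euler_deriv_def)

lemma euler_deriv_power: "euler_deriv (F ^ n) = of_nat n * F ^ (n - 1) * euler_deriv F"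
proof (induction n)
  case (Suc n)
  then show ?case by (cases n) (simp_all add: euler_deriv_mult algebra_simps)
qed simp

lemma dlog_mult: "dlog (F * G) = dlog F * G + F * dlog G"
  by (simp add: dlog_def euler_deriv_mult poly_mod_add_left mod_mult_mult1 mod_mult_mult2)

lemma dlog_1 [simp]: "dlog 1 = 0"
  by (simp add: dlog_def)

lemma degree_lform:
  assumes "odd c \<or> odd d"
  shows "degree (lform c d) = (c + d) mod 2" and "lform c d \<noteq> 0"
proof -
  have "X + 1 + X = 1" by (simp add: add.commute)
  then show "degree (lform c d) = (c + d) mod 2" "lform c d \<noteq> 0"
    using assms unfolding lform_def by (cases "odd c"; cases "odd d"; simp add: mod_2_eq_odd)+
qed

lemma euler_deriv_mform:
  assumes "c > 0" "d > 0"
  shows "euler_deriv (mform c d) = lform c d * (mform c d + 1)"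
proof -
  have "X ^ c = X * X ^ (c - 1)" "(X+1) ^ d = (X+1) * (X+1) ^ (d - 1)"
    using assms by (simp_all flip: power_Suc)
  then show ?thesis
    unfolding mform_def euler_deriv_add euler_deriv_mult euler_deriv_power lform_def
    by (simp add: euler_deriv_def pderiv_add of_nat_bit_poly algebra_simps)
qed

text \<open>With l = \<open>lform c d\<close> the derivative is l Q + l, and l has smaller degree
  than Q.\<close>

lemma dlog_mform:
  assumes "c > 0" "d > 0" "odd c \<or> odd d"
  shows "dlog (mform c d) = lform c d"
proof -
  have "degree (lform c d) < degree (mform c d)"
    using assms degree_lform[of c d] by (simp add: degree_mform mod_2_eq_odd)
  then show ?thesis
    unfolding dlog_def euler_deriv_mform[OF assms(1,2)]
    by (simp add: distrib_left poly_mod_add_left mod_poly_less)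
qed

definition mersenne_split :: "bit poly \<Rightarrow> bool" where
  "mersenne_split W \<longleftrightarrow> W \<noteq> 0 \<and> (\<forall>q. irreducible q \<longrightarrow> q dvd W \<longrightarrow> mersenne_prime q)"

lemma mersenne_split_dvd: "mersenne_split W \<Longrightarrow> V dvd W \<Longrightarrow> mersenne_split V"
  unfolding mersenne_split_def by (meson dvd_0_left dvd_trans)

lemma dlog_mersenne_prime:
  assumes "mersenne_prime Q"
  shows "dlog Q \<noteq> 0" "degree (dlog Q) = degree Q mod 2" "degree Q \<ge> 2"
  using assms by (auto elim!: mersenne_primeE simp: dlog_mform degree_lform degree_mform)

text \<open>\<open>dlog Q\<close> has degree 0 or 1 with the parity of \<open>deg Q\<close>, hence only even \<open>s\<close> are useful.\<close>

lemma degree_dlog_le: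
  assumes "mersenne_split K" "\<And>q. irreducible q \<Longrightarrow> q dvd K \<Longrightarrow> degree q \<ge> s" "even s"
  shows "dlog K = 0 \<or> degree (dlog K) + s \<le> degree K"
  using assms(1,2)
proof (induction "degree K" arbitrary: K rule: less_induct)
  case less
  show ?case
  proof (cases "K = 1")
    case False
    have "K \<noteq> 0" using less.prems by (auto simp: mersenne_split_def)
    obtain q V where q: "irreducible q" and K: "K = q * V"
      using exists_irreducible_dvd_bit_poly[OF \<open>K \<noteq> 0\<close> False] by (metis dvdE)
    have mp: "mersenne_prime q" using less.prems(1) q K by (auto simp: mersenne_split_def)
    note lq = dlog_mersenne_prime[OF mp]
    have nz: "q \<noteq> 0" "V \<noteq> 0" using K \<open>K \<noteq> 0\<close> by auto
    have dK: "degree K = degree q + degree V" using nz by (simp add: K degree_mult_eq)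
    have IH: "dlog V = 0 \<or> degree (dlog V) + s \<le> degree V"
      using less.hyps[of V] less.prems lq dK mersenne_split_dvd[of K V] by (auto simp: K)
    have sq: "degree q \<ge> s" using less.prems(2)[OF q] K by simp
    have "degree q mod 2 + s \<le> degree q" using sq \<open>even s\<close> by presburger
    then have 1: "degree (dlog q * V) + s \<le> degree K"
      using degree_mult_le[of "dlog q" V] dK lq(2) by linarith
    have 2: "q * dlog V = 0 \<or> degree (q * dlog V) + s \<le> degree K"
      using IH nz dK by (cases "dlog V = 0") (auto simp: degree_mult_eq)
    have "degree (dlog K) \<le> max (degree (dlog q * V)) (degree (q * dlog V))"
      unfolding K dlog_mult by (rule degree_add_le_max)
    then show ?thesis using 1 2 by (auto simp: K dlog_mult)
  qed simp
qed

section \<open>Geometric sums\<close>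

definition geo :: "bit poly \<Rightarrow> nat \<Rightarrow> bit poly" where
  "geo P m = (\<Sum>i<m. P ^ i)"

lemma geo_mult: "(P + 1) * geo P m = P ^ m + 1"
  using power_diff_1_eq[of P m] by (simp add: geo_def)

lemma geo_0 [simp]: "geo P 0 = 0" and geo_1 [simp]: "geo P (Suc 0) = 1"
  by (simp_all add: geo_def)

lemma geo_Suc: "geo P (Suc m) = 1 + P * geo P m"
  unfolding geo_def by (subst sum.lessThan_Suc_shift) (simp add: sum_distrib_left)

lemma geo_power: "P \<noteq> 1 \<Longrightarrow> geo P (k * l) = geo P k * geo (P ^ k) l"
proof -
  assume "P \<noteq> 1"
  have "(P + 1) * geo P (k * l) = (P + 1) * (geo P k * geo (P ^ k) l)"
    unfolding mult.assoc[symmetric] geo_mult by (simp add: geo_mult power_mult)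
  then show ?thesis using \<open>P \<noteq> 1\<close> by (simp add: bit_poly_add_eq_0_iff)
qed

lemma geo_dvd: "P \<noteq> 1 \<Longrightarrow> k dvd m \<Longrightarrow> geo P k dvd geo P m"
  by (metis dvd_def geo_power)

lemma poly_geo: "poly (geo P m) a = (\<Sum>i<m. poly P a ^ i)"
  by (simp add: geo_def poly_sum)

lemma degree_geo: "degree P > 0 \<Longrightarrow> m > 0 \<Longrightarrow> degree (geo P m) = (m - 1) * degree P"
  and geo_nonzero: "degree P > 0 \<Longrightarrow> m > 0 \<Longrightarrow> geo P m \<noteq> 0"
proof -
  assume a: "degree P > 0" "m > 0"
  have "degree (P ^ m + 1) = m * degree P" using a by (subst degree_add_eq_left) auto
  moreover have *: "degree (P + 1) = degree P" using a by (subst degree_add_eq_left) auto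
  moreover show nz: "geo P m \<noteq> 0"
    using geo_mult[of P m] a calculation by auto
  ultimately have "degree P + degree (geo P m) = m * degree P"
    using geo_mult[of P m] degree_mult_eq[of "P + 1" "geo P m"] a by force
  then show "degree (geo P m) = (m - 1) * degree P"
    using a by (cases m) auto
qed

lemma dvd_power_plus_1:
  assumes "Q dvd P ^ a + 1" shows "Q dvd P ^ (a * b) + (1 :: bit poly)"
  using assms geo_mult[of "P ^ a" b] by (metis dvd_mult2 power_mult)

text \<open>Modulo \<open>Q\<close> both \<open>P ^ a\<close> and \<open>P ^ b\<close> are 1, so by
  Bezout \<open>P\<close> itself is 1.\<close>

lemma dvd_power_plus_1_coprime:
  assumes "Q dvd P ^ a + 1" "Q dvd P ^ b + 1" "coprime a b"
  shows "Q dvd P + (1 :: bit poly)"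
proof -
  have *: "Q dvd P + 1" if "Q dvd P ^ a + 1" "Q dvd P ^ b + 1" "a * x = b * y + 1" for a b x y
  proof -
    have "Q dvd P ^ (b * y + 1) + 1" "Q dvd P ^ (b * y) + 1"
      using that dvd_power_plus_1 by metis+
    then have "Q dvd (P ^ (b * y + 1) + 1) + P * (P ^ (b * y) + 1)"
      using dvd_add dvd_mult by blast
    moreover have "(P ^ (b * y + 1) + 1) + P * (P ^ (b * y) + 1) = P + 1"
      by (simp add: algebra_simps)
    ultimately show ?thesis by (simp only:)
  qed
  show ?thesis
  proof (cases "a = 0 \<or> b = 0")
    case True
    then show ?thesis using assms by auto
  next
    case False
    then obtain x y where "a * x = b * y + gcd a b" using bezout_nat[of a b] by auto
    then show ?thesis using *[of a b x y] assms by simp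
  qed
qed

text \<open>A known exponent \<open>r\<close> of \<open>P\<close> modulo \<open>Q\<close> restricts
  the \<open>m\<close> for which \<open>Q\<close> can divide the geometric sum; when
  \<open>m\<close> and \<open>r\<close> are prime it determines \<open>m\<close>.\<close>

lemma dvd_geo_imp_not_coprime:
  assumes "Q dvd geo P m" "Q dvd P ^ r + 1" "\<not> Q dvd P + 1"
  shows "\<not> coprime r m"
proof
  assume "coprime r m"
  moreover have "Q dvd P ^ m + 1" using assms(1) by (metis dvd_mult geo_mult)
  ultimately show False using dvd_power_plus_1_coprime assms by blast
qed

lemma dvd_geo_if:
  assumes "irreducible Q" "Q dvd P ^ r + 1" "\<not> Q dvd P + 1" "r dvd m" "P \<noteq> 1"
  shows "Q dvd geo P m"
proof -
  have "prime Q" using assms(1) by (simp add: prime_bit_poly_iff)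
  then have "Q dvd geo P r" using assms(2,3) by (metis geo_mult prime_dvd_mult_iff)
  then show ?thesis using geo_dvd[OF assms(5,4)] by (rule dvd_trans)
qed

lemma irreducible_dvd_irreducible:
  "irreducible (p :: bit poly) \<Longrightarrow> irreducible q \<Longrightarrow> p dvd q \<Longrightarrow> p = q"
  by (metis prime_bit_poly_iff primes_dvd_imp_eq)

lemma mersenne_prime_not_dvd_monomial:
  assumes "mersenne_prime Q" shows "\<not> Q dvd X ^ c * (X + 1) ^ d"
proof
  assume "Q dvd X ^ c * (X + 1) ^ d"
  moreover have "irreducible Q" using assms by (simp add: mersenne_prime_def)
  ultimately have "Q dvd X \<or> Q dvd X + 1"
    by (metis prime_bit_poly_iff prime_dvd_mult_iff prime_dvd_power)
  then have "Q = X \<or> Q = X + 1"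
    using \<open>irreducible Q\<close> irreducible_dvd_irreducible irreducible_X by blast
  then show False using dlog_mersenne_prime(3)[OF assms] by auto
qed

text \<open>Supplies the side condition of the arguments with exponents modulo \<open>Q\<close>: no
  Mersenne prime divides P + 1 when P is a Mersenne prime.\<close>

lemma mersenne_prime_not_dvd_mform_plus_1:
  "mersenne_prime Q \<Longrightarrow> \<not> Q dvd mform c d + 1"
  using mersenne_prime_not_dvd_monomial[of Q c d] by (simp add: mform_def add.commute)

lemma mersenne_prime_not_dvd_dlog: "mersenne_prime Q \<Longrightarrow> mersenne_prime P \<Longrightarrow> \<not> Q dvd dlog P"
  using dlog_mersenne_prime[of P] dlog_mersenne_prime[of Q] dvd_imp_degree_le[of Q "dlog P"]
  by (auto simp: mod_2_eq_odd of_bool_def split: if_splits)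

text \<open>Comes from applying \<open>euler_deriv\<close> to (P + 1) W = P^m + 1. The third claim
  is the degree gap between W and \<open>dlog W\<close>. It is even and about deg P, so it
  contradicts \<open>degree_dlog_le\<close> as soon as all prime factors of W have degree at least
  some even s above the gap.\<close>

lemma mform_times_dlog_geo:
  assumes P: "mersenne_prime P" and m: "odd m" "m > 1"
  shows "P * dlog (geo P m) = dlog P * (geo P m + 1)"
    and "dlog (geo P m) \<noteq> 0"
    and "degree (dlog (geo P m)) + 2 * (degree P div 2) = degree (geo P m)"
proof -
  obtain c d where cd: "c > 0" "d > 0" "P = mform c d" "odd c \<or> odd d"
    using P by (auto elim: mersenne_primeE)
  define W where "W = geo P m"
  define L where "L = dlog P"
  note lP = dlog_mersenne_prime[OF P]
  have nz: "P + 1 \<noteq> 0" using lP(3) by (auto simp: bit_poly_add_eq_0_iff)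
  have L: "euler_deriv P = L * (P + 1)" using cd by (simp add: L_def euler_deriv_mform dlog_mform)
  have "euler_deriv ((P + 1) * W) = euler_deriv (P ^ m + 1)" by (simp add: W_def geo_mult)
  then have "(P + 1) * (L * W + euler_deriv W) = (P + 1) * (P ^ (m - 1) * L)"
    using m(1) by (simp add: euler_deriv_mult euler_deriv_add euler_deriv_power L of_nat_bit_poly algebra_simps)
  then have 1: "L * W + euler_deriv W = P ^ (m - 1) * L" using nz by simp
  have "P * (L * W + euler_deriv W) = P ^ m * L"
    unfolding 1 using m by (simp add: mult.assoc[symmetric] flip: power_Suc)
  also have "P ^ m = (P + 1) * W + 1" unfolding W_def geo_mult by (simp add: add.assoc)
  finally have "P * euler_deriv W + P * (L * W) = L * (W + 1) + P * (L * W)" 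
    by (simp add: algebra_simps)
  then have 2: "P * euler_deriv W = L * (W + 1)" by (rule add_right_imp_eq)
  have dW: "degree W = (m - 1) * degree P" and Wnz: "W \<noteq> 0" 
    using degree_geo[of P m] geo_nonzero[of P m] lP m by (auto simp: W_def)
  have "degree W > 0" using dW m lP by simp
  then have dW1: "degree (W + 1) = degree W" by (subst degree_add_eq_left) auto
  have W1: "W + 1 \<noteq> 0" using \<open>degree W > 0\<close> dW1 by auto
  have nz': "euler_deriv W \<noteq> 0" using 2 W1 lP by (auto simp: L_def)
  have P0: "P \<noteq> 0" using lP by auto
  have deg: "degree P + degree (euler_deriv W) = degree P mod 2 + degree W"
    using arg_cong[OF 2, of degree] nz' W1 lP dW1 P0 by (simp add: degree_mult_eq L_def)
  \<comment> \<open>Since deg P >= 2 exceeds deg P mod 2, the derivative already has degree below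
    deg W and needs no reduction.\<close>
  then have "dlog W = euler_deriv W"
    unfolding dlog_def by (intro mod_poly_less) (use lP in presburger)
  then show "P * dlog (geo P m) = dlog P * (geo P m + 1)" "dlog (geo P m) \<noteq> 0"
     "degree (dlog (geo P m)) + 2 * (degree P div 2) = degree (geo P m)"
    using 2 nz' deg minus_mod_eq_mult_div[of "degree P" 2] lP
    by (simp_all add: W_def L_def)
qed

text \<open>A double factor \<open>Q\<close> of the sum divides its \<open>dlog\<close>, hence
  \<open>dlog P\<close>, which is nonzero of degree at most 1. Later this ensures that small
  factors, once split off, do not recur in the cofactor.\<close>

lemma geo_squarefree:
  assumes P: "mersenne_prime P" and m: "odd m" "m > 1" and Q: "mersenne_prime Q"
  shows "\<not> Q * Q dvd geo P m"
proof
  assume "Q * Q dvd geo P m"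
  then obtain V where V: "geo P m = Q * (Q * V)" by (auto simp: dvd_def mult.assoc)
  have "Q dvd dlog (geo P m)" unfolding V by (subst dlog_mult) (simp add: V dlog_mult)
  then have "Q dvd dlog P * geo P m + dlog P"
    using mform_times_dlog_geo(1)[OF P m] by (metis dvd_mult mult.right_neutral distrib_left)
  moreover have "Q dvd dlog P * geo P m" using V by simp
  ultimately have "Q dvd dlog P" using dvd_add_right_iff by blast
  then show False using mersenne_prime_not_dvd_dlog P Q by blast
qed

lemma not_dvd_geo_self:
  assumes "irreducible P" "m > 0" shows "\<not> P dvd geo P m"
proof
  assume "P dvd geo P m"
  moreover have "geo P m = 1 + P * geo P (m - 1)" using geo_Suc[of P "m - 1"] assms by simp
  ultimately have "P dvd 1" by (metis dvd_add_left_iff dvd_triv_left)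
  then show False using assms by auto
qed

section \<open>The involution exchanging X and X + 1\<close>

lemma bar_simps [simp]: "bar (p + q) = bar p + bar q" "bar (p * q) = bar p * bar q"
  "bar 1 = 1" "bar 0 = 0" "bar X = X + 1"
  by (simp_all add: bar_def pcompose_add pcompose_mult pcompose_1 X_def pcompose_pCons)

lemma bar_power [simp]: "bar (p ^ n) = bar p ^ n"
  by (induction n) simp_all

lemma bar_bar [simp]: "bar (bar p) = p"
proof -
  have "pcompose (pX + 1) (pX + 1) = (pX :: bit poly)"
    by (simp add: pcompose_add pcompose_pCons one_pCons)
  then show ?thesis unfolding bar_def by (simp add: pcompose_pCons flip: pcompose_assoc)
qed

lemma bar_dvd [simp]: "bar p dvd bar q \<longleftrightarrow> p dvd q"
  by (metis bar_bar bar_simps(2) dvd_def)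

lemma bar_eq_iff [simp]: "bar p = bar q \<longleftrightarrow> p = q"
  by (metis bar_bar)

lemma irreducible_bar [simp]: "irreducible (bar p) \<longleftrightarrow> irreducible p"
proof -
  have "irreducible (bar p)" if "irreducible p" for p
  proof (rule irreducibleI)
    show "bar p \<noteq> 0" using that bar_eq_iff[of p 0] by (auto simp del: bar_eq_iff)
    show "\<not> is_unit (bar p)" using that bar_eq_iff[of p 1] by (auto simp del: bar_eq_iff)
    fix a b assume "bar p = a * b"
    then have "p = bar a * bar b" by (metis bar_bar bar_simps(2))
    then show "is_unit a \<or> is_unit b" 
      using irreducibleD[OF that] by (metis bar_bar bar_simps(3) is_unit_bit_poly_iff)
  qed
  then show ?thesis by (metis bar_bar)
qed

lemma bar_mform [simp]: "bar (mform c d) = mform d c"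
  by (simp add: mform_def add.assoc mult.commute)

lemma mersenne_prime_bar [simp]: "mersenne_prime (bar Q) \<longleftrightarrow> mersenne_prime Q"
  unfolding mersenne_prime_iff irreducible_bar by (metis bar_mform bar_bar)

lemma mersenne_split_bar [simp]: "mersenne_split (bar W) \<longleftrightarrow> mersenne_split W"
  unfolding mersenne_split_def by (metis bar_bar bar_dvd bar_simps(4) irreducible_bar mersenne_prime_bar)

lemma bar_geo [simp]: "bar (geo P m) = geo (bar P) m"
  by (induction m) (simp_all add: geo_Suc)

section \<open>Geometric sums of the Mersenne primes of degree at most 4\<close>

lemma degree_1_bit_poly:
  assumes "degree (q :: bit poly) = 1" shows "q = X \<or> q = X + 1"
proof -
  obtain a b where q: "q = [:a, b:]" "b \<noteq> 0" using assms by (rule degree1_coeffs)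
  then have "q = [:a, 1:]" by simp
  then show ?thesis by (cases a) (simp_all add: X_def one_pCons)
qed

lemma irreducible_degree_2_bit_poly:
  assumes "irreducible (q :: bit poly)" "degree q = 2" shows "q = mform 1 1"
proof -
  obtain a b c where q: "q = [:a, b, c:]" "c \<noteq> 0" using assms(2) by (rule degree2_coeffs)
  have "poly q 0 \<noteq> 0" "poly q 1 \<noteq> 0"
    using irreducible_dvd_irreducible[OF _ assms(1)] assms(2) by (force simp flip: X_dvd_iff X1_dvd_iff)+
  then have "q = [:1, 1, 1:]" using q by (cases a; cases b) simp_all
  then show ?thesis by (simp add: mform_def X_def one_pCons)
qed

text \<open>A proper factorisation in degree at most 5 has a factor of degree at most 2, and the
  irreducible ones are X, X + 1 and \<open>mform 1 1\<close>; the last matters only from degree 4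
  on.\<close>

lemma irreducible_bit_polyI:
  assumes "degree (p :: bit poly) \<in> {1..5}" "\<not> X dvd p" "\<not> X + 1 dvd p" "\<not> mform 1 1 dvd p \<or> degree p \<le> 3"
  shows "irreducible p"
proof (rule irreducibleI)
  show "p \<noteq> 0" "\<not> p dvd 1" using assms(1) by auto
  fix a b assume p: "p = a * b"
  have small: "a = 1" if "p = a * b" "degree a \<le> degree b" for a b
  proof (rule ccontr)
    assume "a \<noteq> 1"
    have nz: "a \<noteq> 0" "b \<noteq> 0" using that \<open>p \<noteq> 0\<close> by auto
    then obtain q where q: "irreducible q" "q dvd a"
      using exists_irreducible_dvd_bit_poly \<open>a \<noteq> 1\<close> by blast
    have d: "degree q \<le> degree a" "degree p = degree a + degree b"
      using nz q(2) that by (auto simp: dvd_imp_degree_le degree_mult_eq)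
    have "degree q \<noteq> 0" using q(1) by (auto simp: degree_eq_0_bit_poly_iff)
    then have "degree q = 1 \<or> degree q = 2 \<and> degree p > 3" using d assms(1) that(2) by simp linarith
    then show False
      using assms(2-4) q that degree_1_bit_poly[of q] irreducible_degree_2_bit_poly[of q]
      by (metis dvd_mult2 not_less)
  qed
  show "a dvd 1 \<or> b dvd 1" using small[of a b] small[of b a] p by (metis dvd_refl mult.commute nle_le)
qed

text \<open>Coefficient lists turn divisibility between fixed polynomials into evaluation.\<close>

lemma mform_explicit:
  "mform (Suc 0) (Suc 0) = [:1, 1, 1:]"
  "mform (Suc 0) 2 = [:1, 1, 0, 1:]"
  "mform 2 (Suc 0) = [:1, 0, 1, 1:]"
  "mform (Suc 0) 3 = [:1, 1, 1, 1, 1:]"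
  "mform 3 (Suc 0) = [:1, 0, 0, 1, 1:]"
  "mform 2 3 = [:1, 0, 1, 1, 1, 1:]"
  "mform 3 2 = [:1, 0, 0, 1, 0, 1:]"
  "mform (Suc 0) 4 = [:1, 1, 0, 0, 0, 1:]"
  "mform 4 (Suc 0) = [:1, 0, 0, 0, 1, 1:]"
  by (simp_all add: mform_def X_def one_pCons numeral_eq_Suc)

lemma mform_eq_iff [simp]: "mform c d = mform c' d' \<longleftrightarrow> c = c' \<and> d = d'"
proof
  assume eq: "mform c d = mform c' d'"
  then have *: "X ^ c * (X + 1) ^ d = X ^ c' * (X + 1) ^ d'" by (simp add: mform_def)
  then have deg: "c + d = c' + d'" by (metis degree_X_power_X1_power)
  have no: "\<not> c < c'" if "X ^ c * (X + 1) ^ d = X ^ c' * (X + 1) ^ d'" for c c' d d'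
  proof
    assume "c < c'"
    then have "X ^ c' = X ^ c * X ^ (c' - c)" by (simp flip: power_add)
    with that have "(X + 1) ^ d = X ^ (c' - c) * (X + 1) ^ d'" by (simp add: mult.assoc)
    then have "poly ((X + 1) ^ d) 0 = poly (X ^ (c' - c) * (X + 1) ^ d') 0" by simp
    then show False using \<open>c < c'\<close> by (simp add: power_0_left)
  qed
  show "c = c' \<and> d = d'" using no[OF *] no[OF *[symmetric]] deg by linarith
qed simp

lemma irreducible_mform [simp]:
  "irreducible (mform (Suc 0) (Suc 0))" "irreducible (mform (Suc 0) 2)" "irreducible (mform (Suc 0) 3)"
proof -
  have *: "\<not> mform 1 1 dvd mform 1 3" unfolding mform_explicit One_nat_def by code_simp
  show "irreducible (mform (Suc 0) (Suc 0))" "irreducible (mform (Suc 0) 2)" "irreducible (mform (Suc 0) 3)"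
    by (rule irreducible_bit_polyI; use * in \<open>simp add: degree_mform X_dvd_iff X1_dvd_iff\<close>; simp add: mform_def)+
qed

lemma irreducible_mform' [simp]: "irreducible (mform 2 (Suc 0))" "irreducible (mform 3 (Suc 0))"
  by (metis irreducible_mform(2,3) irreducible_bar bar_mform)+

lemma mersenne_prime_mform_iff: "c > 0 \<Longrightarrow> d > 0 \<Longrightarrow> mersenne_prime (mform c d) \<longleftrightarrow> irreducible (mform c d)"
  by (auto simp: mersenne_prime_iff)

lemma mersenne_prime_degree_less_4:
  assumes "mersenne_prime Q" "degree Q < 4"
  shows "Q \<in> {mform 1 1, mform 1 2, mform 2 1}"
proof -
  obtain c d where cd: "c > 0" "d > 0" "Q = mform c d" using assms(1) by (rule mersenne_primeE)
  then have "c + d < 4" using assms(2) by (simp add: degree_mform)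
  then have "c = 1 \<and> d = 1 \<or> c = 1 \<and> d = 2 \<or> c = 2 \<and> d = 1" using cd by presburger
  then show ?thesis using cd by auto
qed

lemma mersenne_prime_degree_less_6:
  assumes "mersenne_prime Q" "degree Q < 6"
  shows "Q \<in> {mform 1 1, mform 1 2, mform 2 1, mform 1 3, mform 3 1, mform 2 3, mform 3 2}"
proof -
  obtain c d where cd: "c > 0" "d > 0" "Q = mform c d" "irreducible Q" and odd: "odd c \<or> odd d"
    using assms(1) by (rule mersenne_primeE)
  \<comment> \<open>The two forms of degree 5 with an exponent 1 are reducible; (2, 2) is excluded
    by parity.\<close>
  have *: "mform 1 1 dvd mform 1 4" "mform 1 1 dvd mform 4 1"
    unfolding mform_explicit One_nat_def by code_simp+
  have "\<not> (c = 1 \<and> d = 4)" "\<not> (c = 4 \<and> d = 1)"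
    using * irreducible_dvd_irreducible[of "mform 1 1" "mform c d"] cd
     degree_mform[of 1 1] degree_mform[of c d] by auto
  moreover have "c + d < 6" using assms(2) cd by (simp add: degree_mform)
  then have "c \<in> {1,2,3,4}" "d \<in> {1,2,3,4}" "c + d < 6" using cd by auto
  ultimately show ?thesis using cd odd by auto
qed

text \<open>\<open>G\<close> collects the small prime factors, whose \<open>dlog\<close> is computed
  exactly and may profit from cancellation; \<open>K\<close> has only large ones, for which the
  general bound suffices.\<close>

lemma degree_dlog_mult_le:
  assumes "mersenne_split (G * K)" "\<And>q. irreducible q \<Longrightarrow> q dvd K \<Longrightarrow> degree q \<ge> s" "even s"
    and "degree (dlog G) + t \<le> degree G" "t \<le> s"
  shows "degree (dlog (G * K)) + t \<le> degree (G * K)"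
proof -
  have nz: "G \<noteq> 0" "K \<noteq> 0" using assms(1) by (auto simp: mersenne_split_def)
  have "mersenne_split K" using assms(1) mersenne_split_dvd by (metis dvd_triv_right)
  note K = degree_dlog_le[OF this assms(2,3)]
  have 1: "degree (dlog G * K) + t \<le> degree G + degree K"
    using degree_mult_le[of "dlog G" K] assms(4) by linarith
  have 2: "degree (G * dlog K) + t \<le> degree G + degree K"
  proof (cases "dlog K = 0")
    case False
    then show ?thesis using K nz assms(5) by (simp add: degree_mult_eq)
  qed (use assms(4) in simp)
  have "degree (dlog (G * K)) \<le> max (degree (dlog G * K)) (degree (G * dlog K))"
    unfolding dlog_mult by (rule degree_add_le_max)
  then show ?thesis using 1 2 nz by (simp add: degree_mult_eq)
qed

lemma mersenne_split_irreducible_dvd: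
  "mersenne_split W \<Longrightarrow> irreducible q \<Longrightarrow> q dvd W \<Longrightarrow> mersenne_prime q"
  by (simp add: mersenne_split_def)

lemma coprime_irreducible_bit_poly:
  "irreducible (p :: bit poly) \<Longrightarrow> irreducible q \<Longrightarrow> p \<noteq> q \<Longrightarrow> coprime p q"
  by (simp add: primes_coprime prime_bit_poly_iff)

text \<open>A cancellation: each factor alone has a \<open>dlog\<close> of degree 1, only 2 below
  its own degree, but for the pair the gap is 6.\<close>

lemma dlog_mform_1_2_mform_2_1: "dlog (mform 1 2 * mform 2 1) = 1"
  by (simp add: dlog_mult dlog_mform lform_def) (simp add: mform_explicit X_def one_pCons)

lemma coprime_mform_1_2_mform_2_1: "coprime (mform 1 2) (mform 2 1)"
  using irreducible_mform(2) irreducible_mform'(1)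
  by (intro coprime_irreducible_bit_poly) (simp_all add: mform_explicit)

text \<open>The gap of the sum is exactly 2. Factors of degree at least 4 force gap 4, and the two
  primes of degree 3 occur together, with gap 6; so every composition of the sum contradicts gap
  2.\<close>

lemma mersenne_split_geo_M1:
  assumes "mersenne_split (geo (mform 1 1) m)" "odd m" shows "m = 1"
proof (rule ccontr)
  let ?P = "mform 1 1" let ?W = "geo ?P m"
  assume "m \<noteq> 1"
  then have m: "odd m" "m > 1" using assms(2) by (auto elim!: oddE)
  have P: "mersenne_prime ?P" by (simp add: mersenne_prime_mform_iff)
  note dW = mform_times_dlog_geo(2,3)[OF P m]
  have dP: "degree ?P = 2" by (simp add: degree_mform)
  have nP: "\<not> ?P dvd ?W" using not_dvd_geo_self[of ?P m] m by simp
  \<comment> \<open>The base \<open>mform 1 1\<close> is fixed by \<open>bar\<close>, hence so is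
    its geometric sum.\<close>
  have sym: "mform 1 2 dvd ?W \<longleftrightarrow> mform 2 1 dvd ?W"
    by (metis bar_dvd bar_geo bar_mform)
  show False
  proof (cases "mform 1 2 dvd ?W")
    case True
    then obtain K where K: "?W = mform 1 2 * mform 2 1 * K"
      using sym divides_mult[of "mform 1 2" ?W "mform 2 1"] coprime_mform_1_2_mform_2_1
      by (auto elim: dvdE)
    have "degree q \<ge> 4" if "irreducible q" "q dvd K" for q
    proof (rule ccontr)
      assume "\<not> 4 \<le> degree q"
      moreover have mq: "mersenne_prime q"
        using mersenne_split_irreducible_dvd[OF assms(1) that(1)] that(2) K by simp
      ultimately have q: "q \<in> {?P, mform 1 2, mform 2 1}"
        by (intro mersenne_prime_degree_less_4) auto
      have "\<not> q * q dvd ?W" using geo_squarefree[OF P m mq] .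
      moreover have "q * q dvd ?W" if "q = mform 1 2 \<or> q = mform 2 1"
        using that \<open>q dvd K\<close> unfolding K by (auto intro: mult_dvd_mono simp: mult.assoc mult.left_commute[of _ "mform 2 1"])
      ultimately show False using q nP \<open>q dvd K\<close> K by auto
    qed
    moreover have "degree (dlog (mform 1 2 * mform 2 1)) + 4 \<le> degree (mform 1 2 * mform 2 1)"
      unfolding dlog_mform_1_2_mform_2_1 by (simp add: degree_mult_eq mform_nonzero degree_mform)
    ultimately have "degree (dlog ?W) + 4 \<le> degree ?W"
      using degree_dlog_mult_le[of "mform 1 2 * mform 2 1" K 4 4] assms(1) unfolding K by simp
    then show False using dW(2) dP by simp
  next
    case False
    have "degree q \<ge> 4" if "irreducible q" "q dvd ?W" for q
      using mersenne_prime_degree_less_4[of q] mersenne_split_irreducible_dvd[OF assms(1) that] False sym nP that(2)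
      by force
    then show False using degree_dlog_le[of ?W 4] assms(1) dW dP by auto
  qed
qed

text \<open>Coefficients in the field with two elements are fixed by Frobenius, so
  \<open>P ^ (2 ^ k)\<close> is P evaluated at X^(2^k), which is congruent to P.\<close>

lemma frobenius_dvd:
  assumes "Q dvd X ^ (2 ^ k) + X" shows "Q dvd P ^ (2 ^ k) + P"
proof (induction P)
  case (pCons a P)
  have "pCons a P = [:a:] + X * P" by (simp add: X_def)
  moreover have "[:a:] ^ (2 ^ k) = [:a:]" by (cases a) (simp_all add: power_0_left one_pCons[symmetric])
  ultimately have "pCons a P ^ (2 ^ k) + pCons a P = X ^ (2 ^ k) * (P ^ (2 ^ k) + P) + (X ^ (2 ^ k) + X) * P"
    by (simp add: power_2_power_add_bit_poly power_mult_distrib algebra_simps)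
  then show ?case using pCons.IH assms by (metis dvd_add dvd_mult dvd_mult2)
qed (simp add: power_0_left)

lemma X_power_eq_monom: "X ^ n = monom 1 n"
  by (induction n) (simp_all add: X_def monom_Suc monom_0 one_pCons)

text \<open>The exponents 2, 3, 4, 5 are the degrees of the four divisors. They give exponents 3, 7,
  15, 31 for residues modulo these polynomials.\<close>

lemma dvd_X_power_2_power:
  "mform 1 1 dvd X ^ (2 ^ 2) + X" "mform 1 2 dvd X ^ (2 ^ 3) + X" "mform 3 1 dvd X ^ (2 ^ 4) + X"
  "mform 2 3 dvd X ^ (2 ^ 5) + X"
proof -
  have *: "X ^ 4 = [:0, 0, 0, 0, 1:]" "X ^ 8 = [:0, 0, 0, 0, 0, 0, 0, 0, 1:]"
    "X ^ 16 = [:0, 0, 0, 0, 0, 0, 0, 0, 0, 0, 0, 0, 0, 0, 0, 0, 1:]"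
    "X ^ 32 =
      [:0, 0, 0, 0, 0, 0, 0, 0, 0, 0, 0, 0, 0, 0, 0, 0, 0, 0, 0, 0, 0, 0, 0, 0, 0, 0, 0, 0, 0, 0, 0, 0, 1:]"
    unfolding X_power_eq_monom by (simp_all add: numeral_eq_Suc monom_Suc monom_0)
  have "mform 1 1 dvd X ^ 4 + X" "mform 1 2 dvd X ^ 8 + X" "mform 3 1 dvd X ^ 16 + X" "mform 2 3 dvd X ^ 32 + X"
    unfolding * unfolding mform_explicit One_nat_def unfolding X_def by code_simp+
  then show "mform 1 1 dvd X ^ (2 ^ 2) + X" "mform 1 2 dvd X ^ (2 ^ 3) + X"
    "mform 3 1 dvd X ^ (2 ^ 4) + X" "mform 2 3 dvd X ^ (2 ^ 5) + X"
    by simp_all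
qed

lemma dvd_power_2_power_minus_1:
  assumes "irreducible Q" "\<not> Q dvd P" "Q dvd X ^ (2 ^ k) + X"
  shows "Q dvd P ^ (2 ^ k - 1) + 1"
proof -
  have "P ^ (2 ^ k) + P = P * (P ^ (2 ^ k - 1) + 1)"
    by (simp add: algebra_simps flip: power_Suc)
  then show ?thesis using frobenius_dvd[OF assms(3), of P] assms(1,2)
    by (metis prime_bit_poly_iff prime_dvd_mult_iff)
qed

lemma mform_bar_dvd: "mform c d dvd W \<longleftrightarrow> mform d c dvd bar W"
  by (metis bar_dvd bar_mform)

lemma mform_1_2_power_7: 
  assumes "mersenne_prime P" "P \<notin> {mform 1 2, mform 2 1}"
  shows "mform 1 2 dvd P ^ 7 + 1" "mform 2 1 dvd P ^ 7 + 1"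
proof -
  have *: "mform 1 2 dvd P ^ 7 + 1" if "mersenne_prime P" "P \<noteq> mform 1 2" for P
  proof -
    have "\<not> mform 1 2 dvd P"
      using that irreducible_dvd_irreducible[of "mform 1 2" P] by (auto simp: mersenne_prime_def)
    then show ?thesis
      using dvd_power_2_power_minus_1[of "mform 1 2" P 3] dvd_X_power_2_power(2) by simp
  qed
  show "mform 1 2 dvd P ^ 7 + 1" using * assms by simp
  have "bar P \<noteq> mform 1 2" using assms(2) by (metis bar_bar bar_mform insertCI)
  then have "mform 1 2 dvd bar P ^ 7 + 1" using assms(1) by (intro *) simp_all
  then show "mform 2 1 dvd P ^ 7 + 1" by (simp add: mform_bar_dvd[of 2])
qed

lemma not_coprime_prime_nat: "prime (p :: nat) \<Longrightarrow> prime r \<Longrightarrow> \<not> coprime r p \<Longrightarrow> p = r"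
  by (metis primes_coprime)

text \<open>The gap is 4, so some prime factor has degree below 6. Each candidate has a known
  exponent, and since \<open>p\<close> is prime this determines \<open>p\<close> and all the other
  small factors. The \<open>dlog\<close> of their product then contradicts gap 4.\<close>

lemma mersenne_split_geo_M3_prime:
  assumes split: "mersenne_split (geo (mform 1 3) p)" and p: "prime p" "odd p" shows False
proof -
  let ?P = "mform 1 3" let ?W = "geo ?P p"
  have m: "odd p" "p > 1" using p prime_gt_1_nat by auto
  have P: "mersenne_prime ?P" by (simp add: mersenne_prime_mform_iff)
  note dW = mform_times_dlog_geo(2,3)[OF P m]
  have dP: "degree ?P = 4" by (simp add: degree_mform)
  then have dW4: "degree (dlog ?W) + 4 = degree ?W" using dW by simp
  have nP: "\<not> ?P dvd ?W" using not_dvd_geo_self[of ?P p] m by simp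
  have nP1: "\<not> Q dvd ?P + 1" if "mersenne_prime Q" for Q
    using mersenne_prime_not_dvd_mform_plus_1[OF that] by simp
  have mp: "mersenne_prime q" if "irreducible q" "q dvd ?W" for q
    using mersenne_split_irreducible_dvd[OF split that] .
  have PX: "?P \<noteq> 1" by (rule mform_neq_1) simp
  have ord: "p = r" if "mersenne_prime Q" "Q dvd ?W" "Q dvd ?P ^ r + 1" "prime r" for Q r
    using dvd_geo_imp_not_coprime[OF that(2,3) nP1] that not_coprime_prime_nat p by blast
  have irr: "irreducible Q" if "mersenne_prime Q" for Q using that by (simp add: mersenne_prime_def)
  have ne: "\<not> Q dvd ?P" if "mersenne_prime Q" "Q \<noteq> ?P" for Q
    using irreducible_dvd_irreducible[OF irr irr] that P by blast
  have d3: "mform 1 1 dvd ?P ^ 3 + 1"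
    using dvd_power_2_power_minus_1[of "mform 1 1" ?P 2] dvd_X_power_2_power(1) ne[of "mform 1 1"]
    by (simp add: mersenne_prime_mform_iff)
  have d7: "mform 1 2 dvd ?P ^ 7 + 1" "mform 2 1 dvd ?P ^ 7 + 1"
    using mform_1_2_power_7[OF P] by (simp_all)
  have d31: "Q dvd ?P ^ 31 + 1" if "mersenne_prime Q" "Q = mform 2 3 \<or> Q = mform 3 2" for Q
  proof (cases "Q = mform 2 3")
    case True
    then show ?thesis
      using dvd_power_2_power_minus_1[of Q ?P 5] irr[OF that(1)] dvd_X_power_2_power(4) ne[OF that(1)]
      by (simp)
  next
    case False
    then have Q: "Q = mform 3 2" using that by simp
    have "\<not> mform 2 3 dvd bar ?P" using ne[OF that(1)] by (simp add: Q mform_bar_dvd[of 2])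
    moreover have "irreducible (mform 2 3)" using irr[OF that(1)] unfolding Q by (metis bar_mform irreducible_bar)
    ultimately show ?thesis
      using dvd_power_2_power_minus_1[of "mform 2 3" "bar ?P" 5] dvd_X_power_2_power(4)
      by (simp add: Q mform_bar_dvd[of 3])
  qed
  \<comment> \<open>Here the exponent 15 is composite and leaves p = 3 and p = 5; both are refuted
    by direct division.\<close>
  have n31: "\<not> mform 3 1 dvd ?W"
  proof
    assume a: "mform 3 1 dvd ?W"
    have m31: "mersenne_prime (mform 3 1)" by (simp add: mersenne_prime_mform_iff)
    have "mform 3 1 dvd ?P ^ 15 + 1"
      using dvd_power_2_power_minus_1[of "mform 3 1" ?P 4] dvd_X_power_2_power(3) ne[OF m31]
      by (simp)
    then have "\<not> coprime (3 * 5) p" using dvd_geo_imp_not_coprime[OF a _ nP1[OF m31]] by simp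
    then have "p = 3 \<or> p = 5"
      unfolding coprime_mult_left_iff
      using p(1) not_coprime_prime_nat[of p 3] not_coprime_prime_nat[of p 5] by auto
    moreover have "mform 3 1 dvd ?P ^ p + 1" using a by (metis dvd_mult geo_mult)
    moreover have "?P ^ 3 + 1 = [:0, 1, 0, 0, 1, 0, 1, 0, 1, 0, 0, 1, 1:]" "?P ^ 5 + 1 =
      [:0, 1, 1, 1, 0, 1, 1, 1, 0, 1, 1, 1, 0, 1, 1, 1, 0, 1, 1, 1, 1:]"
      unfolding mform_explicit One_nat_def by (simp_all add: numeral_eq_Suc one_pCons)
    moreover have "\<not> mform 3 1 dvd [:0, 1, 0, 0, 1, 0, 1, 0, 1, 0, 0, 1, 1:]" "\<not> mform 3 1 dvd [:0, 1, 1, 1, 0, 1, 1, 1, 0, 1, 1, 1, 0, 1, 1, 1, 0, 1, 1, 1, 1:]"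
      unfolding mform_explicit One_nat_def by code_simp+
    ultimately show False by auto
  qed
  have sq: "\<not> q * q dvd ?W" if "mersenne_prime q" for q using geo_squarefree[OF P m that] .
  have cases: "q = mform 1 1 \<and> p = 3 \<or> q \<in> {mform 1 2, mform 2 1} \<and> p = 7 \<or> q \<in> {mform 2 3, mform 3 2} \<and> p = 31"
    if "irreducible q" "q dvd ?W" "degree q < 6" for q
  proof -
    note mq = mp[OF that(1,2)]
    have p31: "prime (31 :: nat)" "prime (7 :: nat)" "prime (3 :: nat)" by simp_all
    have "q \<in> {mform 1 1, mform 1 2, mform 2 1, mform 2 3, mform 3 2}"
      using mersenne_prime_degree_less_6[OF mq that(3)] that(2) nP n31 by auto
    then show ?thesis using ord[OF mq that(2)] d3 d7 d31[OF mq] p31 by auto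
  qed
  have "\<exists>q. irreducible q \<and> q dvd ?W \<and> degree q < 6"
  proof (rule ccontr)
    assume "\<not> ?thesis"
    then have "degree q \<ge> 6" if "irreducible q" "q dvd ?W" for q using that by force
    then show False using degree_dlog_le[OF split, of 6] dW(1) dW4 by auto
  qed
  then obtain q where q: "irreducible q" "q dvd ?W" "degree q < 6" by blast
  \<comment> \<open>Conjugate primes have the same exponent, so both divide the sum. Once their
    product has gap 6 and the remaining factors have degree at least 6, the whole sum has gap 6
    instead of 4.\<close>
  have pair: False if g: "mform c d dvd ?W" "mform d c dvd ?W" "coprime (mform c d) (mform d c)" 
      "degree (dlog (mform c d * mform d c)) + 6 \<le> degree (mform c d * mform d c)"
      and only: "\<And>q. irreducible q \<Longrightarrow> q dvd ?W \<Longrightarrow> degree q < 6 \<Longrightarrow> q \<in> {mform c d, mform d c}" for c d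
  proof -
    obtain K where K: "?W = mform c d * mform d c * K"
      using divides_mult[OF g(1,2,3)] by (auto elim: dvdE)
    have "degree q \<ge> 6" if "irreducible q" "q dvd K" for q
    proof (rule ccontr)
      assume "\<not> 6 \<le> degree q"
      have "q dvd ?W" using that(2) K by simp
      then have "q = mform c d \<or> q = mform d c" using only[OF that(1)] \<open>\<not> 6 \<le> degree q\<close> by auto
      then have "q * q dvd ?W"
        using \<open>q dvd K\<close> unfolding K by (auto intro: mult_dvd_mono simp: mult.assoc mult.left_commute[of _ "mform d c"])
      then show False using sq[OF mp[OF that(1) \<open>q dvd ?W\<close>]] by simp
    qed
    then have "degree (dlog ?W) + 6 \<le> degree ?W"
      using degree_dlog_mult_le[of "mform c d * mform d c" K 6 6] split g(4) unfolding K by simp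
    then show False using dW4 by simp
  qed
  from cases[OF q] consider "p = 3" "q = mform 1 1" | "p = 7" | "p = 31" "q \<in> {mform 2 3, mform 3 2}" by blast
  then show False
  proof cases
    case 1
    then obtain K where K: "?W = mform 1 1 * K" using q by (auto elim: dvdE)
    have "degree q \<ge> 4" if "irreducible q" "q dvd K" for q
    proof (rule ccontr)
      assume "\<not> 4 \<le> degree q"
      have W: "q dvd ?W" using that(2) K by simp
      then have "q = mform 1 1" using cases[OF that(1)] \<open>\<not> 4 \<le> degree q\<close> 1 by auto
      then have "q * q dvd ?W" using \<open>q dvd K\<close> unfolding K by (auto intro: mult_dvd_mono)
      then show False using sq[OF mp[OF that(1) W]] by simp
    qed
    moreover have "mersenne_split K" using split mersenne_split_dvd K by (metis dvd_triv_right)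
    ultimately have dK: "dlog K = 0 \<or> degree (dlog K) + 4 \<le> degree K"
      using degree_dlog_le[of K 4] by simp
    have nz: "?W \<noteq> 0" "K \<noteq> 0" using split K by (auto simp: mersenne_split_def)
    \<comment> \<open>In \<open>dlog W = K + mform 1 1 * dlog K\<close> the term K dominates, so the
      gap is only 2.\<close>
    have "dlog (mform 1 1) = 1" by (simp add: dlog_mform lform_def add.commute)
    then have "dlog ?W = K + mform 1 1 * dlog K" unfolding K dlog_mult by simp
    then have "K = dlog ?W + mform 1 1 * dlog K" by (simp add: add.assoc)
    then have "degree K \<le> max (degree (dlog ?W)) (degree (mform 1 1 * dlog K))" by (metis degree_add_le_max)
    moreover have "degree ?W = degree K + 2"
      using nz unfolding K by (simp add: degree_mult_eq degree_mform)
    moreover have "degree (mform 1 1 * dlog K) < degree K \<or> dlog K = 0"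
      using dK by (cases "dlog K = 0") (auto simp: degree_mult_eq degree_mform mform_nonzero)
    ultimately show False using dW4 by auto
  next
    case 2
    have "mform 1 2 dvd ?W" "mform 2 1 dvd ?W"
      using dvd_geo_if[OF _ d7(1) nP1, of p] dvd_geo_if[OF _ d7(2) nP1, of p] PX 2
      by (simp_all add: mersenne_prime_mform_iff)
    moreover have "degree (dlog (mform 1 2 * mform 2 1)) + 6 \<le> degree (mform 1 2 * mform 2 1)"
      unfolding dlog_mform_1_2_mform_2_1 by (simp add: degree_mult_eq mform_nonzero degree_mform)
    ultimately show False using pair[of 1 2] coprime_mform_1_2_mform_2_1 cases 2 by fastforce
  next
    case 3
    have "mersenne_prime q" using mp q by blast
    then have mq: "mersenne_prime (mform 2 3)" "mersenne_prime (mform 3 2)"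
      using 3 mersenne_prime_bar[of "mform 2 3"] by (auto simp del: mersenne_prime_bar)
    have "mform 2 3 dvd ?W" "mform 3 2 dvd ?W"
      using dvd_geo_if[OF _ d31 nP1, of "mform 2 3" p] dvd_geo_if[OF _ d31 nP1, of "mform 3 2" p] PX 3 mq irr
      by simp_all
    moreover have "coprime (mform 2 3) (mform 3 2)"
      using irr mq by (intro coprime_irreducible_bit_poly) (simp_all)
    moreover have "dlog (mform 2 3 * mform 3 2) = [:1, 0, 1, 0, 1:]"
      by (simp add: dlog_mult dlog_mform lform_def) (simp add: mform_explicit X_def one_pCons)
    then have "degree (dlog (mform 2 3 * mform 3 2)) + 6 \<le> degree (mform 2 3 * mform 3 2)"
      by (simp add: degree_mult_eq mform_nonzero degree_mform)
    ultimately show False using pair[of 2 3] cases 3 by fastforce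
  qed
qed

lemma mersenne_split_geo_M3:
  assumes "mersenne_split (geo (mform 1 3) m)" "odd m" shows "m = 1"
proof (rule ccontr)
  assume "m \<noteq> 1"
  then obtain p where p: "prime p" "p dvd m" using prime_factor_nat by blast
  have "mform 1 3 \<noteq> 1" by (rule mform_neq_1) simp
  then have "mersenne_split (geo (mform 1 3) p)"
    using assms(1) geo_dvd[OF _ p(2)] mersenne_split_dvd by blast
  then show False using mersenne_split_geo_M3_prime[OF _ p(1)] p(2) assms(2) by auto
qed

text \<open>Without Mersenne divisors of at most half its degree, a splitting \<open>K\<close> would
  itself be a Mersenne prime. Then \<open>K + 1\<close> would be a monomial in X and X + 1, which
  \<open>q\<close> cannot divide.\<close>

lemma not_mersenne_splitI:
  assumes K: "degree K > 0" and small: "\<And>c d. c > 0 \<Longrightarrow> d > 0 \<Longrightarrow> 2 * (c + d) \<le> degree K \<Longrightarrow> \<not> mform c d dvd K"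
    and not: "mersenne_prime q" "q dvd K + 1"
  shows "\<not> mersenne_split K"
proof
  assume split: "mersenne_split K"
  have "K \<noteq> 0" "K \<noteq> 1" using K by auto
  have big: "degree K < 2 * degree q" if q: "irreducible q" "q dvd K" for q
  proof -
    obtain c d where "c > 0" "d > 0" "q = mform c d"
      using mersenne_split_irreducible_dvd[OF split q] by (auto elim: mersenne_primeE)
    then show ?thesis using small[of c d] q by (force simp: degree_mform)
  qed
  obtain q V where q: "irreducible q" "K = q * V" 
    using exists_irreducible_dvd_bit_poly[OF \<open>K \<noteq> 0\<close> \<open>K \<noteq> 1\<close>] by (metis dvdE)
  then have nz: "q \<noteq> 0" "V \<noteq> 0" using \<open>K \<noteq> 0\<close> by auto
  have "V = 1"
  proof (rule ccontr)
    assume "V \<noteq> 1"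
    then obtain r where r: "irreducible r" "r dvd V" using exists_irreducible_dvd_bit_poly nz by blast
    then have "degree r \<le> degree V" using nz by (simp add: dvd_imp_degree_le)
    moreover have "degree K = degree q + degree V" using nz by (simp add: q degree_mult_eq)
    ultimately show False using big[OF q(1)] big[OF r(1)] q(2) r(2) by simp
  qed
  then have "mersenne_prime K" using q mersenne_split_irreducible_dvd[OF split] by auto
  then show False using not mersenne_prime_not_dvd_mform_plus_1[OF not(1)] by (auto elim: mersenne_primeE)
qed

text \<open>T^3 + T^2 + 1 is one of the two cubic factors of 1 + T + ... + T^6, taken here at T =
  \<open>mform 1 2\<close>. Degree 9 leaves divisors of degree at most 4 to test.\<close>

lemma not_mersenne_split_M2_7: "\<not> mersenne_split (mform 1 2 ^ 3 + mform 1 2 ^ 2 + 1)"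
proof -
  let ?K = "mform 1 2 ^ 3 + mform 1 2 ^ 2 + 1"
  have K: "?K = [:1, 1, 0, 0, 0, 1, 0, 1, 0, 1:]"
    unfolding mform_explicit One_nat_def by (simp add: numeral_eq_Suc one_pCons)
  then have dK: "degree ?K = 9" by simp
  show ?thesis
  proof (rule not_mersenne_splitI)
    show "degree ?K > 0" unfolding dK by simp
    show "mersenne_prime (mform 1 2)" by (simp add: mersenne_prime_mform_iff)
    show "mform 1 2 dvd ?K + 1" by (simp add: add.assoc numeral_eq_Suc)
    fix c d :: nat assume "c > 0" "d > 0" "2 * (c + d) \<le> degree ?K"
    then have "2 * (c + d) \<le> 9" unfolding dK by simp
    with \<open>c > 0\<close> \<open>d > 0\<close> have cd: "c \<in> {1,2,3}" "d \<in> {1,2,3}" "c + d \<le> 4" by auto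
    have "\<not> mform 1 1 dvd ?K" "\<not> mform 1 2 dvd ?K" "\<not> mform 2 1 dvd ?K" "\<not> mform 1 3 dvd ?K"
      "\<not> mform 3 1 dvd ?K" "\<not> mform 2 2 dvd ?K"
      unfolding K by (simp add: mform_def X_def one_pCons numeral_eq_Suc, code_simp)+
    then show "\<not> mform c d dvd ?K" using cd by auto
  qed
qed

text \<open>T^6 + T^3 + 1 is the ninth cyclotomic polynomial, the quotient of the sums with 9 and 3
  terms. Degree 18 requires all forms of degree at most 9.\<close>

lemma not_mersenne_split_M2_9: "\<not> mersenne_split (mform 1 2 ^ 6 + mform 1 2 ^ 3 + 1)"
proof -
  let ?K = "mform 1 2 ^ 6 + mform 1 2 ^ 3 + 1"
  have K: "?K =
    [:1, 1, 0, 0, 1, 1, 1, 1, 0, 1, 1, 0, 1, 0, 1, 0, 0, 0, 1:]"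
    unfolding mform_explicit One_nat_def by (simp add: numeral_eq_Suc one_pCons)
  then have dK: "degree ?K = 18" by simp
  show ?thesis
  proof (rule not_mersenne_splitI)
    show "degree ?K > 0" unfolding dK by simp
    show "mersenne_prime (mform 1 2)" by (simp add: mersenne_prime_mform_iff)
    show "mform 1 2 dvd ?K + 1" by (simp add: add.assoc numeral_eq_Suc)
    fix c d :: nat assume "c > 0" "d > 0" "2 * (c + d) \<le> degree ?K"
    then have "2 * (c + d) \<le> 18" unfolding dK by simp
    with \<open>c > 0\<close> \<open>d > 0\<close> have cd: "c \<in> {1,2,3,4,5,6,7,8}" "d \<in> {1,2,3,4,5,6,7,8}" "c + d \<le> 9" by auto
    have "\<not> mform 1 1 dvd ?K"
      "\<not> mform 1 2 dvd ?K"
      "\<not> mform 2 1 dvd ?K"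
      "\<not> mform 1 3 dvd ?K"
      "\<not> mform 2 2 dvd ?K"
      "\<not> mform 3 1 dvd ?K"
      "\<not> mform 1 4 dvd ?K"
      "\<not> mform 2 3 dvd ?K"
      "\<not> mform 3 2 dvd ?K"
      "\<not> mform 4 1 dvd ?K"
      "\<not> mform 1 5 dvd ?K"
      "\<not> mform 2 4 dvd ?K"
      "\<not> mform 3 3 dvd ?K"
      "\<not> mform 4 2 dvd ?K"
      "\<not> mform 5 1 dvd ?K"
      "\<not> mform 1 6 dvd ?K"
      "\<not> mform 2 5 dvd ?K"
      "\<not> mform 3 4 dvd ?K"
      "\<not> mform 4 3 dvd ?K"
      "\<not> mform 5 2 dvd ?K"
      "\<not> mform 6 1 dvd ?K"
      "\<not> mform 1 7 dvd ?K"
      "\<not> mform 2 6 dvd ?K"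
      "\<not> mform 3 5 dvd ?K"
      "\<not> mform 4 4 dvd ?K"
      "\<not> mform 5 3 dvd ?K"
      "\<not> mform 6 2 dvd ?K"
      "\<not> mform 7 1 dvd ?K"
      "\<not> mform 1 8 dvd ?K"
      "\<not> mform 2 7 dvd ?K"
      "\<not> mform 3 6 dvd ?K"
      "\<not> mform 4 5 dvd ?K"
      "\<not> mform 5 4 dvd ?K"
      "\<not> mform 6 3 dvd ?K"
      "\<not> mform 7 2 dvd ?K"
      "\<not> mform 8 1 dvd ?K"
      unfolding K by (simp add: mform_def X_def one_pCons numeral_eq_Suc, code_simp)+
    then show "\<not> mform c d dvd ?K" using cd by auto
  qed
qed

text \<open>The gap 2 forces a prime factor of degree at most 3, namely \<open>mform 1 1\<close>
  with exponent 3 or \<open>mform 2 1\<close> with exponent 7. The factorisations above exclude 7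
  and 9 as divisors of \<open>m\<close>.\<close>

lemma mersenne_split_geo_M2:
  assumes "mersenne_split (geo (mform 1 2) m)" "odd m" shows "m = 1 \<or> m = 3"
proof -
  let ?P = "mform 1 2"
  have P: "mersenne_prime ?P" by (simp add: mersenne_prime_mform_iff)
  have P1: "?P \<noteq> 1" by (rule mform_neq_1) simp
  have dP: "degree ?P = 3" by (simp add: degree_mform)
  have sub: "mersenne_split (geo ?P k)" if "k dvd m" for k
    using assms(1) geo_dvd[OF P1 that] mersenne_split_dvd by blast
  have geo: "geo ?P 7 = (?P ^ 3 + ?P ^ 2 + 1) * (?P ^ 3 + ?P + 1)"
    "geo ?P 9 = geo ?P 3 * (?P ^ 6 + ?P ^ 3 + 1)"
    by (simp_all add: geo_Suc numeral_eq_Suc algebra_simps)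
  have n7: "\<not> 7 dvd m"
    using sub[of 7] not_mersenne_split_M2_7 geo(1) by (metis dvd_triv_left mersenne_split_dvd)
  have n9: "\<not> 9 dvd m"
    using sub[of 9] not_mersenne_split_M2_9 geo(2) by (metis dvd_triv_right mersenne_split_dvd)
  \<comment> \<open>Stated for every divisor of \<open>m\<close>, so that it can be applied to
    \<open>m\<close> and again to m / 3, which would give 9.\<close>
  have d3: "3 dvd k" if k: "k dvd m" "k > 1" for k
  proof -
    let ?W = "geo ?P k"
    note split = sub[OF k(1)]
    have "odd k" using k assms(2) by auto
    note dW = mform_times_dlog_geo(2,3)[OF P \<open>odd k\<close> k(2)]
    have nP: "\<not> ?P dvd ?W" using not_dvd_geo_self[of ?P k] k by simp
    have "\<exists>q. irreducible q \<and> q dvd ?W \<and> degree q < 4"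
    proof (rule ccontr)
      assume "\<not> ?thesis"
      then have "degree q \<ge> 4" if "irreducible q" "q dvd ?W" for q using that by force
      then show False using degree_dlog_le[OF split, of 4] dW dP by auto
    qed
    then obtain q where q: "irreducible q" "q dvd ?W" "degree q < 4" by blast
    have mq: "mersenne_prime q" using mersenne_split_irreducible_dvd[OF split q(1,2)] .
    then have nq: "\<not> q dvd ?P + 1" by (rule mersenne_prime_not_dvd_mform_plus_1)
    have "mform 2 1 dvd ?P ^ 7 + 1"
      using dvd_power_2_power_minus_1[of "mform 1 2" "mform 2 1" 3] dvd_X_power_2_power(2)
        irreducible_dvd_irreducible[of "mform 1 2" "mform 2 1"]
      by (auto simp: mform_bar_dvd[of 2])
    moreover have "mform 1 1 dvd ?P ^ 3 + 1"
      using dvd_power_2_power_minus_1[of "mform 1 1" ?P 2] dvd_X_power_2_power(1)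
        irreducible_dvd_irreducible[of "mform 1 1" ?P]
      by auto
    ultimately have "q dvd ?P ^ 3 + 1 \<or> q dvd ?P ^ 7 + 1"
      using mersenne_prime_degree_less_4[OF mq q(3)] nP q(2) by auto
    then have "\<not> coprime 3 k \<or> \<not> coprime 7 k"
      using dvd_geo_imp_not_coprime[OF q(2) _ nq] by blast
    then have "3 dvd k \<or> 7 dvd k"
      using prime_imp_coprime[of "3::nat" k] prime_imp_coprime[of "7::nat" k] by auto
    then show ?thesis using n7 k(1) by (meson dvd_trans)
  qed
  show ?thesis
  proof (cases "m > 1")
    case True
    then obtain k where k: "m = 3 * k" using d3[of m] by (auto elim: dvdE)
    then have "\<not> k > 1" using d3[of k] n9 by (auto simp: dvd_def mult.assoc)
    then show ?thesis using k assms(2) by (cases k) auto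
  qed (use assms(2) in \<open>cases m; auto\<close>)
qed

section \<open>Geometric sums of X\<close>

lemma euler_deriv_X: "euler_deriv X = X * (X + 1)" "euler_deriv (X + 1) = X * (X + 1)"
  by (simp_all add: euler_deriv_def pderiv_add)

lemma euler_deriv_geo_X:
  assumes "odd m" shows "euler_deriv (geo X m) = geo X m + 1"
proof -
  let ?W = "geo X m"
  have "m > 0" using assms by (auto elim: oddE)
  then have "X ^ m = X * X ^ (m - 1)" by (simp flip: power_Suc)
  moreover have "euler_deriv ((X + 1) * ?W) = euler_deriv (X ^ m + 1)" by (simp add: geo_mult)
  ultimately have "(X + 1) * (X * ?W + euler_deriv ?W) = (X + 1) * X ^ m"
    using assms unfolding euler_deriv_mult euler_deriv_add[of "X ^ m"] euler_deriv_power euler_deriv_X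
    by (simp add: of_nat_bit_poly algebra_simps)
  then have "X * ?W + euler_deriv ?W = X ^ m" by (metis X_nonzero(2) mult_left_cancel)
  also have "X ^ m = X * ?W + (?W + 1)" using geo_mult[of X m] by (simp add: algebra_simps)
  finally show ?thesis by (rule add_left_imp_eq)
qed

section \<open>Reciprocal polynomials\<close>

lemma coeff_X_power: "coeff (X ^ n) i = of_bool (i = n)"
  by (simp add: X_power_eq_monom)

lemma coeff_geo_X: "coeff (geo X m) i = of_bool (i < m)"
  by (simp add: geo_def coeff_sum coeff_X_power of_bool_def if_distrib sum.delta cong: if_cong)

lemma reflect_poly_geo_X: "reflect_poly (geo X (Suc n)) = geo X (Suc n)"
proof -
  have "degree (geo X (Suc n)) = n" by (simp add: degree_geo)
  then show ?thesis by (intro poly_eqI) (auto simp: coeff_reflect_poly coeff_geo_X)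
qed

lemma irreducible_reflect_bit_poly:
  assumes "irreducible (p :: bit poly)" "coeff p 0 \<noteq> 0" shows "irreducible (reflect_poly p)"
proof (rule irreducibleI)
  have *: "reflect_poly a = 1 \<longleftrightarrow> a = 1" if "coeff a 0 \<noteq> 0" for a :: "bit poly"
    using that by (metis reflect_poly_reflect_poly reflect_poly_1)
  show "reflect_poly p \<noteq> 0" "\<not> reflect_poly p dvd 1" using assms * by auto
  fix a b assume ab: "reflect_poly p = a * b"
  then have "coeff (a * b) 0 \<noteq> 0" using assms(1) by (metis coeff_0_reflect_poly leading_coeff_neq_0 not_irreducible_zero)
  then have nz: "coeff a 0 \<noteq> 0" "coeff b 0 \<noteq> 0" by (auto simp: mult_poly_0_left coeff_mult_0)
  have "p = reflect_poly a * reflect_poly b"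
    using assms(2) ab by (metis reflect_poly_mult reflect_poly_reflect_poly)
  then show "a dvd 1 \<or> b dvd 1"
    using irreducibleD[OF assms(1)] * nz by auto
qed

text \<open>Reversal turns X into 1 and fixes X + 1, and the constant term 1 becomes X^(c +
  d).\<close>

lemma reflect_poly_mform:
  assumes "c > 0" shows "reflect_poly (mform c d) = X ^ (c + d) + (X + 1) ^ d"
proof (rule poly_eqI)
  fix i
  have "X + 1 = [:1, 1:]" by (simp add: X_def one_pCons)
  then have "reflect_poly (X + 1) = X + 1" by (simp add: reflect_poly_def)
  then have "reflect_poly ((X + 1) ^ d) = (X + 1) ^ d" by (simp add: reflect_poly_power)
  then have sym: "coeff ((X + 1) ^ d) (d - i) = coeff ((X + 1) ^ d) i" if "i \<le> d"
    using coeff_reflect_poly[of "(X + 1) ^ d" i] that by simp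
  have high: "coeff ((X + 1) ^ d) i = 0" if "i > d" using that by (intro coeff_eq_0) simp
  have shift: "coeff (X ^ c * F) j = (if j < c then 0 else coeff F (j - c))" for F j
    by (simp add: X_power_eq_monom coeff_monom_mult)
  show "coeff (reflect_poly (mform c d)) i = coeff (X ^ (c + d) + (X + 1) ^ d) i"
  proof (cases "i > c + d")
    case True
    then show ?thesis using high by (simp add: coeff_reflect_poly degree_mform assms coeff_X_power)
  next
    case False
    have "coeff 1 (c + d - i) = (of_bool (i = c + d) :: bit)" using False by (auto simp: coeff_1)
    moreover have "coeff (X ^ c * (X + 1) ^ d) (c + d - i) = coeff ((X + 1) ^ d) i"
      using False sym high by (cases "i \<le> d") (simp_all add: shift)
    ultimately show ?thesis
      using False by (simp add: coeff_reflect_poly degree_mform assms coeff_X_power)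
        (simp add: mform_def)
  qed
qed

text \<open>The 2-part of \<open>d\<close> is removed because Frobenius is injective. For the odd
  part r, differentiation gives (X + 1)^(r - 1) = X^(r - 1), and evaluation at 0 forces r =
  1.\<close>

lemma X_plus_1_power_eq:
  assumes "(X + 1) ^ d = X ^ d + 1" "d > 0" obtains k where "d = 2 ^ k"
proof -
  obtain r where r: "d = 2 ^ multiplicity 2 d * r" "odd r"
    using multiplicity_decompose'[of d 2] \<open>d > 0\<close> by auto
  then obtain k where d: "d = 2 ^ k * r" by blast
  have "((X + 1) ^ r + (X ^ r + 1)) ^ (2 ^ k) = 0"
    using assms(1) by (simp only: power_2_power_add_bit_poly d power_mult[symmetric] mult.commute[of r]) simp
  then have "(X + 1) ^ r = X ^ r + 1" by (simp add: bit_poly_add_eq_0_iff)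
  then have "euler_deriv ((X + 1) ^ r) = euler_deriv (X ^ r + 1)" by simp
  then have "(X + 1) ^ (r - 1) * (X * (X + 1)) = X ^ (r - 1) * (X * (X + 1))"
    using r(2) unfolding euler_deriv_add euler_deriv_power euler_deriv_X by (simp add: of_nat_bit_poly)
  then have "(X + 1) ^ (r - 1) = X ^ (r - 1)"
    by (metis X_nonzero(1,2) mult_right_cancel no_zero_divisors)
  then have "poly ((X + 1) ^ (r - 1)) 0 = poly (X ^ (r - 1)) 0" by simp
  then have "r = 1" using r(2) by (cases "r - 1 = 0") (auto simp: power_0_left elim: oddE)
  then show thesis using that d by simp
qed

lemma monomial_eqD:
  assumes "X ^ a * (X + 1) ^ b = X ^ c * (X + 1) ^ d" shows "a = c" "b = d"
proof -
  have "mform a b = mform c d" using assms by (simp add: mform_def)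
  then show "a = c" "b = d" by auto
qed

text \<open>\<open>1 + X + \<dots> + X\<^sup>n\<close> is its own reciprocal, so the reciprocals of its prime factors must be
  Mersenne primes as well.\<close>

lemma reciprocal_mersenne_prime:
  assumes Q: "mersenne_prime Q" and R: "mersenne_prime (reflect_poly Q)"
  obtains v where "v > 0" "Q \<in> {mform 1 (2 ^ v - 1), mform 1 (2 ^ v), mform (2 ^ v) 1}"
proof -
  obtain c d where cd: "c > 0" "d > 0" "Q = mform c d" "odd c \<or> odd d"
    using Q by (auto elim: mersenne_primeE)
  obtain e f where ef: "e > 0" "f > 0" "reflect_poly Q = mform e f" "odd e \<or> odd f"
    using R by (auto elim: mersenne_primeE)
  have E: "X ^ (c + d) + (X + 1) ^ d = mform e f"
    using ef(3) unfolding cd(3) reflect_poly_mform[OF cd(1)] .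
  have "coeff Q 0 \<noteq> 0" using cd by (simp add: mform_def power_0_left flip: poly_0_coeff_0)
  then have "degree (mform e f) = degree (mform c d)"
    using cd ef by (metis degree_reflect_poly_eq)
  then have n: "c + d = e + f" using cd ef by (simp add: degree_mform)
  have Xm: "X ^ k = X * X ^ (k - 1)" "(X + 1) ^ k = (X + 1) * (X + 1) ^ (k - 1)" if "k > 0" for k
    using that by (cases k; simp)+
  have eX: "euler_deriv (X ^ k) = of_nat k * (X ^ k * (X + 1))"
    "euler_deriv ((X + 1) ^ k) = of_nat k * (X * (X + 1) ^ k)" if "k > 0" for k
    unfolding euler_deriv_power euler_deriv_X using Xm[OF that] by (simp_all only: mult_ac)
  have cd0: "c + d > 0" using cd by simp
  have mform_plus_1: "mform e f + 1 = X ^ e * (X + 1) ^ f" by (simp add: mform_def add.commute)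
  \<comment> \<open>Differentiating loses all but parities. Unless c is even and d odd, both sides
    become monomials in X and X + 1, and exponents can be compared.\<close>
  have D: "of_nat (c + d) * (X ^ (c + d) * (X + 1)) + of_nat d * (X * (X + 1) ^ d)
      = lform e f * (X ^ e * (X + 1) ^ f)"
    using arg_cong[OF E, of euler_deriv] unfolding euler_deriv_mform[OF ef(1,2)] euler_deriv_add eX(1)[OF cd0] eX(2)[OF cd(2)]
    by (simp only: mform_plus_1)
  consider "odd c" "odd d" | "odd c" "even d" | "even c" "odd d" using cd(4) by blast
  then show thesis
  proof cases
    case 1
    then have "even (e + f)" unfolding n[symmetric] by simp
    then have "lform e f = 1" using ef(4) by (auto simp: lform_def add.commute)
    then have "X ^ 1 * (X + 1) ^ d = X ^ e * (X + 1) ^ f" using D 1 by (simp add: of_nat_bit_poly)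
    then have e: "e = 1" "f = d" using monomial_eqD by metis+
    then have "c = 1" using n by simp
    have "X ^ Suc d + ((X + 1) ^ d + (X * (X + 1) ^ d + (X + 1) ^ Suc d)) = 1 + (X * (X + 1) ^ d + (X * (X + 1) ^ d + (X + 1) ^ Suc d))"
      using E unfolding e \<open>c = 1\<close> by (simp add: mform_def add.assoc[symmetric])
    moreover have "(X + 1) ^ d + (X * (X + 1) ^ d + (X + 1) ^ Suc d) = 0" by (simp add: algebra_simps)
    ultimately have "X ^ Suc d = 1 + (X + 1) ^ Suc d" by (simp del: power_Suc)
    then have "(X + 1) ^ Suc d = X ^ Suc d + 1" by (simp add: add.commute del: power_Suc)
    then obtain v where v: "Suc d = 2 ^ v" using X_plus_1_power_eq by blast
    then have "v > 0" using cd(2) by (cases v) auto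
    then show thesis using that[of v] cd(3) v \<open>c = 1\<close> by (metis diff_Suc_1 insertI1)
  next
    case 2
    then have odd: "odd (e + f)" unfolding n[symmetric] by simp
    have D': "X ^ (c + d) * (X + 1) ^ 1 = lform e f * (X ^ e * (X + 1) ^ f)" using D 2 by (simp add: of_nat_bit_poly)
    have "even e"
    proof (rule ccontr)
      assume "odd e"
      then have "X ^ (c + d) * (X + 1) ^ 1 = X ^ e * (X + 1) ^ Suc f"
        using D' odd by (simp add: lform_def mult_ac)
      then have "1 = Suc f" by (rule monomial_eqD(2))
      then show False using ef(2) by simp
    qed
    then have "X ^ (c + d) * (X + 1) ^ 1 = X ^ Suc e * (X + 1) ^ f"
      using D' odd by (simp add: lform_def mult_ac)
    then have e: "c + d = Suc e" "f = 1" using monomial_eqD by metis+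
    have "X ^ Suc e + (X + 1) ^ d = X ^ Suc e + (X ^ e + 1)"
      using E unfolding e by (simp add: mform_def algebra_simps)
    then have *: "(X + 1) ^ d = X ^ e + 1" by (rule add_left_imp_eq)
    have "degree (X ^ e + 1) = e" using ef(1) by (subst degree_add_eq_left) auto
    then have "d = e" using arg_cong[OF *, of degree] by simp
    then obtain v where v: "d = 2 ^ v" using X_plus_1_power_eq * cd(2) by metis
    then have "v > 0" using 2(2) by (cases v) auto
    moreover have "c = 1" using e(1) \<open>d = e\<close> by simp
    ultimately show thesis using that[of v] cd(3) v by simp
  next
    case 3
    then have odd: "odd (e + f)" unfolding n[symmetric] by simp
    have D': "X * (X + 1) * (X ^ (c + d - 1) + (X + 1) ^ (d - 1)) = X * (X + 1) * (lform e f * (X ^ (e - 1) * (X + 1) ^ (f - 1)))"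
      using D 3 Xm[of e] Xm[of f] Xm[of "c + d"] Xm[of d] cd(2) ef(1,2) by (simp add: of_nat_bit_poly algebra_simps)
    then have D'': "X ^ (c + d - 1) + (X + 1) ^ (d - 1) = lform e f * (X ^ (e - 1) * (X + 1) ^ (f - 1))" 
      by (metis X_nonzero(1,2) mult_left_cancel no_zero_divisors)
    have "d = 1"
    proof (rule ccontr)
      assume "d \<noteq> 1"
      then have d1: "d > 1" using cd(2) by simp
      \<comment> \<open>For d > 1 the left side takes the value 1 at 1, so X + 1 cannot divide the
        right side and f = 1; then (X + 1)^(d - 1) would have to vanish.\<close>
      have ev: "poly (lform e f * (X ^ (e - 1) * (X + 1) ^ (f - 1))) 1 = 1"
        unfolding D''[symmetric] using d1 by (simp add: power_0_left)
      then have "f = 1" using ef(2) by (simp add: power_0_left split: if_splits)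
      then have "even e" using odd by simp
      then have "lform e f * (X ^ (e - 1) * (X + 1) ^ (f - 1)) = X ^ e"
        using \<open>f = 1\<close> Xm(1)[OF ef(1)] by (simp add: lform_def)
      then show False using D'' n \<open>f = 1\<close> by simp
    qed
    have "X * X ^ c + X = X ^ e * (X + 1) ^ f" using E \<open>d = 1\<close> by (simp add: mform_def add.commute[of 1])
    then have "X * (X ^ c + 1) = X * (X ^ (e - 1) * (X + 1) ^ f)"
      using Xm(1)[OF ef(1)] by (simp add: algebra_simps)
    then have *: "X ^ c + 1 = X ^ (e - 1) * (X + 1) ^ f" by simp
    have "poly (X ^ (e - 1) * (X + 1) ^ f) 0 = 1" unfolding *[symmetric] using cd(1) by (simp add: power_0_left)
    then have "e = 1" using ef(1) by (simp add: power_0_left split: if_splits)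
    then have "f = c" using n \<open>d = 1\<close> by simp
    then have "(X + 1) ^ c = X ^ c + 1" using * \<open>e = 1\<close> by simp
    then obtain v where v: "c = 2 ^ v" using X_plus_1_power_eq cd(1) by blast
    then have "v > 0" using 3(1) by (cases v) auto
    then show thesis using that[of v] cd(3) v \<open>d = 1\<close> by simp
  qed
qed

lemma dvd_same_degree_bit_poly:
  assumes "p dvd q" "(q :: bit poly) \<noteq> 0" "degree q \<le> degree p" shows "q = p"
proof -
  obtain r where r: "q = p * r" using assms(1) by (rule dvdE)
  then have nz: "p \<noteq> 0" "r \<noteq> 0" using assms(2) by auto
  then have "degree r = 0" using assms(3) r by (simp add: degree_mult_eq)
  then show ?thesis using r nz by (simp add: degree_eq_0_bit_poly_iff)
qed

text \<open>By Frobenius (X + 1)^(2^v) = X^(2^v) + 1. The self-reciprocal family thus consists of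
  geometric sums of X, whose irreducibility can be decided.\<close>

lemma mform_1_eq_geo: "mform 1 (2 ^ v - 1) = geo X (2 ^ v + 1)"
proof -
  have "(X + 1) * (X + 1) ^ (2 ^ v - 1) = (X + 1) ^ (2 ^ v)" by (simp flip: power_Suc)
  then have *: "(X + 1) * (X + 1) ^ (2 ^ v - 1) = X ^ (2 ^ v) + 1" by (simp add: power_2_power_add_bit_poly)
  have "(X + 1) * mform 1 (2 ^ v - 1) = (X + 1) + X * ((X + 1) * (X + 1) ^ (2 ^ v - 1))"
    by (simp add: mform_def algebra_simps)
  also have "\<dots> = (X + 1) * geo X (2 ^ v + 1)"
    unfolding * geo_mult by (simp add: algebra_simps)
  finally show ?thesis by simp
qed

text \<open>Squaring shifts the summation index, so the sum telescopes.\<close>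

lemma artin_schreier_sum: "(\<Sum>i<k. P ^ (2 ^ i)) ^ 2 + (\<Sum>i<k. P ^ (2 ^ i)) = P ^ (2 ^ k) + (P :: bit poly)"
proof (induction k)
  case (Suc k)
  have "((\<Sum>i<k. P ^ 2 ^ i) + P ^ 2 ^ k)\<^sup>2 + ((\<Sum>i<k. P ^ 2 ^ i) + P ^ 2 ^ k)
    = ((\<Sum>i<k. P ^ 2 ^ i)\<^sup>2 + (\<Sum>i<k. P ^ 2 ^ i)) + ((P ^ 2 ^ k)\<^sup>2 + P ^ 2 ^ k)"
    by (simp add: power2_add_bit_poly add_ac)
  also have "\<dots> = P ^ (2 ^ Suc k) + P"
    unfolding Suc.IH by (simp add: add_ac power_mult[symmetric] mult.commute)
  finally show ?case by simp
qed simp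

text \<open>Modulo the polynomial, \<open>X\<close> has order \<open>2 ^ v + 1\<close>, so \<open>X ^ 2 ^ (2 * v) = X\<close> and an
  irreducible polynomial would divide \<open>T\<close> or \<open>T + 1\<close> for the trace \<open>T\<close> of \<open>X\<close>.  The reduced
  form of \<open>T\<close> has no term of degree 3.\<close>

lemma reducible_geo_X_Fermat:
  assumes "v \<ge> 3" shows "\<not> irreducible (geo X (2 ^ v + 1))"
proof
  let ?S = "geo X (2 ^ v + 1)"
  assume irr: "irreducible ?S"
  define q where "q = (2 :: nat) ^ v"
  have S: "?S = geo X (q + 1)" by (simp add: q_def)
  have ge8: "q \<ge> 8" using power_increasing[OF assms, of "2 :: nat"] by (simp add: q_def)
  define T where "T = (\<Sum>i<v + v. X ^ (2 ^ i))"
  \<comment> \<open>In exponents modulo q + 1 one has q = -1, so X^(2^(v + i)) reduces to X^(q + 1 -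
    2^i). Thus \<open>T'\<close> is \<open>T\<close> brought down to degree at most q, the degree of
    \<open>?S\<close>.\<close>
  define T' where "T' = (\<Sum>i<v. X ^ (2 ^ i) + X ^ (q + 1 - 2 ^ i))"
  have per: "?S dvd X ^ ((q + 1) * k) + 1" for k
    using geo_mult[of X "q + 1"] dvd_power_plus_1[of ?S X "q + 1" k] S by (metis dvd_triv_right)
  have i_le: "2 ^ i < q" "2 * 2 ^ i \<le> q" if "i < v" for i
    using that power_strict_increasing[of i v "2 :: nat"] power_increasing[of "Suc i" v "2 :: nat"]
    by (simp_all add: q_def)
  have red: "?S dvd X ^ (2 ^ (v + i)) + X ^ (q + 1 - 2 ^ i)" if "i < v" for i
  proof -
    have "2 ^ (v + i) = (q + 1 - 2 ^ i) + (q + 1) * (2 ^ i - 1)"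
    proof -
      obtain w where w: "(2::nat) ^ i = Suc w" using not0_implies_Suc[of "2 ^ i"] by auto
      then show ?thesis using i_le(1)[OF that] by (simp add: power_add q_def[symmetric] algebra_simps)
    qed
    then have "X ^ (2 ^ (v + i)) + X ^ (q + 1 - 2 ^ i) = X ^ (q + 1 - 2 ^ i) * (X ^ ((q + 1) * (2 ^ i - 1)) + 1)"
      by (simp only: power_add distrib_left mult_1_right)
    then show ?thesis using per dvd_mult by metis
  qed
  have "(\<Sum>i<v + w. X ^ (2 ^ i)) = (\<Sum>i<v. X ^ (2 ^ i)) + (\<Sum>i<w. X ^ (2 ^ (v + i)))" for w
    by (induction w) (simp_all add: add_ac)
  then have "T = (\<Sum>i<v. X ^ (2 ^ i)) + (\<Sum>i<v. X ^ (2 ^ (v + i)))" unfolding T_def .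
  then have "T + T' = (\<Sum>i<v. X ^ (2 ^ (v + i)) + X ^ (q + 1 - 2 ^ i))"
    by (simp add: T'_def sum.distrib add_ac)
  then have TT': "?S dvd T + T'" using red by (auto intro!: dvd_sum)
  have "?S dvd T * (T + 1)"
  proof -
    have "2 ^ (v + v) = 1 + (q + 1) * (q - 1)"
      using ge8 by (simp add: power_add q_def[symmetric] algebra_simps)
    then have "X ^ (2 ^ (v + v)) + X = X * (X ^ ((q + 1) * (q - 1)) + 1)"
      by (simp only: power_add power_one_right distrib_left mult_1_right)
    then have "?S dvd X ^ (2 ^ (v + v)) + X" using per by simp
    then show ?thesis using artin_schreier_sum[of X "v + v"] by (simp add: T_def power2_eq_square algebra_simps)
  qed
  then have "?S dvd T \<or> ?S dvd T + 1" using irr by (metis prime_bit_poly_iff prime_dvd_mult_iff)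
  moreover have "T' = T + (T + T')" "T' + 1 = (T + 1) + (T + T')" by (simp_all add: add_ac)
  ultimately have "?S dvd T' + of_bool False \<or> ?S dvd T' + of_bool True"
    using TT' dvd_add by (metis add_0_right of_bool_eq)
  then obtain c where c: "?S dvd T' + of_bool c" by blast
  have coeff: "coeff (T' + of_bool c) j = (\<Sum>i<v. of_bool (j = 2 ^ i) + of_bool (j = q + 1 - 2 ^ i))" if "j > 0" for j
    using that by (simp add: T'_def coeff_sum coeff_X_power of_bool_def coeff_1)
  have "coeff (T' + of_bool c) q = (\<Sum>i<v. of_bool (i = 0))"
    unfolding coeff[OF less_le_trans[OF _ ge8, of 0, simplified]]
  proof (rule sum.cong)
    fix i assume i: "i \<in> {..<v}"
    then have "q \<noteq> 2 ^ i" using i_le(1)[of i] by auto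
    moreover have "q = q + 1 - w \<longleftrightarrow> w = 1" if "w < q" for w using that by arith
    then have "q = q + 1 - 2 ^ i \<longleftrightarrow> (2 :: nat) ^ i = 1"
      using i_le(1)[of i] i by blast
    then have "q = q + 1 - 2 ^ i \<longleftrightarrow> i = 0" by simp
    ultimately show "of_bool (q = 2 ^ i) + of_bool (q = q + 1 - 2 ^ i) = (of_bool (i = 0) :: bit)" by simp
  qed simp
  \<comment> \<open>Only i = 0 contributes, through q + 1 - 1. Hence \<open>T' + of_bool c\<close>
    is nonzero, and being a multiple of \<open>?S\<close> of degree at most q it equals
    \<open>?S\<close>, all of whose coefficients up to q are 1.\<close>
  also have "\<dots> = 1" using assms by (simp add: of_bool_def)
  finally have cq: "coeff (T' + of_bool c) q = 1" .
  then have nz: "T' + of_bool c \<noteq> 0" by (metis coeff_0 zero_neq_one)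
  have "degree (X ^ 2 ^ i + X ^ (q + 1 - 2 ^ i)) \<le> q" if "i < v" for i
  proof (rule degree_add_le)
    show "degree (X ^ 2 ^ i) \<le> q" using i_le(1)[OF that] by simp
    have "(1 :: nat) \<le> 2 ^ i" by simp
    then have "q + 1 - 2 ^ i \<le> q" by linarith
    then show "degree (X ^ (q + 1 - 2 ^ i)) \<le> q" by simp
  qed
  then have "degree T' \<le> q" unfolding T'_def by (intro degree_sum_le) auto
  then have "degree (T' + of_bool c) \<le> degree ?S"
    unfolding S by (intro degree_add_le) (auto simp: degree_geo)
  then have eq: "T' + of_bool c = geo X (q + 1)" using dvd_same_degree_bit_poly[OF c nz] S by simp
  have "coeff (T' + of_bool c) 3 = (\<Sum>i<v. of_bool ((3 :: nat) = 2 ^ i) + of_bool (3 = q + 1 - 2 ^ i))"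
    by (rule coeff) simp
  also have "\<dots> = (\<Sum>i<v. 0)"
  proof (rule sum.cong)
    fix i assume i: "i \<in> {..<v}"
    have "3 \<noteq> (2 :: nat) ^ i"
    proof
      assume e: "3 = (2 :: nat) ^ i"
      then have "odd ((2 :: nat) ^ i)" by (metis odd_numeral)
      then show False using e by simp
    qed
    \<comment> \<open>This is where v >= 3 enters: for q = 4 and i = 1 the two numbers
      agree.\<close>
    moreover have "3 \<noteq> q + 1 - 2 ^ i"
    proof
      assume "3 = q + 1 - 2 ^ i"
      then have "2 ^ i + 2 = q" using i_le(1)[of i] i by auto
      then show False using i_le(2)[of i] i ge8 by auto
    qed
    ultimately show "of_bool ((3 :: nat) = 2 ^ i) + of_bool (3 = q + 1 - 2 ^ i) = (0 :: bit)" by simp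
  qed simp
  finally show False unfolding eq using ge8 by (simp add: coeff_geo_X)
qed

text \<open>For v = 1 the two powers cancel and 1 remains; for larger v the degree is 2^v. This is
  why v = 1 is treated apart below.\<close>

lemma dlog_mform_reciprocal_pair:
  assumes "v > 0"
  shows "dlog (mform 1 (2 ^ v) * mform (2 ^ v) 1) = X ^ (2 ^ v) + X ^ 2 + 1"
proof -
  have *: "(X + 1) ^ (2 ^ v) = X ^ (2 ^ v) + 1" "(1 + X) ^ (2 ^ v) = X ^ (2 ^ v) + 1"
    by (simp_all add: power_2_power_add_bit_poly)
  show ?thesis
    using assms unfolding dlog_mult
    by (simp add: dlog_mform lform_def) (simp add: mform_def * power2_eq_square algebra_simps)
qed

text \<open>When \<open>dlog W = 1\<close> is split by the product rule, neither summand can have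
  strictly larger degree than the other.\<close>

lemma degree_le_if_add_eq_1:
  assumes "A + B = (1 :: bit poly)" shows "degree A \<le> degree B"
proof -
  have "A = 1 + B" using assms by (metis add.assoc add_0_right bit_poly_add_self)
  then show ?thesis using degree_add_le_max[of 1 B] by simp
qed

text \<open>Here \<open>dlog W = 1\<close> has the largest possible gap, so a lower bound on the gap
  refutes nothing. Instead the factors of the least level \<open>v\<close> are isolated: all others
  have degree at least 2 * 2^v, too large to compensate for them in \<open>dlog W\<close>. What
  survives is W = S with v <= 2, giving m = 3 or 5, and W = U V with v = 1, giving m = 7.\<close>

lemma mersenne_split_geo_X:
  assumes split: "mersenne_split (geo X m)" and m: "odd m" shows "m \<in> {1, 3, 5, 7}"
proof (cases "m = 1")
  case False
  let ?W = "geo X m"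
  obtain n where n: "m = Suc n" "n > 0" using m False by (cases m) auto
  have dW: "degree ?W = n" and W0: "?W \<noteq> 0" using degree_geo[of X m] geo_nonzero[of X m] n by simp_all
  have dlW: "dlog ?W = 1"
    using dW n(2) unfolding dlog_def euler_deriv_geo_X[OF m] poly_mod_add_left by (simp add: mod_poly_less)
  have mp: "mersenne_prime q" if "irreducible q" "q dvd ?W" for q
    using mersenne_split_irreducible_dvd[OF split that] .
  have sq: "\<not> q * q dvd ?W" if "irreducible q" for q
  proof
    assume "q * q dvd ?W"
    then obtain V where V: "?W = q * (q * V)" by (auto simp: dvd_def mult.assoc)
    have "q dvd dlog ?W" unfolding V by (subst dlog_mult) (simp add: dlog_mult)
    then show False using that dlW by auto
  qed
  have coeff0: "coeff q 0 \<noteq> 0" if "q dvd ?W" for q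
  proof -
    have "coeff ?W 0 \<noteq> 0" by (simp add: coeff_geo_X n)
    then show ?thesis using that by (auto simp: coeff_mult_0)
  qed
  have refl: "irreducible (reflect_poly q)" "reflect_poly q dvd ?W" if "irreducible q" "q dvd ?W" for q
  proof -
    show "irreducible (reflect_poly q)" using irreducible_reflect_bit_poly[OF that(1) coeff0[OF that(2)]] .
    obtain V where "?W = q * V" using \<open>q dvd ?W\<close> by (rule dvdE)
    then show "reflect_poly q dvd ?W" by (metis n(1) reflect_poly_geo_X reflect_poly_mult dvd_triv_left)
  qed
  \<comment> \<open>A level consists of the self-reciprocal candidate, of degree 2^v, and a
    reciprocal pair of degree 2^v + 1.\<close>
  define L where "L v = {mform 1 (2 ^ v - 1), mform 1 (2 ^ v), mform (2 ^ v) 1}" for v :: nat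
  have lev: "\<exists>v>0. q \<in> L v" if "irreducible q" "q dvd ?W" for q
  proof -
    note mp[OF that] mp[OF refl[OF that]]
    then show ?thesis unfolding L_def by (rule reciprocal_mersenne_prime) blast
  qed
  have degL: "degree q \<ge> 2 ^ v" if "q \<in> L v" "v > 0" for q v
    using that by (auto simp: L_def degree_mform)
  define v where "v = (LEAST v. v > 0 \<and> (\<exists>q. irreducible q \<and> q dvd ?W \<and> q \<in> L v))"
  have ex: "\<exists>v. v > 0 \<and> (\<exists>q. irreducible q \<and> q dvd ?W \<and> q \<in> L v)"
  proof -
    have "?W \<noteq> 1" using dW n by auto
    then obtain q where "irreducible q" "q dvd ?W" using exists_irreducible_dvd_bit_poly W0 by blast
    then show ?thesis using lev by blast
  qed
  have v: "v > 0" "\<exists>q. irreducible q \<and> q dvd ?W \<and> q \<in> L v"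
    using LeastI_ex[OF ex] unfolding v_def by auto
  define S U V where "S = mform 1 (2 ^ v - 1)" and "U = mform 1 (2 ^ v)" and "V = mform (2 ^ v) 1"
  have q2: "(2 :: nat) ^ v \<ge> 2" using v(1) by (cases v) auto
  have degs: "degree S = 2 ^ v" "degree U = 2 ^ v + 1" "degree V = 2 ^ v + 1"
    using q2 by (simp_all add: S_def U_def V_def degree_mform)
  then have nz: "S \<noteq> 0" "U \<noteq> 0" "V \<noteq> 0" by auto
  have neq: "S \<noteq> U" "S \<noteq> V" "U \<noteq> V" using q2 by (auto simp: S_def U_def V_def)
  have high: "degree q \<ge> 2 * 2 ^ v" if q: "irreducible q" "q dvd ?W" "q \<notin> {S, U, V}" for q
  proof -
    obtain w where w: "w > 0" "q \<in> L w" using lev[OF q(1,2)] by blast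
    then have "v \<le> w" unfolding v_def using q by (intro Least_le) blast
    moreover have "w \<noteq> v" using w q(3) by (auto simp: L_def S_def U_def V_def)
    ultimately have "(2 :: nat) ^ Suc v \<le> 2 ^ w" by (intro power_increasing) auto
    then show ?thesis using degL[OF w(2,1)] by simp
  qed
  have "reflect_poly U = V"
    by (simp add: U_def V_def reflect_poly_mform power_2_power_add_bit_poly) (simp add: mform_def algebra_simps)
  moreover have "reflect_poly V = U"
    by (simp add: U_def V_def reflect_poly_mform) (simp add: mform_def power_2_power_add_bit_poly algebra_simps)
  ultimately have UV: "irreducible U \<and> U dvd ?W \<longleftrightarrow> irreducible V \<and> V dvd ?W"
    using refl by metis
  have dS: "dlog S = 1" using q2 v(1) unfolding S_def by (subst dlog_mform) (auto simp: lform_def add.commute)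
  have dUV: "dlog (U * V) = X ^ 2 ^ v + X ^ 2 + 1"
    unfolding U_def V_def by (rule dlog_mform_reciprocal_pair[OF v(1)])
  \<comment> \<open>If \<open>G\<close> contains every factor of degree below \<open>s\<close>, none
    of them divides \<open>K\<close>, since \<open>W\<close> is squarefree.\<close>
  have rest: "dlog K = 0 \<or> degree (dlog K) + s \<le> degree K"
    if "?W = G * K" "even s" "\<And>q. irreducible q \<Longrightarrow> q dvd ?W \<Longrightarrow> degree q < s \<Longrightarrow> q dvd G" for G K s
  proof (rule degree_dlog_le)
    show "mersenne_split K" using split mersenne_split_dvd that(1) by (metis dvd_triv_right)
    fix q assume q: "irreducible q" "q dvd K"
    show "s \<le> degree q"
    proof (rule ccontr)
      assume "\<not> s \<le> degree q"
      then have "q dvd G" using that(1,3) q by simp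
      then show False using sq[OF q(1)] that(1) q(2) by (simp add: mult_dvd_mono)
    qed
  qed fact
  show ?thesis
  proof (cases "irreducible U \<and> U dvd ?W")
    case False
    then have SW: "irreducible S" "S dvd ?W" using v(2) UV by (auto simp: L_def S_def U_def V_def)
    then obtain K where K: "?W = S * K" by (auto elim: dvdE)
    have "q dvd S" if "irreducible q" "q dvd ?W" "degree q < 2 * 2 ^ v" for q
    proof -
      have "q = S \<or> q = U \<or> q = V" using high[OF that(1,2)] that(3) by force
      then show ?thesis using that(1,2) False UV by (metis dvd_refl)
    qed
    then have dK: "dlog K = 0 \<or> degree (dlog K) + 2 * 2 ^ v \<le> degree K" using rest[OF K] by simp
    \<comment> \<open>The bound on \<open>dlog K\<close> makes K the dominant term unless
      \<open>dlog K\<close> vanishes; then K = 1.\<close>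
    have one: "K + S * dlog K = 1" using dlW unfolding K dlog_mult dS by simp
    have "dlog K = 0"
    proof (rule ccontr)
      assume "dlog K \<noteq> 0"
      then have "degree (S * dlog K) < degree K" using dK nz degs q2 by (simp add: degree_mult_eq)
      then show False using degree_le_if_add_eq_1[OF one] by simp
    qed
    then have W: "?W = S" using one K by simp
    then have "\<not> v \<ge> 3" using SW(1) reducible_geo_X_Fermat[of v] unfolding S_def mform_1_eq_geo by blast
    then have "v = 1 \<or> v = 2" using v(1) by auto
    moreover have "n = 2 ^ v" using W dW degs by simp
    ultimately show ?thesis using n by auto
  next
    case True
    then have UVW: "irreducible U" "U dvd ?W" "irreducible V" "V dvd ?W" using UV by auto
    have cop: "coprime U V" using coprime_irreducible_bit_poly UVW neq by blast
    have UVd: "U * V dvd ?W" using divides_mult[OF UVW(2,4) cop] .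
    have dgUV: "degree (U * V) = 2 * 2 ^ v + 2" using nz degs by (simp add: degree_mult_eq)
    show ?thesis
    proof (cases "irreducible S \<and> S dvd ?W")
      case SW: True
      have "coprime (U * V) S" using coprime_irreducible_bit_poly UVW SW neq by simp
      then obtain K where K: "?W = U * V * S * K" using divides_mult[OF UVd, of S] SW by (auto elim: dvdE)
      have "q dvd U * V * S" if "irreducible q" "q dvd ?W" "degree q < 2 * 2 ^ v" for q
      proof -
        have "q = S \<or> q = U \<or> q = V" using high[OF that(1,2)] that(3) by force
        then show ?thesis by auto
      qed
      then have dK: "dlog K = 0 \<or> degree (dlog K) + 2 * 2 ^ v \<le> degree K" using rest[OF K] by simp
      \<comment> \<open>With all three factors present, U V dominates
        \<open>dlog (U * V * S)\<close>, so nothing can cancel.\<close>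
      have "degree (X ^ 2 ^ v + X ^ 2 + 1) \<le> 2 ^ v" using q2 by (intro degree_add_le) auto
      then have "degree ((X ^ 2 ^ v + X ^ 2 + 1) * S) < degree (U * V)"
        using degree_mult_le[of "X ^ 2 ^ v + X ^ 2 + 1" S] degs dgUV by linarith
      moreover have dG: "dlog (U * V * S) = (X ^ 2 ^ v + X ^ 2 + 1) * S + U * V"
        unfolding dlog_mult[of "U * V" S] dUV dS by simp
      ultimately have "degree (dlog (U * V * S)) = 2 * 2 ^ v + 2"
        using dgUV degree_add_eq_right by metis
      moreover have K0: "K \<noteq> 0" using K W0 by auto
      ultimately have "degree (dlog (U * V * S) * K) = 2 * 2 ^ v + 2 + degree K"
        by (subst degree_mult_eq) auto
      moreover have one: "dlog (U * V * S) * K + U * V * S * dlog K = 1" using dlW unfolding K dlog_mult by simp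
      moreover have "degree (U * V * S * dlog K) \<le> 2 ^ v + 2 + degree K"
        using dK nz degs dgUV by (cases "dlog K = 0") (auto simp: degree_mult_eq)
      ultimately show ?thesis using degree_le_if_add_eq_1[OF one] q2 by linarith
    next
      case SW: False
      obtain K where K: "?W = U * V * K" using UVd by (rule dvdE)
      have K0: "K \<noteq> 0" using K W0 by auto
      have small: "q dvd U * V" if "irreducible q" "q dvd ?W" "degree q < 2 * 2 ^ v" for q
      proof -
        have "q = S \<or> q = U \<or> q = V" using high[OF that(1,2)] that(3) by force
        then show ?thesis using that(1,2) SW by auto
      qed
      have dK: "dlog K = 0 \<or> degree (dlog K) + 2 * 2 ^ v \<le> degree K" using rest[OF K _ small] by simp
      have one: "(X ^ 2 ^ v + X ^ 2 + 1) * K + U * V * dlog K = 1" using dlW unfolding K dlog_mult[of "U * V"] dUV .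
      show ?thesis
      proof (cases "v = 1")
        case False
        then have q4: "(2 :: nat) ^ v \<ge> 4" using power_increasing[of 2 v "2 :: nat"] v(1) by simp
        have "degree (X ^ 2 ^ v + (X ^ 2 + 1)) = 2 ^ v"
        proof (subst degree_add_eq_left)
          have "degree (X ^ 2 + 1) \<le> 2" by (intro degree_add_le) auto
          then show "degree (X ^ 2 + 1) < degree (X ^ 2 ^ v)" using q4 by simp
        qed simp
        then have dd: "degree (X ^ 2 ^ v + X ^ 2 + 1) = 2 ^ v" by (simp add: add.assoc)
        then have "X ^ 2 ^ v + X ^ 2 + 1 \<noteq> 0" using q4 by auto
        then have "degree ((X ^ 2 ^ v + X ^ 2 + 1) * K) = 2 ^ v + degree K"
          using K0 dd by (simp add: degree_mult_eq)
        moreover have "degree (U * V * dlog K) \<le> 2 + degree K"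
          using dK nz dgUV by (cases "dlog K = 0") (auto simp: degree_mult_eq)
        ultimately show ?thesis using degree_le_if_add_eq_1[OF one] q4 by linarith
      next
        case v1: True
        have "X ^ 2 ^ v + X ^ 2 + 1 = 1" by (simp add: v1)
        with one have one: "K + U * V * dlog K = 1" by simp
        have G6: "degree (U * V) = 6" using dgUV v1 by simp
        show ?thesis
        proof (cases "dlog K = 0")
          case True
          then have "?W = U * V" using K one by simp
          then show ?thesis using dW G6 n by simp
        next
          case dK0: False
          let ?M = "mform 1 3"
          \<comment> \<open>Level 2 contributes only \<open>mform 1 3\<close>, because
            \<open>mform 1 4\<close> and its conjugate are reducible; level 3 begins at degree
            8.\<close>
          have four: "q \<in> {U, V, ?M}" if q: "irreducible q" "q dvd ?W" "degree q < 8" for q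
          proof -
            obtain w where w: "w > 0" "q \<in> L w" using lev[OF q(1,2)] by blast
            have "\<not> w \<ge> 3"
              using degL[OF w(2,1)] power_increasing[of 3 w "2::nat"] q(3) by auto
            then have "w = 1 \<or> w = 2" using w(1) by auto
            moreover have "q \<notin> {mform 1 4, mform 4 1}"
            proof
              assume q4: "q \<in> {mform 1 4, mform 4 1}"
              then have "degree q < 6" by (auto simp: degree_mform)
              then show False using mersenne_prime_degree_less_6[OF mp[OF q(1,2)]] q4 by auto
            qed
            ultimately show ?thesis using w(2) SW q(1,2) v1 by (auto simp: L_def S_def U_def V_def)
          qed
          show ?thesis
          proof (cases "?M dvd K")
            case False
            have "q dvd U * V" if "irreducible q" "q dvd ?W" "degree q < 8" for q
            proof -
              have "\<not> ?M dvd ?W"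
              proof
                assume "?M dvd ?W"
                then have "?M dvd U * V" using False unfolding K
                  by (metis One_nat_def irreducible_mform(3) prime_bit_poly_iff prime_dvd_mult_iff)
                then have "?M dvd U \<or> ?M dvd V"
                  by (metis One_nat_def irreducible_mform(3) prime_bit_poly_iff prime_dvd_mult_iff)
                then have "?M = U \<or> ?M = V"
                  using UVW irreducible_dvd_irreducible[of ?M] by auto
                then show False by (simp add: U_def V_def v1)
              qed
              then show ?thesis using four[OF that] that(2) by auto
            qed
            then have "degree (dlog K) + 8 \<le> degree K" using rest[OF K, of 8] dK0 by simp
            then have "degree (U * V * dlog K) < degree K" using nz dK0 G6 by (simp add: degree_mult_eq)
            then show ?thesis using degree_le_if_add_eq_1[OF one] by simp
          next
            case True
            then obtain K' where K': "K = ?M * K'" by (rule dvdE)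
            have K'0: "K' \<noteq> 0" using K' K0 by auto
            have "q dvd U * V * ?M" if "irreducible q" "q dvd ?W" "degree q < 8" for q
              using four[OF that] by auto
            then have dK': "dlog K' = 0 \<or> degree (dlog K') + 8 \<le> degree K'"
              using rest[of "U * V * ?M" K' 8] K K' by (simp add: mult.assoc)
            have dM: "degree ?M = 4" "?M \<noteq> 0" by (simp_all add: degree_mform mform_nonzero)
            have "dlog ?M = 1" by (simp add: dlog_mform lform_def add.commute)
            then have "dlog K = K' + ?M * dlog K'" unfolding K' dlog_mult by simp
            moreover have "degree (?M * dlog K') < degree K' \<or> dlog K' = 0"
              using dK' dM by (cases "dlog K' = 0") (auto simp: degree_mult_eq)
            ultimately have "degree (dlog K) = degree K'" using degree_add_eq_left[of "?M * dlog K'" K'] by auto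
            \<comment> \<open>The degree 6 of U V exceeds the degree 4 of \<open>?M\<close>, by
              which K exceeds \<open>dlog K\<close>.\<close>
            then have "degree (U * V * dlog K) > degree K"
              unfolding K' using nz dK0 G6 dM K'0 K' by (simp add: degree_mult_eq)
            then show ?thesis using degree_le_if_add_eq_1[of "U * V * dlog K" K] one by (simp add: add.commute)
          qed
        qed
      qed
    qed
  qed
qed simp

section \<open>Divisor sums\<close>

lemma unitary_divisor_mult_iff:
  assumes "coprime a b" "a \<noteq> 0" "b \<noteq> 0" "d dvd a" "e dvd b"
  shows "unitary_divisor (d * e) (a * b) \<longleftrightarrow> unitary_divisor d a \<and> unitary_divisor e b"
proof -
  obtain d' e' where de: "a = d * d'" "b = e * e'" using assms(4,5) by (auto elim!: dvdE)
  have nz: "d \<noteq> 0" "e \<noteq> 0" using de assms by auto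
  then have "a * b div (d * e) = d' * e'" unfolding de by (simp add: mult_ac div_mult_mult1)
  moreover have "coprime d e" "coprime d e'" "coprime d' e" using assms(1) unfolding de by auto
  ultimately show ?thesis
    using nz unfolding unitary_divisor_def de
    by (auto simp: coprime_commute)
qed

text \<open>Serves both divisor sums, with trivial predicates and with unitarity. The two parts of a
  divisor are recovered as its gcds with \<open>a\<close> and \<open>b\<close>.\<close>

lemma sum_divisors_mult:
  assumes "coprime a b" "(a :: bit poly) \<noteq> 0" "b \<noteq> 0"
    and P: "\<And>d e. d dvd a \<Longrightarrow> e dvd b \<Longrightarrow> P (d * e) \<longleftrightarrow> Q d \<and> R e"
  shows "(\<Sum>x | x dvd a * b \<and> P x. x) = (\<Sum>d | d dvd a \<and> Q d. d) * (\<Sum>e | e dvd b \<and> R e. e)"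
proof -
  let ?D = "{d. d dvd a \<and> Q d}" and ?E = "{e. e dvd b \<and> R e}"
  have bij: "bij_betw (\<lambda>(d, e). d * e) (?D \<times> ?E) {x. x dvd a * b \<and> P x}"
  proof (rule bij_betwI')
    fix x y assume "x \<in> ?D \<times> ?E" "y \<in> ?D \<times> ?E"
    then obtain d e d' e' where xy: "x = (d, e)" "y = (d', e')" and
      dvd: "d dvd a" "d' dvd a" "e dvd b" "e' dvd b" by auto
    have g: "gcd (d * e) a = d" "gcd (d * e) b = e" if "d dvd a" "e dvd b" for d e
    proof -
      have "coprime e a" "coprime d b"
        using coprime_divisors[OF that(2) dvd_refl, of a] coprime_divisors[OF that(1) dvd_refl, of b] assms(1)
        by (simp_all add: coprime_commute)
      then have "gcd (d * e) a = gcd d a" "gcd (d * e) b = gcd e b"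
        by (simp_all add: gcd_mult_left_right_cancel gcd_mult_left_left_cancel coprime_commute)
      then show "gcd (d * e) a = d" "gcd (d * e) b = e" using that by (simp_all add: gcd_proj1_if_dvd)
    qed
    show "((\<lambda>(d, e). d * e) x = (\<lambda>(d, e). d * e) y) = (x = y)"
      using g[OF dvd(1,3)] g[OF dvd(2,4)] xy by auto
  next
    fix x assume "x \<in> ?D \<times> ?E"
    then show "(\<lambda>(d, e). d * e) x \<in> {x. x dvd a * b \<and> P x}" using P by (auto intro: mult_dvd_mono)
  next
    fix y assume y: "y \<in> {x. x dvd a * b \<and> P x}"
    then obtain d e where "y = d * e" "d dvd a" "e dvd b" using division_decomp[of y a b] by auto
    then show "\<exists>x\<in>?D \<times> ?E. y = (\<lambda>(d, e). d * e) x" using y P by (intro bexI[of _ "(d, e)"]) auto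
  qed
  have "(\<Sum>x | x dvd a * b \<and> P x. x) = (\<Sum>(d, e)\<in>?D \<times> ?E. d * e)"
    using sum.reindex_bij_betw[OF bij, of "\<lambda>x. x"] by (simp add: case_prod_beta)
  then show ?thesis by (simp add: sum_product sum.cartesian_product)
qed

lemma sigma_mult: "coprime a b \<Longrightarrow> a \<noteq> 0 \<Longrightarrow> b \<noteq> 0 \<Longrightarrow> sigma (a * b) = sigma a * sigma b"
  using sum_divisors_mult[of a b "\<lambda>_. True" "\<lambda>_. True" "\<lambda>_. True"] by (simp add: sigma_def)

lemma sigma_star_mult:
  assumes "coprime a b" "a \<noteq> 0" "b \<noteq> 0" shows "sigma_star (a * b) = sigma_star a * sigma_star b"
proof -
  have "sigma_star A = (\<Sum>x | x dvd A \<and> unitary_divisor x A. x)" for A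
    unfolding sigma_star_def by (rule sum.cong) (auto simp: unitary_divisor_def)
  then show ?thesis
    using sum_divisors_mult[OF assms, of "\<lambda>x. unitary_divisor x (a * b)" "\<lambda>x. unitary_divisor x a" "\<lambda>x. unitary_divisor x b"]
      unitary_divisor_mult_iff[OF assms] by simp
qed

lemma dvd_prime_power_bit_poly_iff:
  assumes "irreducible (p :: bit poly)"
  shows "d dvd p ^ n \<longleftrightarrow> (\<exists>i\<le>n. d = p ^ i)"
  using divides_primepow[of p d n] assms by (auto simp: prime_bit_poly_iff le_imp_power_dvd)

lemma inj_on_power_bit_poly:
  assumes "irreducible (p :: bit poly)" shows "inj_on (\<lambda>i. p ^ i) A"
proof (rule inj_onI)
  fix i j assume "p ^ i = p ^ j"
  then have "i * degree p = j * degree p" by (metis degree_power_bit_poly)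
  moreover have "degree p \<noteq> 0" using assms by (auto simp: degree_eq_0_bit_poly_iff)
  ultimately show "i = j" by simp
qed

lemma sigma_prime_power:
  assumes "irreducible p" shows "sigma (p ^ h) = geo p (Suc h)"
proof -
  have "{d. d dvd p ^ h} = (\<lambda>i. p ^ i) ` {..<Suc h}"
    using dvd_prime_power_bit_poly_iff[OF assms] by (auto simp: less_Suc_eq_le)
  then show ?thesis unfolding sigma_def geo_def
    by (simp add: sum.reindex[OF inj_on_power_bit_poly[OF assms]] del: sum.lessThan_Suc)
qed

lemma sigma_star_prime_power:
  assumes "irreducible p" shows "sigma_star (p ^ h) = (if h = 0 then 1 else p ^ h + 1)"
proof -
  have nz: "p \<noteq> 0" "p \<noteq> 1" using assms by auto
  have "unitary_divisor (p ^ i) (p ^ h) \<longleftrightarrow> i = 0 \<or> i = h" if "i \<le> h" for i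
  proof -
    have "p ^ h div p ^ i = p ^ (h - i)" using nz that by (simp add: power_diff)
    moreover have "\<not> coprime (p ^ i) (p ^ (h - i))" if "i \<noteq> 0" "i \<noteq> h" 
      using that \<open>i \<le> h\<close> nz by (simp add: coprime_power_left_iff coprime_power_right_iff)
    ultimately show ?thesis using that by (auto simp: unitary_divisor_def le_imp_power_dvd)
  qed
  then have "{d. unitary_divisor d (p ^ h)} = {1, p ^ h}"
    using dvd_prime_power_bit_poly_iff[OF assms, of _ h] by (fastforce simp: unitary_divisor_def)
  moreover have "p ^ h = 1 \<longleftrightarrow> h = 0" using inj_on_power_bit_poly[OF assms, of UNIV] by (auto dest: injD[of _ h 0])
  ultimately show ?thesis unfolding sigma_star_def by (cases "h = 0") (auto simp: add.commute)
qed

lemma sigma_1 [simp]: "sigma 1 = 1" "sigma_star 1 = 1"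
  using sigma_prime_power[of X 0] sigma_star_prime_power[of X 0] by simp_all

text \<open>The common properties of \<^const>\<open>sigma\<close> and \<^const>\<open>sigma_star\<close>: multiplicativity, and
  \<open>f (p ^ h) * (p + 1) ^ \<delta> = p ^ N + 1\<close> with \<open>\<delta> = 1\<close>, \<open>N = h + 1\<close> and with \<open>\<delta> = 0\<close>, \<open>N = h\<close>.\<close>

definition sigma_like :: "nat \<Rightarrow> (bit poly \<Rightarrow> bit poly) \<Rightarrow> bool" where
  "sigma_like \<delta> f \<longleftrightarrow> \<delta> \<le> 1 \<and> f 1 = 1 \<and>
     (\<forall>a b. coprime a b \<longrightarrow> a \<noteq> 0 \<longrightarrow> b \<noteq> 0 \<longrightarrow> f (a * b) = f a * f b) \<and>
     (\<forall>p h. irreducible p \<longrightarrow> h > 0 \<longrightarrow> f (p ^ h) * (p + 1) ^ \<delta> = p ^ (h + \<delta>) + 1)"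

lemma sigma_like_sigma: "sigma_like 1 sigma"
  unfolding sigma_like_def by (auto simp: sigma_mult sigma_prime_power geo_mult mult.commute[of "geo _ _"])

lemma sigma_like_sigma_star: "sigma_like 0 sigma_star"
  unfolding sigma_like_def by (auto simp: sigma_star_mult sigma_star_prime_power)

lemma sigma_like_prod:
  assumes "sigma_like \<delta> f" "finite S" "\<And>p. p \<in> S \<Longrightarrow> irreducible p"
  shows "f (\<Prod>p\<in>S. p ^ e p) = (\<Prod>p\<in>S. f (p ^ e p))"
  using assms(2,3)
proof (induction S rule: finite_induct)
  case (insert p S)
  have "coprime (p ^ e p) (\<Prod>q\<in>S. q ^ e q)"
    using insert.prems insert.hyps(2) coprime_irreducible_bit_poly
    by (intro prod_coprime_right) (metis coprime_power_left_iff coprime_power_right_iff insertCI)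
  moreover have "q \<noteq> 0" if "q \<in> insert p S" for q using insert.prems[OF that] by auto
  then have "p ^ e p \<noteq> 0" "(\<Prod>q\<in>S. q ^ e q) \<noteq> 0" using insert.hyps(1) by (auto simp: prod_zero_iff)
  ultimately show ?case using assms(1) insert by (simp add: sigma_like_def)
qed (use assms(1) in \<open>simp add: sigma_like_def\<close>)

text \<open>\<open>odd_part 0\<close> is 0.\<close>

definition pow2_part :: "nat \<Rightarrow> nat" where "pow2_part n = (if n = 0 then 0 else 2 ^ multiplicity 2 n)"
definition odd_part :: "nat \<Rightarrow> nat" where "odd_part n = n div pow2_part n"

lemma pow2_part_mult_odd_part: "pow2_part n * odd_part n = n"
  by (simp add: pow2_part_def odd_part_def multiplicity_dvd)

lemma odd_odd_part: "n > 0 \<Longrightarrow> odd (odd_part n)"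
  using multiplicity_decompose[of n 2] by (simp add: pow2_part_def odd_part_def)

lemma pow2_part_eqI: "odd r \<Longrightarrow> pow2_part (2 ^ k * r) = 2 ^ k \<and> odd_part (2 ^ k * r) = r"
proof -
  assume "odd r"
  then have "multiplicity 2 (2 ^ k * r) = k" by (intro multiplicity_eqI) (auto elim: oddE)
  then show ?thesis using \<open>odd r\<close> by (auto simp: pow2_part_def odd_part_def elim: oddE)
qed

text \<open>Write h + \<delta> = u m with u a power of 2 and m odd. Frobenius gives p^(u m) + 1 =
  (p^m + 1)^u, and (p + 1)^\<delta> is cancelled; since \<delta> <= 1 <= u, the subtraction is not
  truncated.\<close>

lemma sigma_like_prime_power:
  assumes "sigma_like \<delta> f" "irreducible p" "h + \<delta> > 0"
  shows "f (p ^ h) = (p + 1) ^ (pow2_part (h + \<delta>) - \<delta>) * geo p (odd_part (h + \<delta>)) ^ pow2_part (h + \<delta>)"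
proof (cases "h = 0")
  case True
  then have "\<delta> = 1" using assms by (simp add: sigma_like_def)
  then show ?thesis using assms(1) True pow2_part_eqI[of 1 0] by (simp add: sigma_like_def)
next
  case False
  define u m where "u = pow2_part (h + \<delta>)" and "m = odd_part (h + \<delta>)"
  obtain k where k: "u = 2 ^ k" using assms(3) by (auto simp: u_def pow2_part_def)
  have "u * m = h + \<delta>" unfolding u_def m_def by (rule pow2_part_mult_odd_part)
  then have "p ^ (h + \<delta>) + 1 = (p ^ m + 1) ^ u"
    unfolding k power_2_power_add_bit_poly by (simp flip: power_mult add: mult.commute)
  also have "\<dots> = (p + 1) ^ u * geo p m ^ u" by (simp add: geo_mult[symmetric] power_mult_distrib)
  finally have "f (p ^ h) * (p + 1) ^ \<delta> = (p + 1) ^ u * geo p m ^ u"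
    using assms(1,2) False by (simp add: sigma_like_def)
  moreover have "(p + 1) ^ u = (p + 1) ^ (u - \<delta>) * (p + 1) ^ \<delta>"
  proof -
    have "\<delta> \<le> 1" using assms(1) by (simp add: sigma_like_def)
    moreover have "(1 :: nat) \<le> 2 ^ k" by simp
    ultimately have "\<delta> \<le> u" unfolding k by linarith
    then show ?thesis by (simp flip: power_add)
  qed
  moreover have "p + 1 \<noteq> 0" using assms(2) by (auto simp: bit_poly_add_eq_0_iff)
  ultimately show ?thesis by (simp add: u_def m_def mult_ac)
qed

lemma degree_irreducible_bit_poly: "irreducible (p :: bit poly) \<Longrightarrow> degree p > 0"
  using degree_eq_0_bit_poly_iff[of p] by (cases "degree p = 0") auto

text \<open>On prime powers the largest divisor dominates. This is what turns divisibility of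
  \<open>f B\<close> by \<open>B\<close> into equality.\<close>

lemma sigma_like_degree:
  assumes f: "sigma_like \<delta> f" and "A \<noteq> 0" shows "degree (f A) = degree A \<and> f A \<noteq> 0"
proof -
  have pp: "degree (f (p ^ h)) = degree (p ^ h) \<and> f (p ^ h) \<noteq> 0" if p: "irreducible p" for p h
  proof (cases "h = 0")
    case False
    have dp: "degree p > 0" using p by (rule degree_irreducible_bit_poly)
    then have d1: "degree (p + 1) = degree p" by (subst degree_add_eq_left) auto
    then have nz1: "p + 1 \<noteq> 0" using dp by auto
    have eq: "f (p ^ h) * (p + 1) ^ \<delta> = p ^ (h + \<delta>) + 1" using f p False by (simp add: sigma_like_def)
    have d2: "degree (p ^ (h + \<delta>) + 1) = (h + \<delta>) * degree p"
      using dp False by (subst degree_add_eq_left) auto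
    then have "p ^ (h + \<delta>) + 1 \<noteq> 0" using dp False by auto
    then have "f (p ^ h) \<noteq> 0" using eq by auto
    moreover have "degree (f (p ^ h)) + \<delta> * degree p = (h + \<delta>) * degree p"
      using eq d2 d1 nz1 calculation by (metis degree_mult_eq degree_power_bit_poly power_not_zero)
    ultimately show ?thesis by (simp add: add_mult_distrib)
  qed (use f in \<open>simp add: sigma_like_def\<close>)
  let ?S = "prime_factors A"
  have irr: "irreducible p" if "p \<in> ?S" for p using that by (auto simp: prime_bit_poly_iff[symmetric])
  have A: "A = (\<Prod>p\<in>?S. p ^ multiplicity p A)" using prod_prime_factors_bit_poly[OF \<open>A \<noteq> 0\<close>] by simp
  have fA: "f A = (\<Prod>p\<in>?S. f (p ^ multiplicity p A))"
    by (subst A) (rule sigma_like_prod[OF f _ irr], simp_all)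
  have nz: "f A \<noteq> 0" unfolding fA using pp irr by simp
  have "degree (f A) = (\<Sum>p\<in>?S. degree (f (p ^ multiplicity p A)))"
    unfolding fA using pp irr by (intro degree_prod_sum_eq) blast
  also have "\<dots> = (\<Sum>p\<in>?S. degree (p ^ multiplicity p A))" using pp irr by (intro sum.cong) auto
  also have "\<dots> = degree A" by (subst (3) A, rule degree_prod_sum_eq[symmetric]) (use irr in auto)
  finally show ?thesis using nz by simp
qed

text \<open>The value \<open>pow2_part 0 = 0\<close> makes the formula correct for h = \<delta> = 0
  as well, where both powers become 1.\<close>

lemma sigma_like_prime_power':
  assumes "sigma_like \<delta> f" "irreducible p"
  shows "f (p ^ h) = (p + 1) ^ (pow2_part (h + \<delta>) - \<delta>) * geo p (odd_part (h + \<delta>)) ^ pow2_part (h + \<delta>)"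
proof (cases "h + \<delta> = 0")
  case True
  then show ?thesis using assms by (simp add: sigma_like_def pow2_part_def)
qed (use sigma_like_prime_power[OF assms] in simp)

section \<open>Reduction to seven primes\<close>

definition small_primes :: "bit poly set" where
  "small_primes = {X, X + 1, mform 1 1, mform 1 2, mform 2 1, mform 1 3, mform 3 1}"

lemma poly_mform: "c > 0 \<Longrightarrow> poly (mform c d) 0 = 1" "d > 0 \<Longrightarrow> poly (mform c d) 1 = 1"
  by (simp_all add: mform_def power_0_left)

lemma X_neq_mform [simp]: "c > 0 \<Longrightarrow> X \<noteq> mform c d" "d > 0 \<Longrightarrow> X + 1 \<noteq> mform c d"
  "c > 0 \<Longrightarrow> mform c d \<noteq> X" "d > 0 \<Longrightarrow> mform c d \<noteq> X + 1"
proof -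
  show *: "X \<noteq> mform c d" if "c > 0" using poly_mform(1)[OF that] by (metis poly_X zero_neq_one)
  have "poly (X + 1) 1 = 0" by simp
  then show **: "X + 1 \<noteq> mform c d" if "d > 0" using poly_mform(2)[OF that] by (metis zero_neq_one)
  show "mform c d \<noteq> X" if "c > 0" using *[OF that] by simp
  show "mform c d \<noteq> X + 1" if "d > 0" using **[OF that] by metis
qed

lemma irreducible_small_primes: "p \<in> small_primes \<Longrightarrow> irreducible p"
  by (auto simp: small_primes_def)

text \<open>\<open>h2\<close>, \<open>h3\<close> belong to \<open>M 2\<close>, \<open>M 3\<close>
  and \<open>k2\<close>, \<open>k3\<close> to their conjugates; \<open>M 1\<close> is its own
  conjugate.\<close>

definition smono :: "nat \<Rightarrow> nat \<Rightarrow> nat \<Rightarrow> nat \<Rightarrow> nat \<Rightarrow> nat \<Rightarrow> nat \<Rightarrow> bit poly" where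
  "smono a b h1 h2 k2 h3 k3 = X ^ a * (X + 1) ^ b * mform 1 1 ^ h1 * mform 1 2 ^ h2 * mform 2 1 ^ k2
     * mform 1 3 ^ h3 * mform 3 1 ^ k3"

definition small_exp :: "nat \<Rightarrow> nat \<Rightarrow> nat \<Rightarrow> nat \<Rightarrow> nat \<Rightarrow> nat \<Rightarrow> nat \<Rightarrow> bit poly \<Rightarrow> nat" where
  "small_exp a b h1 h2 k2 h3 k3 p = (if p = X then a else if p = X + 1 then b
     else if p = mform 1 1 then h1 else if p = mform 1 2 then h2 else if p = mform 2 1 then k2
     else if p = mform 1 3 then h3 else k3)"

lemma prod_small_primes:
  "(\<Prod>p\<in>small_primes. g p) = g X * g (X + 1) * g (mform 1 1) * g (mform 1 2) * g (mform 2 1)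
     * g (mform 1 3) * (g (mform 3 1) :: bit poly)"
  unfolding small_primes_def by (simp add: mult.assoc)

lemma small_exp_simps:
  "small_exp a b h1 h2 k2 h3 k3 X = a" "small_exp a b h1 h2 k2 h3 k3 (X + 1) = b"
  "small_exp a b h1 h2 k2 h3 k3 (mform 1 1) = h1" "small_exp a b h1 h2 k2 h3 k3 (mform 1 2) = h2"
  "small_exp a b h1 h2 k2 h3 k3 (mform 2 1) = k2" "small_exp a b h1 h2 k2 h3 k3 (mform 1 3) = h3"
  "small_exp a b h1 h2 k2 h3 k3 (mform 3 1) = k3"
  by (simp_all add: small_exp_def)

lemma smono_eq_prod: "smono a b h1 h2 k2 h3 k3 = (\<Prod>p\<in>small_primes. p ^ small_exp a b h1 h2 k2 h3 k3 p)"
  unfolding prod_small_primes small_exp_simps smono_def ..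

lemma finite_small_primes [simp]: "finite small_primes" by (simp add: small_primes_def)

lemma multiplicity_smono:
  "p \<in> small_primes \<Longrightarrow> multiplicity p (smono a b h1 h2 k2 h3 k3) = small_exp a b h1 h2 k2 h3 k3 p"
  unfolding smono_eq_prod
  by (subst multiplicity_prod_prime_powers) (auto simp: prime_bit_poly_iff irreducible_small_primes)

lemma smono_eq_iff: "smono a b h1 h2 k2 h3 k3 = smono a' b' h1' h2' k2' h3' k3' \<longleftrightarrow>
  a = a' \<and> b = b' \<and> h1 = h1' \<and> h2 = h2' \<and> k2 = k2' \<and> h3 = h3' \<and> k3 = k3'"
proof
  assume "smono a b h1 h2 k2 h3 k3 = smono a' b' h1' h2' k2' h3' k3'"
  then have *: "small_exp a b h1 h2 k2 h3 k3 p = small_exp a' b' h1' h2' k2' h3' k3' p" if "p \<in> small_primes" for p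
    using multiplicity_smono[OF that] by metis
  show "a = a' \<and> b = b' \<and> h1 = h1' \<and> h2 = h2' \<and> k2 = k2' \<and> h3 = h3' \<and> k3 = k3'"
    using *[of X] *[of "X + 1"] *[of "mform 1 1"] *[of "mform 1 2"] *[of "mform 2 1"] *[of "mform 1 3"]
      *[of "mform 3 1"]
    unfolding small_exp_simps by (simp add: small_primes_def)
qed simp

lemma smono_nonzero: "smono a b h1 h2 k2 h3 k3 \<noteq> 0"
  by (simp add: smono_def mform_nonzero)

lemma smono_mult: "smono a b h1 h2 k2 h3 k3 * smono a' b' h1' h2' k2' h3' k3' =
  smono (a + a') (b + b') (h1 + h1') (h2 + h2') (k2 + k2') (h3 + h3') (k3 + k3')"
  by (simp add: smono_def power_add mult_ac)

lemma smono_power: "smono a b h1 h2 k2 h3 k3 ^ n = smono (a * n) (b * n) (h1 * n) (h2 * n) (k2 * n) (h3 * n) (k3 * n)"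
  by (simp add: smono_def power_mult power_mult_distrib)

lemma eq_smonoI:
  assumes "A \<noteq> 0" "\<And>q. irreducible q \<Longrightarrow> q dvd A \<Longrightarrow> q \<in> small_primes"
  obtains a b h1 h2 k2 h3 k3 where "A = smono a b h1 h2 k2 h3 k3"
proof -
  have sub: "prime_factors A \<subseteq> small_primes"
    using assms(2) by (auto simp: prime_bit_poly_iff[symmetric] in_prime_factors_iff)
  have "A = (\<Prod>p\<in>prime_factors A. p ^ multiplicity p A)"
    using prod_prime_factors_bit_poly[OF assms(1)] by simp
  also have "\<dots> = (\<Prod>p\<in>small_primes. p ^ multiplicity p A)"
    using sub by (rule prod.mono_neutral_left[OF finite_small_primes])
      (auto simp: in_prime_factors_iff prime_bit_poly_iff irreducible_small_primes assms(1) not_dvd_imp_multiplicity_0)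
  finally show thesis using that unfolding prod_small_primes smono_def by blast
qed

section \<open>Admissible geometric sums of the seven primes\<close>

definition good_prime :: "bit poly \<Rightarrow> bool" where
  "good_prime p \<longleftrightarrow> irreducible p \<and> (p = X \<or> p = X + 1 \<or> mersenne_prime p)"

text \<open>An odd number of terms makes the sum 1 at both 0 and 1, so X and X + 1 are not among its
  factors.\<close>

lemma geo_mersenne_split:
  assumes "odd m" "\<And>q. irreducible q \<Longrightarrow> q dvd geo p m \<Longrightarrow> good_prime q"
    and "poly p 0 = 1 \<and> poly p 1 = 1 \<or> p = X \<or> p = X + 1"
  shows "mersenne_split (geo p m)"
proof -
  have "of_nat k = (of_bool (odd k) :: bit)" for k by (induction k) auto
  then have "(\<Sum>i<m. 1) = (1 :: bit)" using assms(1) by simp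
  moreover have "(\<Sum>i<m. 0 ^ i) = (1 :: bit)" using assms(1) by (cases m) (simp_all add: sum.lessThan_Suc_shift del: power_bit_unfold sum.lessThan_Suc)
  ultimately have "poly (geo p m) 0 = 1" "poly (geo p m) 1 = 1"
    using assms(3) by (auto simp: poly_geo simp del: power_bit_unfold)
  then have "\<not> X dvd geo p m" "\<not> X + 1 dvd geo p m" "geo p m \<noteq> 0"
    by (auto simp: X_dvd_iff X1_dvd_iff)
  then show ?thesis using assms(2) by (auto simp: mersenne_split_def good_prime_def)
qed

text \<open>Collects the numbers of terms left by the four classifications and their
  conjugates.\<close>

definition admissible :: "bit poly \<Rightarrow> nat set" where
  "admissible p = (if p = X \<or> p = X + 1 then {1, 3, 5, 7} else
     if p = mform 1 2 \<or> p = mform 2 1 then {1, 3} else {1})"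

lemma geo_admissible:
  assumes "p \<in> small_primes" "odd m" "\<And>q. irreducible q \<Longrightarrow> q dvd geo p m \<Longrightarrow> good_prime q"
  shows "m \<in> admissible p"
proof -
  have "poly p 0 = 1 \<and> poly p 1 = 1 \<or> p = X \<or> p = X + 1"
    using assms(1) by (auto simp: small_primes_def poly_mform)
  then have split: "mersenne_split (geo p m)" using geo_mersenne_split assms(2,3) by blast
  then have split': "mersenne_split (geo (bar p) m)" by (metis bar_geo mersenne_split_bar)
  have bars: "bar (X + 1) = X" "bar (mform 2 1) = mform 1 2" "bar (mform 3 1) = mform 1 3"
    by (simp_all add: add.assoc)
  show ?thesis
    using assms(1) unfolding small_primes_def
  proof (elim insertE emptyE)
    assume p: "p = X" then show ?thesis using mersenne_split_geo_X[of m] split assms(2) by (simp add: admissible_def)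
  next
    assume p: "p = X + 1" then show ?thesis using mersenne_split_geo_X[of m] split' assms(2) bars
      by (simp add: admissible_def)
  next
    assume p: "p = mform 1 1" then show ?thesis using mersenne_split_geo_M1[of m] split assms(2)
      by (simp add: admissible_def)
  next
    assume p: "p = mform 1 2" then show ?thesis using mersenne_split_geo_M2[of m] split assms(2)
      by (simp add: admissible_def)
  next
    assume p: "p = mform 2 1" then show ?thesis using mersenne_split_geo_M2[of m] split' assms(2) bars
      by (simp add: admissible_def)
  next
    assume p: "p = mform 1 3" then show ?thesis using mersenne_split_geo_M3[of m] split assms(2)
      by (simp add: admissible_def)
  next
    assume p: "p = mform 3 1" then show ?thesis using mersenne_split_geo_M3[of m] split' assms(2) bars
      by (simp add: admissible_def)
  qed
qed

lemma geo_X_values: "geo X 3 = mform 1 1" "geo X 5 = mform 1 3" "geo X 7 = mform 1 2 * mform 2 1"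
proof -
  show "geo X 3 = mform 1 1" "geo X 5 = mform 1 3"
    using mform_1_eq_geo[of 1] mform_1_eq_geo[of 2] by simp_all
  have "geo X 7 = [:1, 1, 1, 1, 1, 1, 1:]"
    by (simp add: numeral_eq_Suc geo_Suc) (simp add: X_def one_pCons)
  moreover have "mform 1 2 * mform 2 1 = [:1, 1, 1, 1, 1, 1, 1:]"
    by (simp add: mform_explicit)
  ultimately show "geo X 7 = mform 1 2 * mform 2 1" by simp
qed

lemma geo_X1_values: "geo (X + 1) 3 = mform 1 1" "geo (X + 1) 5 = mform 3 1" "geo (X + 1) 7 = mform 1 2 * mform 2 1"
  using geo_X_values[THEN arg_cong[of _ _ bar]] by (simp_all add: mult.commute)

lemma geo_3: "geo p 3 = 1 + p + p * p"
  by (simp add: numeral_eq_Suc geo_Suc algebra_simps)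

lemma geo_M2_values: "geo (mform 1 2) 3 = mform 1 1 * mform 3 1" "geo (mform 2 1) 3 = mform 1 1 * mform 1 3"
proof -
  show *: "geo (mform 1 2) 3 = mform 1 1 * mform 3 1"
    unfolding geo_3 by (simp add: mform_explicit one_pCons)
  show "geo (mform 2 1) 3 = mform 1 1 * mform 1 3"
    using arg_cong[OF *, of bar] by simp
qed

text \<open>The closure property behind the choice of \<open>small_primes\<close>: each admissible
  sum is 1, one of these primes, or a product of two of them.\<close>

lemma dvd_geo_admissible_imp_small:
  assumes "p \<in> small_primes" "m \<in> admissible p" "irreducible q" "q dvd geo p m"
  shows "q \<in> small_primes"
proof -
  have *: "q \<in> small_primes" if "q dvd r * s" "r \<in> small_primes" "s \<in> small_primes \<or> s = 1" for r s
  proof -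
    have "q dvd r \<or> q dvd s" using that(1) assms(3) by (metis prime_bit_poly_iff prime_dvd_mult_iff)
    then show ?thesis
      using that(2,3) irreducible_small_primes irreducible_dvd_irreducible[OF assms(3)] assms(3) by auto
  qed
  then have s1: "q \<in> small_primes" if "q dvd r" "r \<in> small_primes" for r using that *[of r 1] by simp
  have F: "mform 1 1 \<in> small_primes" "mform 1 2 \<in> small_primes" "mform 2 1 \<in> small_primes"
    "mform 1 3 \<in> small_primes" "mform 3 1 \<in> small_primes" by (simp_all add: small_primes_def)
  have "m = 1 \<or> geo p m \<in> {mform 1 1, mform 1 3, mform 3 1, mform 1 2 * mform 2 1, mform 1 1 * mform 3 1, mform 1 1 * mform 1 3}"
    using assms(2) geo_X_values geo_X1_values geo_M2_values by (auto simp: admissible_def split: if_splits)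
  moreover have "m \<noteq> 1" using assms(3,4) by auto
  ultimately show ?thesis using assms(4) * s1 F by auto
qed

section \<open>Splitting off the seven primes\<close>

definition fixed :: "(bit poly \<Rightarrow> bit poly) \<Rightarrow> bit poly \<Rightarrow> bool" where
  "fixed f A \<longleftrightarrow> A \<noteq> 0 \<and> f A = A"

definition indecomposable_fixed :: "(bit poly \<Rightarrow> bit poly) \<Rightarrow> bit poly \<Rightarrow> bool" where
  "indecomposable_fixed f A \<longleftrightarrow> fixed f A \<and>
     \<not> (\<exists>B C. A = B * C \<and> coprime B C \<and> degree B > 0 \<and> degree C > 0 \<and> fixed f B \<and> fixed f C)"

lemma sigma_like_prime_power_dvd:
  assumes "sigma_like \<delta> f" "A \<noteq> 0" "irreducible p"
  shows "f (p ^ multiplicity p A) dvd f A"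
proof -
  obtain R where R: "A = p ^ multiplicity p A * R" "\<not> p dvd R"
    by (rule multiplicity_decompose'[of A p]) (use assms in auto)
  have "prime p" using assms(3) by (simp add: prime_bit_poly_iff)
  then have "coprime (p ^ multiplicity p A) R" using R(2) by (simp add: prime_imp_coprime coprime_power_left_iff)
  moreover have "p ^ multiplicity p A \<noteq> 0" "R \<noteq> 0" using R(1) assms(2) by auto
  ultimately have "f (p ^ multiplicity p A * R) = f (p ^ multiplicity p A) * f R"
    using assms(1) by (simp add: sigma_like_def)
  then show ?thesis using R(1) by (metis dvd_triv_left)
qed

text \<open>The sum divides \<open>f\<close> of a full prime power component, hence
  \<open>f A = A\<close>, so its factors are good.\<close>

lemma odd_part_admissible:
  assumes f: "sigma_like \<delta> f" and A: "fixed f A" and good: "\<And>q. irreducible q \<Longrightarrow> q dvd A \<Longrightarrow> good_prime q"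
    and p: "p \<in> small_primes" and h: "multiplicity p A + \<delta> > 0"
  shows "odd_part (multiplicity p A + \<delta>) \<in> admissible p"
proof (rule geo_admissible[OF p odd_odd_part[OF h]])
  fix q assume q: "irreducible q" "q dvd geo p (odd_part (multiplicity p A + \<delta>))"
  have "pow2_part (multiplicity p A + \<delta>) > 0" using h by (simp add: pow2_part_def)
  then have "q dvd f (p ^ multiplicity p A)"
    unfolding sigma_like_prime_power'[OF f irreducible_small_primes[OF p]]
    using q(2) by (meson dvd_mult dvd_power dvd_trans)
  also have "\<dots> dvd A"
    using sigma_like_prime_power_dvd[OF f _ irreducible_small_primes[OF p], of A] A by (simp add: fixed_def)
  finally show "good_prime q" using good q(1) by blast
qed

lemma small_primes_plus_1:
  assumes "p \<in> small_primes" "irreducible q" "q dvd p + 1" shows "q = X \<or> q = X + 1"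
proof -
  have "\<exists>c d. p + 1 = X ^ c * (X + 1) ^ d"
  proof -
    have "mform c d + 1 = X ^ c * (X + 1) ^ d" for c d by (simp add: mform_def add.commute)
    moreover have "X + 1 = X ^ 0 * (X + 1) ^ 1" "X + 1 + 1 = X ^ 1 * (X + 1) ^ 0" by (simp_all add: add.assoc)
    ultimately show ?thesis using assms(1) unfolding small_primes_def by blast
  qed
  then obtain c d where "q dvd X ^ c * (X + 1) ^ d" using assms(3) by auto
  then have "q dvd X \<or> q dvd X + 1"
    using assms(2) by (metis prime_bit_poly_iff prime_dvd_mult_iff prime_dvd_power)
  then show ?thesis using assms(2) irreducible_dvd_irreducible irreducible_X by blast
qed

lemma indecomposable_fixed_prime_factors_small:
  assumes f: "sigma_like \<delta> f" and ind: "indecomposable_fixed f A"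
    and good: "\<And>q. irreducible q \<Longrightarrow> q dvd A \<Longrightarrow> good_prime q" and "X dvd A"
    and r: "irreducible r" "r dvd A"
  shows "r \<in> small_primes"
proof (rule ccontr)
  assume nr: "r \<notin> small_primes"
  have A: "fixed f A" "A \<noteq> 0" "f A = A" using ind by (auto simp: indecomposable_fixed_def fixed_def)
  let ?S1 = "prime_factors A \<inter> small_primes" and ?S2 = "prime_factors A - small_primes"
  let ?e = "\<lambda>p. multiplicity p A"
  define C where "C = (\<Prod>p\<in>?S1. p ^ ?e p)"
  define B where "B = (\<Prod>p\<in>?S2. p ^ ?e p)"
  have irr: "irreducible p" if "p \<in> prime_factors A" for p using that by (auto simp: prime_bit_poly_iff[symmetric])
  have nz: "p \<noteq> 0" if "p \<in> prime_factors A" for p using irr[OF that] by auto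
  have fin: "finite (prime_factors A)" by simp
  have AB: "A = B * C"
    using prod_prime_factors_bit_poly[OF A(2)] prod.Int_Diff[OF fin, of "\<lambda>p. p ^ ?e p" small_primes]
    by (simp add: B_def C_def mult.commute)
  then have nz': "B \<noteq> 0" "C \<noteq> 0" using A(2) by auto
  have primeB: "p \<in> ?S2" if p: "irreducible p" "p dvd B" for p
  proof -
    have "prime p" using p(1) by (simp add: prime_bit_poly_iff)
    then obtain q where q: "q \<in> ?S2" "p dvd q ^ ?e q"
      using p(2) fin unfolding B_def by (auto simp: prime_dvd_prod_iff)
    then have "p dvd q" using \<open>prime p\<close> prime_dvd_power by blast
    then have "p = q" using irreducible_dvd_irreducible[OF p(1) irr] q(1) by blast
    then show ?thesis using q(1) by simp
  qed
  have primeC: "p \<in> small_primes" if p: "irreducible p" "p dvd C" for p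
  proof -
    have "prime p" using p(1) by (simp add: prime_bit_poly_iff)
    then obtain q where q: "q \<in> ?S1" "p dvd q ^ ?e q"
      using p(2) fin unfolding C_def by (auto simp: prime_dvd_prod_iff)
    then have "p dvd q" using \<open>prime p\<close> prime_dvd_power by blast
    then have "p = q" using irreducible_dvd_irreducible[OF p(1) irr] q(1) by blast
    then show ?thesis using q(1) by simp
  qed
  \<comment> \<open>A factor of \<open>f C\<close> divides q + 1, a monomial in X and X + 1, or an
    admissible geometric sum over some q in \<open>small_primes\<close>.\<close>
  have primefC: "p \<in> small_primes" if p: "irreducible p" "p dvd f C" for p
  proof -
    have "f C = (\<Prod>q\<in>?S1. f (q ^ ?e q))" unfolding C_def by (rule sigma_like_prod[OF f]) (use irr in auto)
    moreover have "prime p" using p(1) by (simp add: prime_bit_poly_iff)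
    ultimately obtain q where q: "q \<in> ?S1" "p dvd f (q ^ ?e q)"
      using p(2) fin by (auto simp: prime_dvd_prod_iff)
    have "?e q > 0" using q(1) A(2) by (auto simp: in_prime_factors_iff prime_multiplicity_gt_zero_iff)
    then have adm: "odd_part (?e q + \<delta>) \<in> admissible q" using odd_part_admissible[OF f A(1) good] q(1) by simp
    have "p dvd q + 1 \<or> p dvd geo q (odd_part (?e q + \<delta>))"
      using q(2) sigma_like_prime_power'[OF f, of q "?e q"] irr q(1) \<open>prime p\<close>
      by (metis IntD1 prime_dvd_mult_iff prime_dvd_power)
    then show ?thesis
      using small_primes_plus_1[of q p] dvd_geo_admissible_imp_small[OF _ adm p(1)] q(1) p(1)
      by (auto simp: small_primes_def)
  qed
  have coprimeI: "coprime B D" if "\<And>p. irreducible p \<Longrightarrow> p dvd D \<Longrightarrow> p \<in> small_primes" for D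
  proof (rule ccontr)
    assume "\<not> coprime B D"
    then have "gcd B D \<noteq> 1" "gcd B D \<noteq> 0" using nz' by (auto simp: coprime_iff_gcd_eq_1)
    then obtain p where "irreducible p" "p dvd gcd B D" using exists_irreducible_dvd_bit_poly by blast
    then show False using primeB[of p] that[of p] by auto
  qed
  have BC: "coprime B C" using coprimeI primeC by blast
  then have fBC: "f B * f C = B * C" using f A(3) nz' AB by (simp add: sigma_like_def)
  then have "B dvd f B * f C" by simp
  then have "B dvd f B" using coprimeI[OF primefC] by (simp add: coprime_dvd_mult_left_iff)
  then have fB: "f B = B"
    using dvd_same_degree_bit_poly[of B "f B"] sigma_like_degree[OF f nz'(1)] by simp
  then have fC: "f C = C" using fBC nz' by simp
  have "degree B > 0"
  proof -
    have "r \<in> ?S2" using r nr A(2) by (simp add: in_prime_factors_iff prime_bit_poly_iff)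
    then have "r ^ ?e r dvd B" unfolding B_def using fin by (intro dvd_prodI) auto
    moreover have "prime r" using r(1) by (simp add: prime_bit_poly_iff)
    then have "?e r > 0" using r(2) A(2) by (simp add: prime_multiplicity_gt_zero_iff)
    ultimately have "r dvd B" by (meson dvd_power dvd_trans)
    then show ?thesis using degree_irreducible_bit_poly[OF r(1)] dvd_imp_degree_le[of r B] nz' by simp
  qed
  moreover have "degree C > 0"
  proof -
    \<comment> \<open>The factor X of A guarantees that \<open>C\<close> is not 1, so the
      decomposition is proper.\<close>
    have "X dvd C" using \<open>X dvd A\<close> AB primeB[of X]
      by (auto simp: prime_bit_poly_iff prime_dvd_mult_iff small_primes_def)
    then show ?thesis using dvd_imp_degree_le[of X C] nz' by simp
  qed
  ultimately show False using ind AB BC fB fC nz' unfolding indecomposable_fixed_def fixed_def by blast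
qed

text \<open>The exponent of p + 1 in f (p^h). For \<delta> <= 1 the subtraction never
  truncates.\<close>

definition alpha :: "nat \<Rightarrow> nat \<Rightarrow> nat" where "alpha \<delta> h = pow2_part (h + \<delta>) - \<delta>"

text \<open>The exponent with which \<open>geo p m\<close>, as one particular sum, enters f
  (p^h).\<close>

definition sel :: "nat \<Rightarrow> nat \<Rightarrow> nat \<Rightarrow> nat" where
  "sel \<delta> m h = (if odd_part (h + \<delta>) = m then pow2_part (h + \<delta>) else 0)"

text \<open>Odd part 0 stands for an absent prime when \<delta> = 0.\<close>

definition admissible_exps :: "nat \<Rightarrow> nat \<Rightarrow> nat \<Rightarrow> nat \<Rightarrow> nat \<Rightarrow> nat \<Rightarrow> nat \<Rightarrow> nat \<Rightarrow> bool" where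
  "admissible_exps \<delta> a b h1 h2 k2 h3 k3 \<longleftrightarrow>
     odd_part (a + \<delta>) \<in> {0, 1, 3, 5, 7} \<and> odd_part (b + \<delta>) \<in> {0, 1, 3, 5, 7} \<and> odd_part (h1 + \<delta>) \<in> {0, 1} \<and>
     odd_part (h2 + \<delta>) \<in> {0, 1, 3} \<and> odd_part (k2 + \<delta>) \<in> {0, 1, 3} \<and>
     odd_part (h3 + \<delta>) \<in> {0, 1} \<and> odd_part (k3 + \<delta>) \<in> {0, 1}"

text \<open>The equations say that the two sides of \<open>f A = A\<close> have the same exponents.\<close>

definition balanced :: "nat \<Rightarrow> nat \<Rightarrow> nat \<Rightarrow> nat \<Rightarrow> nat \<Rightarrow> nat \<Rightarrow> nat \<Rightarrow> nat \<Rightarrow> bool" where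
  "balanced \<delta> a b h1 h2 k2 h3 k3 \<longleftrightarrow>
     a = alpha \<delta> b + alpha \<delta> h1 + alpha \<delta> h2 + 2 * alpha \<delta> k2 + alpha \<delta> h3 + 3 * alpha \<delta> k3 \<and>
     b = alpha \<delta> a + alpha \<delta> h1 + 2 * alpha \<delta> h2 + alpha \<delta> k2 + 3 * alpha \<delta> h3 + alpha \<delta> k3 \<and>
     h1 = sel \<delta> 3 a + sel \<delta> 3 b + sel \<delta> 3 h2 + sel \<delta> 3 k2 \<and>
     h2 = sel \<delta> 7 a + sel \<delta> 7 b \<and> k2 = sel \<delta> 7 a + sel \<delta> 7 b \<and>
     h3 = sel \<delta> 5 a + sel \<delta> 3 k2 \<and> k3 = sel \<delta> 5 b + sel \<delta> 3 h2"

lemma odd_part_0_iff: "odd_part n = 0 \<longleftrightarrow> n = 0"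
  using odd_odd_part[of n] by (cases "n = 0") (auto simp: odd_part_def pow2_part_def elim: oddE)

text \<open>The coefficients 2 and 3 stem from \<open>mform c d + 1 = X ^ c * (X + 1) ^ d\<close>;
  the \<open>sel\<close> terms record the values of the admissible sums.\<close>

lemma sigma_like_smono:
  assumes f: "sigma_like \<delta> f" and adm: "admissible_exps \<delta> a b h1 h2 k2 h3 k3"
  shows "f (smono a b h1 h2 k2 h3 k3) = smono
    (alpha \<delta> b + alpha \<delta> h1 + alpha \<delta> h2 + 2 * alpha \<delta> k2 + alpha \<delta> h3 + 3 * alpha \<delta> k3)
    (alpha \<delta> a + alpha \<delta> h1 + 2 * alpha \<delta> h2 + alpha \<delta> k2 + 3 * alpha \<delta> h3 + alpha \<delta> k3)
    (sel \<delta> 3 a + sel \<delta> 3 b + sel \<delta> 3 h2 + sel \<delta> 3 k2) (sel \<delta> 7 a + sel \<delta> 7 b) (sel \<delta> 7 a + sel \<delta> 7 b)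
    (sel \<delta> 5 a + sel \<delta> 3 k2) (sel \<delta> 5 b + sel \<delta> 3 h2)"
proof -
  have pw: "f (p ^ h) = (p + 1) ^ alpha \<delta> h * geo p (odd_part (h + \<delta>)) ^ pow2_part (h + \<delta>)" if "p \<in> small_primes" for p h
    using sigma_like_prime_power'[OF f irreducible_small_primes[OF that]] by (simp add: alpha_def)
  have mp1: "mform c d + 1 = X ^ c * (X + 1) ^ d" for c d by (simp add: mform_def add.commute)
  have P0: "pow2_part n = 0" if "odd_part n = 0" for n using that by (simp add: odd_part_0_iff pow2_part_def)
  have g: "geo X m ^ r = smono 0 0 (if m = 3 then r else 0) (if m = 7 then r else 0) (if m = 7 then r else 0) (if m = 5 then r else 0) 0"
      "geo (X + 1) m ^ r = smono 0 0 (if m = 3 then r else 0) (if m = 7 then r else 0) (if m = 7 then r else 0) 0 (if m = 5 then r else 0)"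
    if "m \<in> {0, 1, 3, 5, 7}" "m = 0 \<Longrightarrow> r = 0" for m r
    using that geo_X_values geo_X1_values by (elim insertE emptyE; simp add: smono_def power_mult_distrib)+
  have g2: "geo (mform 1 2) m ^ r = smono 0 0 (if m = 3 then r else 0) 0 0 0 (if m = 3 then r else 0)"
      "geo (mform 2 1) m ^ r = smono 0 0 (if m = 3 then r else 0) 0 0 (if m = 3 then r else 0) 0"
    if "m \<in> {0, 1, 3}" "m = 0 \<Longrightarrow> r = 0" for m r
    using that geo_M2_values by (elim insertE emptyE; simp add: smono_def power_mult_distrib)+
  have g1: "geo p m ^ r = smono 0 0 0 0 0 0 0" if "m \<in> {0, 1}" "m = 0 \<Longrightarrow> r = 0" for m r p
    using that by (elim insertE emptyE; simp add: smono_def)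
  have l: "(mform c d + 1) ^ n = smono (c * n) (d * n) 0 0 0 0 0" "X ^ n = smono n 0 0 0 0 0 0"
    "(X + 1) ^ n = smono 0 n 0 0 0 0 0" for c d n
    by (simp_all add: mp1 smono_def power_mult_distrib power_mult)
  have X11: "X + 1 + 1 = X" by (simp add: add.assoc)
  have "f (X ^ a) = smono 0 (alpha \<delta> a) (sel \<delta> 3 a) (sel \<delta> 7 a) (sel \<delta> 7 a) (sel \<delta> 5 a) 0"
    using adm P0[of "a + \<delta>"] g(1)[of "odd_part (a + \<delta>)" "pow2_part (a + \<delta>)"] unfolding admissible_exps_def
    by (simp add: pw small_primes_def l(3) sel_def smono_mult)
  moreover have "f ((X + 1) ^ b) = smono (alpha \<delta> b) 0 (sel \<delta> 3 b) (sel \<delta> 7 b) (sel \<delta> 7 b) 0 (sel \<delta> 5 b)"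
    using adm P0[of "b + \<delta>"] g(2)[of "odd_part (b + \<delta>)" "pow2_part (b + \<delta>)"] unfolding admissible_exps_def
    by (simp add: pw small_primes_def X11 l(2) sel_def smono_mult)
  moreover have "f (mform 1 1 ^ h1) = smono (alpha \<delta> h1) (alpha \<delta> h1) 0 0 0 0 0"
    using adm P0[of "h1 + \<delta>"] g1[of "odd_part (h1 + \<delta>)" "pow2_part (h1 + \<delta>)" "mform 1 1"]
    unfolding admissible_exps_def by (simp add: pw small_primes_def l(1) sel_def smono_mult)
  moreover have "f (mform 1 2 ^ h2) = smono (alpha \<delta> h2) ((2 * alpha \<delta> h2)) (sel \<delta> 3 h2) 0 0 0 (sel \<delta> 3 h2)"
    using adm P0[of "h2 + \<delta>"] g2(1)[of "odd_part (h2 + \<delta>)" "pow2_part (h2 + \<delta>)"]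
    unfolding admissible_exps_def by (simp add: pw small_primes_def l(1) sel_def smono_mult)
  moreover have "f (mform 2 1 ^ k2) = smono (2 * alpha \<delta> k2) ((alpha \<delta> k2)) (sel \<delta> 3 k2) 0 0 (sel \<delta> 3 k2) 0"
    using adm P0[of "k2 + \<delta>"] g2(2)[of "odd_part (k2 + \<delta>)" "pow2_part (k2 + \<delta>)"]
    unfolding admissible_exps_def by (simp add: pw small_primes_def l(1) sel_def smono_mult)
  moreover have "f (mform 1 3 ^ h3) = smono (alpha \<delta> h3) ((3 * alpha \<delta> h3)) 0 0 0 0 0"
    using adm P0[of "h3 + \<delta>"] g1[of "odd_part (h3 + \<delta>)" "pow2_part (h3 + \<delta>)" "mform 1 3"]
    unfolding admissible_exps_def by (simp add: pw small_primes_def l(1) sel_def smono_mult)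
  moreover have "f (mform 3 1 ^ k3) = smono (3 * alpha \<delta> k3) ((alpha \<delta> k3)) 0 0 0 0 0"
    using adm P0[of "k3 + \<delta>"] g1[of "odd_part (k3 + \<delta>)" "pow2_part (k3 + \<delta>)" "mform 3 1"]
    unfolding admissible_exps_def by (simp add: pw small_primes_def l(1) sel_def smono_mult)
  moreover have "f (smono a b h1 h2 k2 h3 k3) = f (X ^ a) * f ((X + 1) ^ b) * f (mform 1 1 ^ h1) * f (mform 1 2 ^ h2)
      * f (mform 2 1 ^ k2) * f (mform 1 3 ^ h3) * f (mform 3 1 ^ k3)"
    unfolding smono_eq_prod
    by (subst sigma_like_prod[OF f finite_small_primes irreducible_small_primes], assumption)
       (simp only: prod_small_primes small_exp_simps)
  ultimately show ?thesis by (simp only: smono_mult add_0_left add_0_right add.assoc)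
qed

text \<open>The classification of geometric sums yields admissibility; then unique factorisation
  reduces \<open>f A = A\<close> to equations between exponents.\<close>

lemma fixed_smono_iff:
  assumes f: "sigma_like \<delta> f"
  shows "fixed f (smono a b h1 h2 k2 h3 k3) \<longleftrightarrow> admissible_exps \<delta> a b h1 h2 k2 h3 k3 \<and> balanced \<delta> a b h1 h2 k2 h3 k3"
proof
  assume fx: "fixed f (smono a b h1 h2 k2 h3 k3)"
  have good: "good_prime q" if q: "irreducible q" "q dvd smono a b h1 h2 k2 h3 k3" for q
  proof -
    have "prime q" using q(1) by (simp add: prime_bit_poly_iff)
    then obtain p where "p \<in> small_primes" "q dvd p ^ small_exp a b h1 h2 k2 h3 k3 p"
      using q(2) unfolding smono_eq_prod by (auto simp: prime_dvd_prod_iff)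
    then have "q \<in> small_primes"
      using irreducible_dvd_irreducible[OF q(1) irreducible_small_primes] \<open>prime q\<close> prime_dvd_power by blast
    then show ?thesis by (auto simp: small_primes_def good_prime_def mersenne_prime_mform_iff)
  qed
  have adm: "odd_part (small_exp a b h1 h2 k2 h3 k3 p + \<delta>) \<in> insert 0 (admissible p)" if "p \<in> small_primes" for p
    using odd_part_admissible[OF f fx good that] unfolding multiplicity_smono[OF that]
    by (cases "small_exp a b h1 h2 k2 h3 k3 p + \<delta> = 0") (auto simp: odd_part_0_iff)
  have "admissible_exps \<delta> a b h1 h2 k2 h3 k3"
    using adm[of X] adm[of "X + 1"] adm[of "mform 1 1"] adm[of "mform 1 2"] adm[of "mform 2 1"]
      adm[of "mform 1 3"] adm[of "mform 3 1"]
    unfolding small_exp_simps admissible_exps_def by (auto simp: admissible_def small_primes_def)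
  then show "admissible_exps \<delta> a b h1 h2 k2 h3 k3 \<and> balanced \<delta> a b h1 h2 k2 h3 k3"
    using fx unfolding fixed_def sigma_like_smono[OF f \<open>admissible_exps \<delta> a b h1 h2 k2 h3 k3\<close>] smono_eq_iff balanced_def
    by auto
next
  assume "admissible_exps \<delta> a b h1 h2 k2 h3 k3 \<and> balanced \<delta> a b h1 h2 k2 h3 k3"
  then show "fixed f (smono a b h1 h2 k2 h3 k3)"
    unfolding fixed_def using smono_nonzero sigma_like_smono[OF f] unfolding balanced_def by metis
qed

section \<open>Comparison of exponents\<close>

lemma pow2_part_cases: "n > 0 \<Longrightarrow> \<exists>k. pow2_part n = 2 ^ k"
  by (auto simp: pow2_part_def)

lemma pow2_part_scale: "pow2_part (2 ^ k * n) = 2 ^ k * pow2_part n" "odd_part (2 ^ k * n) = odd_part n"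
proof -
  have "pow2_part (2 ^ k * n) = 2 ^ k * pow2_part n \<and> odd_part (2 ^ k * n) = odd_part n"
  proof (cases "n = 0")
    case False
    then obtain j where j: "pow2_part n = 2 ^ j" using pow2_part_cases by blast
    have "2 ^ k * n = 2 ^ (k + j) * odd_part n" using pow2_part_mult_odd_part[of n] j
      by (simp add: power_add mult.assoc)
    moreover have "odd (odd_part n)" using False by (simp add: odd_odd_part)
    ultimately show ?thesis using pow2_part_eqI[of "odd_part n" "k + j"] j by (metis power_add)
  qed (simp add: pow2_part_def odd_part_def)
  then show "pow2_part (2 ^ k * n) = 2 ^ k * pow2_part n" "odd_part (2 ^ k * n) = odd_part n" by auto
qed

lemma part_odd: "odd n \<Longrightarrow> pow2_part n = 1 \<and> odd_part n = n"
  using pow2_part_eqI[of n 0] by simp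

lemma part_simps [simp]:
  "pow2_part 0 = 0" "odd_part 0 = 0" "pow2_part 1 = 1" "odd_part 1 = 1" "pow2_part (Suc 0) = Suc 0" "odd_part (Suc 0) = Suc 0"
  "pow2_part (numeral (Num.Bit0 k)) = 2 * pow2_part (numeral k)"
  "odd_part (numeral (Num.Bit0 k)) = odd_part (numeral k)"
  "pow2_part (numeral (Num.Bit1 k)) = 1" "odd_part (numeral (Num.Bit1 k)) = numeral (Num.Bit1 k)"
  using pow2_part_scale[of 1 "numeral k"] part_odd[of 1] part_odd[of "numeral (Num.Bit1 k)"]
  by (simp_all add: pow2_part_def odd_part_def mult_2 flip: numeral_Bit0)

text \<open>All exponents are determined by the exponents of \<open>X\<close> and \<open>X + 1\<close>.\<close>

definition balanced_by :: "nat \<Rightarrow> nat \<Rightarrow> nat \<Rightarrow> nat \<Rightarrow> nat \<Rightarrow> nat \<Rightarrow> nat \<Rightarrow> bool" where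
  "balanced_by \<delta> a b h1 h2 h3 k3 \<longleftrightarrow>
     h2 = sel \<delta> 7 a + sel \<delta> 7 b \<and> odd_part (h2 + \<delta>) \<in> {0, 1, 3} \<and>
     h1 = sel \<delta> 3 a + sel \<delta> 3 b + 2 * sel \<delta> 3 h2 \<and> odd_part (h1 + \<delta>) \<in> {0, 1} \<and>
     h3 = sel \<delta> 5 a + sel \<delta> 3 h2 \<and> odd_part (h3 + \<delta>) \<in> {0, 1} \<and>
     k3 = sel \<delta> 5 b + sel \<delta> 3 h2 \<and> odd_part (k3 + \<delta>) \<in> {0, 1} \<and>
     a = alpha \<delta> b + alpha \<delta> h1 + 3 * alpha \<delta> h2 + alpha \<delta> h3 + 3 * alpha \<delta> k3 \<and>
     b = alpha \<delta> a + alpha \<delta> h1 + 3 * alpha \<delta> h2 + 3 * alpha \<delta> h3 + alpha \<delta> k3"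

text \<open>\<open>M 2\<close> and its conjugate arise only together, from sums with 7 terms, so
  their exponents agree.\<close>

lemma balanced_iff:
  "admissible_exps \<delta> a b h1 h2 k2 h3 k3 \<and> balanced \<delta> a b h1 h2 k2 h3 k3 \<longleftrightarrow>
    odd_part (a + \<delta>) \<in> {0, 1, 3, 5, 7} \<and> odd_part (b + \<delta>) \<in> {0, 1, 3, 5, 7} \<and> k2 = h2 \<and>
    balanced_by \<delta> a b h1 h2 h3 k3"
proof (cases "k2 = h2")
  case True
  have e: "x + y + z + 2 * z + v + w = x + y + 3 * z + v + w" "x + y + 2 * z + z + v + w = x + y + 3 * z + v + w"
    "x + y + z + z = x + y + 2 * z" for x y z v w :: nat by simp_all
  show ?thesis unfolding admissible_exps_def balanced_def balanced_by_def True e by blast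
next
  case False
  then show ?thesis unfolding balanced_def by metis
qed

text \<open>Some Mersenne prime must occur, since X^(2^n - 1) (X + 1)^(2^n - 1) is perfect for every
  n. If 4 divided both 2-parts, all Mersenne exponents h would be multiples of 4; but then h + 1 is
  odd and at most 3, so h = 0. Hence one 2-part is at most 2, and the other at most 14, so at most
  8.\<close>

lemma perfect_exponents_bound:
  assumes "odd_part (a + 1) \<in> {0, 1, 3, 5, 7}" "odd_part (b + 1) \<in> {0, 1, 3, 5, 7}"
    and bal: "balanced_by 1 a b h1 h2 h3 k3" and "h1 + h2 + h3 + k3 > 0"
  shows "pow2_part (a + 1) \<in> {1, 2, 4, 8}" "pow2_part (b + 1) \<in> {1, 2, 4, 8}"
proof -
  define u w where "u = pow2_part (a + 1)" and "w = pow2_part (b + 1)"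
  obtain i j where ij: "u = 2 ^ i" "w = 2 ^ j"
    using pow2_part_cases[of "a + 1"] pow2_part_cases[of "b + 1"] by (auto simp: u_def w_def)
  have small: "pow2_part n \<le> 8 \<Longrightarrow> n > 0 \<Longrightarrow> pow2_part n \<in> {1, 2, 4, 8}" for n
  proof -
    assume n: "pow2_part n \<le> 8" "n > 0"
    obtain k where k: "pow2_part n = 2 ^ k" using pow2_part_cases n(2) by blast
    have "\<not> k \<ge> 4" using power_increasing[of 4 k "2 :: nat"] k n(1) by auto
    then have "k = 0 \<or> k = 1 \<or> k = 2 \<or> k = 3" by auto
    then show ?thesis using k by auto
  qed
  have le: "odd_part n \<in> {0, 1, 3, 5, 7} \<Longrightarrow> n \<le> 7 * pow2_part n" for n
  proof -
    assume "odd_part n \<in> {0, 1, 3, 5, 7}"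
    then have "odd_part n \<le> 7" by auto
    then have "pow2_part n * odd_part n \<le> pow2_part n * 7" by (intro mult_left_mono) auto
    then show "n \<le> 7 * pow2_part n" by (metis mult.commute pow2_part_mult_odd_part)
  qed
  \<comment> \<open>The equation for a gives a >= w - 1, while a + 1 <= 7 u; symmetrically for
    b.\<close>
  have uw: "w \<le> 7 * u" "u \<le> 7 * w"
    using bal le[OF assms(1)] le[OF assms(2)] unfolding balanced_by_def alpha_def u_def w_def by linarith+
  have "\<not> (4 dvd u \<and> 4 dvd w)"
  proof
    assume four: "4 dvd u \<and> 4 dvd w"
    then have sel4: "4 dvd sel 1 m a" "4 dvd sel 1 m b" for m by (auto simp: sel_def u_def w_def)
    have zero: "h = 0" if "4 dvd h" "odd_part (h + 1) \<in> {0, 1, 3}" for h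
    proof -
      have "odd (h + 1)" using that(1) by (auto elim!: dvdE)
      then have "h + 1 \<in> {0, 1, 3}" using part_odd that(2) by metis
      then show ?thesis using that(1) by auto
    qed
    have B: "h2 = sel 1 7 a + sel 1 7 b" "odd_part (h2 + 1) \<in> {0, 1, 3}"
      "h1 = sel 1 3 a + sel 1 3 b + 2 * sel 1 3 h2" "odd_part (h1 + 1) \<in> {0, 1, 3}"
      "h3 = sel 1 5 a + sel 1 3 h2" "odd_part (h3 + 1) \<in> {0, 1, 3}"
      "k3 = sel 1 5 b + sel 1 3 h2" "odd_part (k3 + 1) \<in> {0, 1, 3}"
      using bal unfolding balanced_by_def by blast+
    have "4 dvd h2" unfolding B(1) by (intro dvd_add sel4)
    then have h2: "h2 = 0" using zero B(2) by blast
    have s0: "sel 1 3 h2 = 0" by (simp add: h2 sel_def)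
    have "4 dvd h1" "4 dvd h3" "4 dvd k3"
      unfolding B(3,5,7) s0 mult_0_right add_0_right by (intro dvd_add sel4)+
    then have "h1 = 0" "h3 = 0" "k3 = 0" using zero B(4,6,8) by blast+
    then show False using assms(4) h2 by simp
  qed
  then have "i \<le> 1 \<or> j \<le> 1"
    using le_imp_power_dvd[of 2 i "2 :: nat"] le_imp_power_dvd[of 2 j "2 :: nat"] unfolding ij by (cases "i \<le> 1"; cases "j \<le> 1") auto
  moreover have "(2 :: nat) ^ k \<le> 2" if "k \<le> 1" for k using power_increasing[OF that, of "2::nat"] by simp
  ultimately have "u \<le> 2 \<or> w \<le> 2" unfolding ij by blast
  then have lt: "u < 16" "w < 16" using uw by auto
  have "\<not> 4 \<le> i" "\<not> 4 \<le> j"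
    using power_increasing[of 4 i "2 :: nat"] power_increasing[of 4 j "2 :: nat"] lt unfolding ij by auto
  then have "u \<le> 8" "w \<le> 8"
    unfolding ij using power_increasing[of i 3 "2 :: nat"] power_increasing[of j 3 "2 :: nat"] by auto
  then show "pow2_part (a + 1) \<in> {1, 2, 4, 8}" "pow2_part (b + 1) \<in> {1, 2, 4, 8}"
    using small u_def w_def by auto
qed

lemma exponent_range:
  assumes "odd_part n \<in> {0, 1, 3, 5, 7}" "pow2_part n \<in> {1, 2, 4, 8}"
  shows "n \<in> {0, 1, 2, 4, 8, 3, 6, 12, 24, 5, 10, 20, 40, 7, 14, 28, 56}"
  using assms pow2_part_mult_odd_part[of n] by auto

text \<open>The nesting makes the simplifier evaluate the exponents one after the other.\<close>

definition balance_check3 :: "nat \<Rightarrow> nat \<Rightarrow> nat \<Rightarrow> nat \<Rightarrow> nat \<Rightarrow> nat \<Rightarrow> nat \<Rightarrow> bool" where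
  "balance_check3 \<delta> a b h1 h2 h3 k3 =
    (if odd_part (h1 + \<delta>) \<in> {0, 1} then if odd_part (h3 + \<delta>) \<in> {0, 1} then if odd_part (k3 + \<delta>) \<in> {0, 1} then
      if a = alpha \<delta> b + alpha \<delta> h1 + 3 * alpha \<delta> h2 + alpha \<delta> h3 + 3 * alpha \<delta> k3
      then b = alpha \<delta> a + alpha \<delta> h1 + 3 * alpha \<delta> h2 + 3 * alpha \<delta> h3 + alpha \<delta> k3
      else False else False else False else False)"

definition balance_check2 :: "nat \<Rightarrow> nat \<Rightarrow> nat \<Rightarrow> nat \<Rightarrow> nat \<Rightarrow> bool" where
  "balance_check2 \<delta> a b h2 s =
    balance_check3 \<delta> a b (sel \<delta> 3 a + sel \<delta> 3 b + 2 * s) h2 (sel \<delta> 5 a + s) (sel \<delta> 5 b + s)"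

definition balance_check1 :: "nat \<Rightarrow> nat \<Rightarrow> nat \<Rightarrow> nat \<Rightarrow> bool" where
  "balance_check1 \<delta> a b h2 =
    (if odd_part (h2 + \<delta>) \<in> {0, 1, 3} then balance_check2 \<delta> a b h2 (sel \<delta> 3 h2) else False)"

definition balance_check :: "nat \<Rightarrow> nat \<Rightarrow> nat \<Rightarrow> bool" where
  "balance_check \<delta> a b = balance_check1 \<delta> a b (sel \<delta> 7 a + sel \<delta> 7 b)"

lemmas balance_check_defs = balance_check_def balance_check1_def balance_check2_def balance_check3_def

lemma balanced_by_imp_check: "balanced_by \<delta> a b h1 h2 h3 k3 \<Longrightarrow> balance_check \<delta> a b"
  unfolding balanced_by_def balance_check_defs by metis

lemma list_all_list_allD:
  "list_all (\<lambda>a. list_all (\<lambda>b. P a b \<longrightarrow> Q a b) ys) xs \<Longrightarrow> a \<in> set xs \<Longrightarrow> b \<in> set ys \<Longrightarrow> P a b \<Longrightarrow> Q a b"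
  by (auto simp: list_all_iff)

text \<open>The numbers \<open>2 ^ i * m - 1\<close> with \<open>i \<le> 3\<close> and \<open>m \<in> {1, 3, 5, 7}\<close>.\<close>

definition exponent_candidates :: "nat list" where
  "exponent_candidates = [0, 1, 3, 7, 2, 5, 11, 23, 4, 9, 19, 39, 6, 13, 27, 55]"

text \<open>The pairs (0,0), (1,1), (3,3), (7,7) are the solutions without a Mersenne factor; they
  are discarded afterwards.\<close>

lemma perfect_enumeration:
  "list_all (\<lambda>a. list_all (\<lambda>b. balance_check 1 a b \<longrightarrow>
     (a, b) \<in> set [(0,0), (2,1), (4,4), (4,6), (4,3), (6,4), (6,3), (1,2), (1,1), (3,4), (3,6), (3,3), (7,7)])
     exponent_candidates) exponent_candidates"
  unfolding exponent_candidates_def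
  by (simp add: balance_check_defs sel_def alpha_def del: One_nat_def split del: if_split)

lemma perfect_exponents:
  assumes "odd_part (a + 1) \<in> {0, 1, 3, 5, 7}" "odd_part (b + 1) \<in> {0, 1, 3, 5, 7}"
    and bal: "balanced_by 1 a b h1 h2 h3 k3" and nz: "h1 + h2 + h3 + k3 > 0"
  shows "(a, b, h1, h2, h3, k3) \<in> {(2,1,1,0,0,0), (1,2,1,0,0,0), (4,3,0,0,1,0), (3,4,0,0,0,1), (4,4,0,0,1,1),
    (6,3,0,1,0,0), (3,6,0,1,0,0), (4,6,0,1,1,0), (6,4,0,1,0,1)}"
proof -
  have range: "n \<in> set exponent_candidates"
    if "n + 1 \<in> {0, 1, 2, 4, 8, 3, 6, 12, 24, 5, 10, 20, 40, 7, 14, 28, 56}" for n :: nat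
    using that by (auto simp: exponent_candidates_def)
  note b = perfect_exponents_bound[OF assms]
  have "a \<in> set exponent_candidates" "b \<in> set exponent_candidates"
    using range exponent_range assms(1,2) b by metis+
  moreover have "balance_check 1 a b" using bal by (rule balanced_by_imp_check)
  ultimately have "(a, b) \<in> set [(0,0), (2,1), (4,4), (4,6), (4,3), (6,4), (6,3), (1,2), (1,1), (3,4), (3,6), (3,3), (7,7)]"
    using perfect_enumeration unfolding list_all_iff by blast
  then have "(a, b) = (0,0) \<or> (a, b) = (2,1) \<or> (a, b) = (4,4) \<or> (a, b) = (4,6) \<or> (a, b) = (4,3) \<or> (a, b) = (6,4) \<or> (a, b) = (6,3)
     \<or> (a, b) = (1,2) \<or> (a, b) = (1,1) \<or> (a, b) = (3,4) \<or> (a, b) = (3,6) \<or> (a, b) = (3,3) \<or> (a, b) = (7,7)" by simp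
  moreover have "h2 = sel 1 7 a + sel 1 7 b" "h1 = sel 1 3 a + sel 1 3 b + 2 * sel 1 3 h2"
    "h3 = sel 1 5 a + sel 1 3 h2" "k3 = sel 1 5 b + sel 1 3 h2"
    using bal unfolding balanced_by_def by blast+
  ultimately show ?thesis using nz
    by (elim disjE; simp add: sel_def del: One_nat_def split del: if_split)
qed

section \<open>Exponents in the unitary case\<close>

lemma sel_scale: "sel 0 m (2 ^ k * h) = 2 ^ k * sel 0 m h" and alpha_scale: "alpha 0 (2 ^ k * h) = 2 ^ k * alpha 0 h"
  by (simp_all add: sel_def alpha_def pow2_part_scale)

text \<open>For \<delta> = 0 every term is homogeneous under multiplication by a power of 2, which
  reflects that squaring preserves unitary perfection.\<close>

lemma balanced_by_scale:
  "balanced_by 0 (2 ^ k * a) (2 ^ k * b) (2 ^ k * h1) (2 ^ k * h2) (2 ^ k * h3) (2 ^ k * k3) \<longleftrightarrow>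
     balanced_by 0 a b h1 h2 h3 k3"
proof -
  define g where "g = (2 :: nat) ^ k"
  have g: "g * x = g * y \<longleftrightarrow> x = y" for x y :: nat by (simp add: g_def)
  have d: "g * x + g * y = g * (x + y)" "c * (g * x) = g * (c * x)" for c x y :: nat by (simp_all add: algebra_simps)
  note sc = sel_scale[of _ k, folded g_def] alpha_scale[of k, folded g_def] pow2_part_scale(2)[of k, folded g_def]
  show ?thesis unfolding balanced_by_def g_def[symmetric] add_0_right sc d g ..
qed

text \<open>After scaling, one exponent is odd and the other has 2-part at most 4. The pair (1,1),
  that is X (X + 1), is the only solution without a Mersenne factor.\<close>

lemma unitary_perfect_enumeration:
  "list_all (\<lambda>a. list_all (\<lambda>b. balance_check 0 a b \<longrightarrow> (a, b) \<in> set [(1,1), (3,3), (5,5), (5,7), (7,5), (7,7), (3,2), (2,3), (5,6), (6,5), (7,6), (6,7),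
       (5,4), (4,5), (7,4), (4,7)]) [1,3,5,7,2,6,10,14,4,12,20,28]) [1,3,5,7]"
  "list_all (\<lambda>a. list_all (\<lambda>b. balance_check 0 a b \<longrightarrow> (a, b) \<in> set [(1,1), (3,3), (5,5), (5,7), (7,5), (7,7), (3,2), (2,3), (5,6), (6,5), (7,6), (6,7),
       (5,4), (4,5), (7,4), (4,7)]) [1,3,5,7]) [2,6,10,14,4,12,20,28]"
  by (simp_all add: balance_check_defs numeral_2_eq_2[symmetric] sel_def alpha_def del: One_nat_def split del: if_split)

lemma unitary_perfect_exponents:
  assumes odd: "odd_part a \<in> {1, 3, 5, 7}" "odd_part b \<in> {1, 3, 5, 7}"
    and bal: "balanced_by 0 a b h1 h2 h3 k3" and nz: "h1 + h2 + h3 + k3 > 0"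
  obtains k a' b' h1' h2' h3' k3' where
    "a = 2 ^ k * a'" "b = 2 ^ k * b'" "h1 = 2 ^ k * h1'" "h2 = 2 ^ k * h2'" "h3 = 2 ^ k * h3'" "k3 = 2 ^ k * k3'"
    "(a', b', h1', h2', h3', k3') \<in> {(3,3,2,0,0,0), (5,5,0,0,1,1), (5,7,0,1,1,0), (7,5,0,1,0,1), (7,7,0,2,0,0),
      (3,2,1,0,0,0), (2,3,1,0,0,0), (5,6,2,0,1,0), (6,5,2,0,0,1), (7,6,2,1,0,0), (6,7,2,1,0,0), (5,4,0,0,1,0),
      (4,5,0,0,0,1), (7,4,0,1,0,0), (4,7,0,1,0,0)}"
proof -
  have pos: "a > 0" "b > 0" using odd by (auto intro!: gr0I)
  obtain i j where ij: "pow2_part a = 2 ^ i" "pow2_part b = 2 ^ j" using pow2_part_cases pos by metis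
  define k where "k = min i j"
  have a: "a = 2 ^ k * (2 ^ (i - k) * odd_part a)" and b: "b = 2 ^ k * (2 ^ (j - k) * odd_part b)"
    using pow2_part_mult_odd_part[of a] pow2_part_mult_odd_part[of b] ij
    by (simp_all add: k_def mult.assoc[symmetric] power_add[symmetric])
  define a' b' where "a' = 2 ^ (i - k) * odd_part a" and "b' = 2 ^ (j - k) * odd_part b"
  have s: "sel 0 m a = 2 ^ k * sel 0 m a'" "sel 0 m b = 2 ^ k * sel 0 m b'" for m
    using sel_scale[of m k a'] sel_scale[of m k b'] a b by (simp_all add: a'_def b'_def)
  have E: "h2 = sel 0 7 a + sel 0 7 b" "h1 = sel 0 3 a + sel 0 3 b + 2 * sel 0 3 h2"
    "h3 = sel 0 5 a + sel 0 3 h2" "k3 = sel 0 5 b + sel 0 3 h2"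
    using bal unfolding balanced_by_def by blast+
  define h2' where "h2' = sel 0 7 a' + sel 0 7 b'"
  have h2: "h2 = 2 ^ k * h2'" unfolding h2'_def by (subst E(1)) (simp only: s distrib_left)
  define h1' h3' k3' where "h1' = sel 0 3 a' + sel 0 3 b' + 2 * sel 0 3 h2'"
    and "h3' = sel 0 5 a' + sel 0 3 h2'" and "k3' = sel 0 5 b' + sel 0 3 h2'"
  have s2: "sel 0 3 h2 = 2 ^ k * sel 0 3 h2'" unfolding h2 by (rule sel_scale)
  have h: "h1 = 2 ^ k * h1'" "h3 = 2 ^ k * h3'" "k3 = 2 ^ k * k3'"
    unfolding E(2,3,4) s s2 h1'_def h3'_def k3'_def by (simp_all add: algebra_simps)
  have bal': "balanced_by 0 a' b' h1' h2' h3' k3'"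
    using bal balanced_by_scale[of k a' b' h1' h2' h3' k3'] h h2 a b by (simp add: a'_def b'_def)
  have nz': "h1' + h2' + h3' + k3' > 0" using nz h h2 by auto
  have part: "pow2_part a' = 2 ^ (i - k)" "pow2_part b' = 2 ^ (j - k)"
    using pow2_part_eqI[of "odd_part a" "i - k"] pow2_part_eqI[of "odd_part b" "j - k"] odd_odd_part pos
    by (simp_all add: a'_def b'_def)
  \<comment> \<open>The equation for a' contains the 2-part of b', and a' is at most 7 times its own
    2-part. As one of the 2-parts is 1, the other is at most 7.\<close>
  have "2 ^ (j - k) \<le> a'" "2 ^ (i - k) \<le> b'"
    using bal' unfolding balanced_by_def alpha_def add_0_right diff_zero part by linarith+
  moreover have "odd_part a \<le> 7" "odd_part b \<le> 7" using odd by auto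
  then have "a' \<le> 2 ^ (i - k) * 7" "b' \<le> 2 ^ (j - k) * 7"
    unfolding a'_def b'_def by (intro mult_left_mono; simp)+
  moreover have k0: "i - k = 0 \<or> j - k = 0" by (auto simp: k_def)
  ultimately have le7: "(2 :: nat) ^ (i - k) \<le> 7" "(2 :: nat) ^ (j - k) \<le> 7" by auto
  have le: "n \<le> 2" if "(2 :: nat) ^ n \<le> 7" for n
    using that power_increasing[of 3 n "2 :: nat"] by (cases "n \<le> 2") auto
  have pc: "(i - k = 0 \<and> j - k = 0) \<or> (i - k = 0 \<and> j - k = 1) \<or> (i - k = 0 \<and> j - k = 2) \<or> (i - k = 1 \<and> j - k = 0) \<or> (i - k = 2 \<and> j - k = 0)"
    using k0 le[OF le7(1)] le[OF le7(2)] by auto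
  have cases: "(a' \<in> set [1,3,5,7] \<and> b' \<in> set [1,3,5,7,2,6,10,14,4,12,20,28]) \<or>
      (a' \<in> set [2,6,10,14,4,12,20,28] \<and> b' \<in> set [1,3,5,7])"
    using pc odd unfolding a'_def b'_def by (elim disjE conjE insertE emptyE; simp)
  have check: "balance_check 0 a' b'" using bal' by (rule balanced_by_imp_check)
  have "(a', b') \<in> set [(1,1), (3,3), (5,5), (5,7), (7,5), (7,7), (3,2), (2,3), (5,6), (6,5), (7,6), (6,7),
       (5,4), (4,5), (7,4), (4,7)]"
    using cases
  proof (elim disjE conjE)
    assume "a' \<in> set [1,3,5,7]" "b' \<in> set [1,3,5,7,2,6,10,14,4,12,20,28]"
    then show ?thesis by (rule list_all_list_allD[OF unitary_perfect_enumeration(1) _ _ check])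
  next
    assume "a' \<in> set [2,6,10,14,4,12,20,28]" "b' \<in> set [1,3,5,7]"
    then show ?thesis by (rule list_all_list_allD[OF unitary_perfect_enumeration(2) _ _ check])
  qed
  then have "(a', b') = (1,1) \<or> (a', b') = (3,3) \<or> (a', b') = (5,5) \<or> (a', b') = (5,7) \<or> (a', b') = (7,5) \<or> (a', b') = (7,7)
     \<or> (a', b') = (3,2) \<or> (a', b') = (2,3) \<or> (a', b') = (5,6) \<or> (a', b') = (6,5) \<or> (a', b') = (7,6) \<or> (a', b') = (6,7)
     \<or> (a', b') = (5,4) \<or> (a', b') = (4,5) \<or> (a', b') = (7,4) \<or> (a', b') = (4,7)" by simp
  then have "(a', b', h1', h2', h3', k3') \<in> {(3,3,2,0,0,0), (5,5,0,0,1,1), (5,7,0,1,1,0), (7,5,0,1,0,1), (7,7,0,2,0,0),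
      (3,2,1,0,0,0), (2,3,1,0,0,0), (5,6,2,0,1,0), (6,5,2,0,0,1), (7,6,2,1,0,0), (6,7,2,1,0,0), (5,4,0,0,1,0),
      (4,5,0,0,0,1), (7,4,0,1,0,0), (4,7,0,1,0,0)}"
    using nz' h2'_def h1'_def h3'_def k3'_def
    by (elim disjE; simp add: sel_def del: One_nat_def split del: if_split)
  note fin = this
  have ab: "a = 2 ^ k * a'" "b = 2 ^ k * b'" unfolding a'_def b'_def by (rule a, rule b)
  show thesis by (rule that[OF ab h(1) h2 h(2,3) fin])
qed

section \<open>Indecomposability of the solutions\<close>

lemma multiplicity_pos_bit_poly:
  "irreducible (q :: bit poly) \<Longrightarrow> q dvd A \<Longrightarrow> A \<noteq> 0 \<Longrightarrow> multiplicity q A > 0"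
  by (metis prime_bit_poly_iff prime_elem_iff_irreducible prime_multiplicity_gt_zero_iff)

text \<open>If a Mersenne prime q divides B, then X divides q + 1, which divides f B = B. Otherwise
  B is a power of X + 1, which is not fixed. The parity condition is there because for \<delta> = 1
  and even multiplicity the exponent of q + 1 is 0.\<close>

lemma fixed_has_X:
  assumes f: "sigma_like \<delta> f" and B: "fixed f B" "degree B > 0"
    and small: "\<And>q. irreducible q \<Longrightarrow> q dvd B \<Longrightarrow> q \<in> small_primes"
    and parity: "\<And>q. mersenne_prime q \<Longrightarrow> q dvd B \<Longrightarrow> \<delta> = 0 \<or> odd (multiplicity q B)"
  shows "X dvd B"
proof (rule ccontr)
  assume nX: "\<not> X dvd B"
  have B0: "B \<noteq> 0" "f B = B" using B by (auto simp: fixed_def)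
  have "q = X + 1" if q: "irreducible q" "q dvd B" for q
  proof (rule ccontr)
    assume "q \<noteq> X + 1"
    then have mq: "mersenne_prime q" and q0: "poly q 0 = 1"
      using small[OF q] nX q by (auto simp: small_primes_def mersenne_prime_mform_iff poly_mform)
    let ?h = "multiplicity q B"
    have h: "?h > 0" using multiplicity_pos_bit_poly[OF q B0(1)] .
    have "pow2_part (?h + \<delta>) > \<delta>"
    proof (cases "\<delta> = 0")
      case True
      then show ?thesis using h by (simp add: pow2_part_def)
    next
      case False
      then have "\<delta> = 1" using f by (simp add: sigma_like_def)
      moreover have "even (?h + 1)" using parity[OF mq q(2)] False by simp
      then obtain k where k: "?h + 1 = 2 * k" by (rule evenE)
      moreover obtain j where "pow2_part k = 2 ^ j" using pow2_part_cases[of k] k by auto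
      ultimately have "pow2_part (?h + \<delta>) = 2 * 2 ^ j" using pow2_part_scale(1)[of 1 k] by simp
      moreover have "(1 :: nat) \<le> 2 ^ j" by simp
      ultimately show ?thesis using \<open>\<delta> = 1\<close> by linarith
    qed
    then have "(q + 1) dvd (q + 1) ^ (pow2_part (?h + \<delta>) - \<delta>)" by (intro dvd_power) auto
    then have "(q + 1) dvd f (q ^ ?h)"
      unfolding sigma_like_prime_power'[OF f q(1)] by (rule dvd_mult2)
    also have "\<dots> dvd f B" by (rule sigma_like_prime_power_dvd[OF f B0(1) q(1)])
    finally have "q + 1 dvd B" using B0(2) by simp
    moreover have "X dvd q + 1" using q0 by (simp add: X_dvd_iff)
    ultimately show False using nX dvd_trans by blast
  qed
  then have "prime_factors B \<subseteq> {X + 1}" using B0 by (auto simp: in_prime_factors_iff prime_bit_poly_iff)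
  then have "(\<Prod>p\<in>prime_factors B. p ^ multiplicity p B) = (\<Prod>p\<in>{X + 1}. p ^ multiplicity p B)"
    by (intro prod.mono_neutral_left) (auto simp: in_prime_factors_iff prime_bit_poly_iff B0 not_dvd_imp_multiplicity_0)
  then have Beq: "B = (X + 1) ^ multiplicity (X + 1) B" using prod_prime_factors_bit_poly[OF B0(1)] by simp
  define j where "j = multiplicity (X + 1) B"
  have j: "j > 0" using Beq B(2) by (cases j) (auto simp: j_def)
  have Bj: "B = (X + 1) ^ j" using Beq by (simp add: j_def)
  have "f ((X + 1) ^ j) * (X + 1 + 1) ^ \<delta> = (X + 1) ^ (j + \<delta>) + 1"
    using f j unfolding sigma_like_def by (metis irreducible_X(2))
  \<comment> \<open>At 1 the left side vanishes and the right side is 1.\<close>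
  then have "poly ((X + 1) ^ j * (X + 1 + 1) ^ \<delta>) 1 = poly ((X + 1) ^ (j + \<delta>) + 1) 1"
    using B0(2) Bj by metis
  then show False using j by (simp add: power_0_left)
qed

text \<open>In a coprime factor every prime keeps its exponent from the whole product, so the parity
  condition passes to it; both factors would then be divisible by X.\<close>

lemma indecomposable_fixed_smono:
  assumes f: "sigma_like \<delta> f" and fx: "fixed f (smono a b h1 h2 k2 h3 k3)"
    and parity: "\<delta> = 0 \<or> (\<forall>h\<in>{h1, h2, k2, h3, k3}. h = 0 \<or> odd h)"
  shows "indecomposable_fixed f (smono a b h1 h2 k2 h3 k3)"
proof -
  let ?A = "smono a b h1 h2 k2 h3 k3"
  have smallA: "q \<in> small_primes" if q: "irreducible q" "q dvd ?A" for q
  proof -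
    have "prime q" using q(1) by (simp add: prime_bit_poly_iff)
    then obtain p where "p \<in> small_primes" "q dvd p ^ small_exp a b h1 h2 k2 h3 k3 p"
      using q(2) unfolding smono_eq_prod by (auto simp: prime_dvd_prod_iff)
    then show ?thesis
      using irreducible_dvd_irreducible[OF q(1) irreducible_small_primes] \<open>prime q\<close> prime_dvd_power by blast
  qed
  have "X dvd B" if BC: "?A = B * C" "coprime B C" "degree B > 0" "fixed f B" for B C
  proof (rule fixed_has_X[OF f BC(4,3)])
    show "q \<in> small_primes" if "irreducible q" "q dvd B" for q using smallA[OF that(1)] that(2) BC(1) by simp
    fix q assume q: "mersenne_prime q" "q dvd B"
    have irr: "irreducible q" using q(1) by (simp add: mersenne_prime_def)
    then have pq: "prime q" by (simp add: prime_bit_poly_iff)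
    have nz: "B \<noteq> 0" "C \<noteq> 0" using BC(1) smono_nonzero by auto
    have "\<not> q dvd C" using BC(2) q(2) pq by (metis coprime_common_divisor not_prime_unit)
    then have "multiplicity q ?A = multiplicity q B"
      using pq nz unfolding BC(1) by (subst prime_elem_multiplicity_mult_distrib) (auto simp: not_dvd_imp_multiplicity_0)
    moreover have qs: "q \<in> small_primes" using smallA[OF irr] q(2) BC(1) by simp
    ultimately have mult: "multiplicity q B = small_exp a b h1 h2 k2 h3 k3 q" using multiplicity_smono by metis
    have "multiplicity q B > 0" using pq q(2) nz by (simp add: prime_multiplicity_gt_zero_iff)
    moreover have "q \<noteq> X" "q \<noteq> X + 1" using dlog_mersenne_prime(3)[OF q(1)] by auto
    then have "small_exp a b h1 h2 k2 h3 k3 q \<in> {h1, h2, k2, h3, k3}" by (auto simp: small_exp_def)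
    ultimately show "\<delta> = 0 \<or> odd (multiplicity q B)" using parity mult by auto
  qed
  then have "\<not> (\<exists>B C. ?A = B * C \<and> coprime B C \<and> degree B > 0 \<and> degree C > 0 \<and> fixed f B \<and> fixed f C)"
    by (metis coprime_commute mult.commute coprime_common_divisor irreducible_X(1) irreducible_not_unit)
  then show ?thesis using fx by (simp add: indecomposable_fixed_def)
qed

section \<open>Identification with the given lists\<close>

lemma M_eq: "M j = mform 1 j"
  by (simp add: M_def mform_def pX_eq)

lemma bar_smono: "bar (smono a b h1 h2 k2 h3 k3) = smono b a h1 k2 h2 k3 h3"
  by (simp add: smono_def add.assoc mult_ac)

lemma P_set_eq: "P_set = {smono 2 1 1 0 0 0 0, smono 1 2 1 0 0 0 0, smono 4 3 0 0 0 1 0, smono 3 4 0 0 0 0 1,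
  smono 4 4 0 0 0 1 1, smono 6 3 0 1 1 0 0, smono 3 6 0 1 1 0 0, smono 4 6 0 1 1 1 0, smono 6 4 0 1 1 0 1}"
proof -
  have "T1 = smono 2 1 1 0 0 0 0" "T3 = smono 4 3 0 0 0 1 0" "T5 = smono 4 4 0 0 0 1 1"
    "T6 = smono 6 3 0 1 1 0 0" "T8 = smono 4 6 0 1 1 1 0"
    unfolding T1_def T3_def T5_def T6_def T8_def M_eq pX_eq by (simp_all add: smono_def mult_ac)
  note T = this
  show ?thesis unfolding P_set_def T2_def T4_def T7_def T9_def T bar_smono ..
qed

text \<open>There are 15 elements because \<open>B1\<close>, \<open>B6\<close> and \<open>B7\<close>
  are their own conjugates.\<close>

lemma Pu_set_eq: "Pu_set \<union> bar ` Pu_set = {smono 3 3 2 0 0 0 0, smono 5 5 0 0 0 1 1, smono 5 7 0 1 1 1 0, smono 7 5 0 1 1 0 1,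
  smono 7 7 0 2 2 0 0, smono 3 2 1 0 0 0 0, smono 2 3 1 0 0 0 0, smono 5 6 2 0 0 1 0, smono 6 5 2 0 0 0 1,
  smono 7 6 2 1 1 0 0, smono 6 7 2 1 1 0 0, smono 5 4 0 0 0 1 0, smono 4 5 0 0 0 0 1, smono 7 4 0 1 1 0 0, smono 4 7 0 1 1 0 0}"
proof -
  have "B1 = smono 3 3 2 0 0 0 0" "B2 = smono 3 2 1 0 0 0 0" "B3 = smono 5 4 0 0 0 1 0" "B4 = smono 7 4 0 1 1 0 0"
    "B5 = smono 5 6 2 0 0 1 0" "B6 = smono 5 5 0 0 0 1 1" "B7 = smono 7 7 0 2 2 0 0" "B8 = smono 7 6 2 1 1 0 0"
    "B9 = smono 7 5 0 1 1 0 1"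
    unfolding B1_def B2_def B3_def B4_def B5_def B6_def B7_def B8_def B9_def M_eq pX_eq
    by (simp_all add: smono_def mult_ac)
  then have Pu: "Pu_set = {smono 3 3 2 0 0 0 0, smono 3 2 1 0 0 0 0, smono 5 4 0 0 0 1 0, smono 7 4 0 1 1 0 0,
    smono 5 6 2 0 0 1 0, smono 5 5 0 0 0 1 1, smono 7 7 0 2 2 0 0, smono 7 6 2 1 1 0 0, smono 7 5 0 1 1 0 1}"
    by (simp add: Pu_set_def)
  show ?thesis unfolding Pu image_insert image_empty bar_smono by blast
qed

lemma indecomposable_perfect_iff_fixed: "indecomposable_perfect A \<longleftrightarrow> indecomposable_fixed sigma A"
  by (simp add: indecomposable_perfect_def indecomposable_fixed_def perfect_def fixed_def)

lemma indecomposable_unitary_perfect_iff_fixed: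
  "indecomposable_unitary_perfect A \<longleftrightarrow> indecomposable_fixed sigma_star A"
  by (simp add: indecomposable_unitary_perfect_def indecomposable_fixed_def unitary_perfect_def fixed_def)

lemma P_set_indecomposable:
  assumes "A \<in> P_set" shows "indecomposable_fixed sigma A"
proof -
  have *: "indecomposable_fixed sigma (smono a b h1 h2 h2 h3 k3)"
    if "odd_part (a + 1) \<in> {0, 1, 3, 5, 7}" "odd_part (b + 1) \<in> {0, 1, 3, 5, 7}" "balanced_by 1 a b h1 h2 h3 k3"
      "\<forall>h\<in>{h1, h2, h2, h3, k3}. h = 0 \<or> odd h" for a b h1 h2 h3 k3
  proof (rule indecomposable_fixed_smono[OF sigma_like_sigma])
    show "fixed sigma (smono a b h1 h2 h2 h3 k3)"
      unfolding fixed_smono_iff[OF sigma_like_sigma] balanced_iff by (intro conjI refl that)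
  qed (rule disjI2, rule that(4))
  have "indecomposable_fixed sigma (smono 2 1 1 0 0 0 0)"
    "indecomposable_fixed sigma (smono 1 2 1 0 0 0 0)"
    "indecomposable_fixed sigma (smono 4 3 0 0 0 1 0)"
    "indecomposable_fixed sigma (smono 3 4 0 0 0 0 1)"
    "indecomposable_fixed sigma (smono 4 4 0 0 0 1 1)"
    "indecomposable_fixed sigma (smono 6 3 0 1 1 0 0)"
    "indecomposable_fixed sigma (smono 3 6 0 1 1 0 0)"
    "indecomposable_fixed sigma (smono 4 6 0 1 1 1 0)"
    "indecomposable_fixed sigma (smono 6 4 0 1 1 0 1)"
    by (rule *; simp add: balanced_by_def sel_def alpha_def numeral_2_eq_2[symmetric] del: One_nat_def split del: if_split)+
  then show ?thesis using assms unfolding P_set_eq by blast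
qed

lemma Pu_set_indecomposable:
  assumes "B \<in> Pu_set \<union> bar ` Pu_set" shows "indecomposable_fixed sigma_star (B ^ (2 ^ n))"
proof -
  have *: "indecomposable_fixed sigma_star (smono a b h1 h2 h2 h3 k3 ^ (2 ^ n))"
    if "odd_part a \<in> {0, 1, 3, 5, 7}" "odd_part b \<in> {0, 1, 3, 5, 7}" "balanced_by 0 a b h1 h2 h3 k3" for a b h1 h2 h3 k3
  proof -
    have "fixed sigma_star (smono (2 ^ n * a) (2 ^ n * b) (2 ^ n * h1) (2 ^ n * h2) (2 ^ n * h2) (2 ^ n * h3) (2 ^ n * k3))"
      unfolding fixed_smono_iff[OF sigma_like_sigma_star] balanced_iff
      using that balanced_by_scale[of n] pow2_part_scale(2)[of n] by simp
    then show ?thesis unfolding smono_power mult.commute[of _ "2 ^ n"]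
      by (intro indecomposable_fixed_smono[OF sigma_like_sigma_star]) auto
  qed
  have "indecomposable_fixed sigma_star (smono 3 3 2 0 0 0 0 ^ (2 ^ n))"
    "indecomposable_fixed sigma_star (smono 5 5 0 0 0 1 1 ^ (2 ^ n))"
    "indecomposable_fixed sigma_star (smono 5 7 0 1 1 1 0 ^ (2 ^ n))"
    "indecomposable_fixed sigma_star (smono 7 5 0 1 1 0 1 ^ (2 ^ n))"
    "indecomposable_fixed sigma_star (smono 7 7 0 2 2 0 0 ^ (2 ^ n))"
    "indecomposable_fixed sigma_star (smono 3 2 1 0 0 0 0 ^ (2 ^ n))"
    "indecomposable_fixed sigma_star (smono 2 3 1 0 0 0 0 ^ (2 ^ n))"
    "indecomposable_fixed sigma_star (smono 5 6 2 0 0 1 0 ^ (2 ^ n))"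
    "indecomposable_fixed sigma_star (smono 6 5 2 0 0 0 1 ^ (2 ^ n))"
    "indecomposable_fixed sigma_star (smono 7 6 2 1 1 0 0 ^ (2 ^ n))"
    "indecomposable_fixed sigma_star (smono 6 7 2 1 1 0 0 ^ (2 ^ n))"
    "indecomposable_fixed sigma_star (smono 5 4 0 0 0 1 0 ^ (2 ^ n))"
    "indecomposable_fixed sigma_star (smono 4 5 0 0 0 0 1 ^ (2 ^ n))"
    "indecomposable_fixed sigma_star (smono 7 4 0 1 1 0 0 ^ (2 ^ n))"
    "indecomposable_fixed sigma_star (smono 4 7 0 1 1 0 0 ^ (2 ^ n))"
    by (rule *; simp add: balanced_by_def sel_def alpha_def numeral_2_eq_2[symmetric] del: One_nat_def split del: if_split)+
  then show ?thesis using assms unfolding Pu_set_eq by blast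
qed

theorem theorem1p1:
  fixes A :: "bit poly" and P :: "'i \<Rightarrow> bit poly"
    and a b :: nat and h :: "'i \<Rightarrow> nat" and I :: "'i set"
  assumes "finite I" and "I \<noteq> {}"
    and "\<And>i. i \<in> I \<Longrightarrow> mersenne_prime (P i)"
    and "a > 0" and "b > 0" and "\<And>i. i \<in> I \<Longrightarrow> h i > 0"
    and "A = pX ^ a * (pX + 1) ^ b * (\<Prod>i\<in>I. P i ^ h i)"
  shows "(indecomposable_perfect A \<longleftrightarrow> A \<in> P_set) \<and>
    (indecomposable_unitary_perfect A \<longleftrightarrow>
      (\<exists>n::nat. \<exists>B \<in> Pu_set \<union> bar ` Pu_set. A = B ^ (2 ^ n)))"
proof -
  have A: "A = X ^ a * (X + 1) ^ b * (\<Prod>i\<in>I. P i ^ h i)" using assms(7) unfolding pX_eq .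
  have irrP: "irreducible (P i)" if "i \<in> I" for i using assms(3)[OF that] by (simp add: mersenne_prime_def)
  have XA: "X dvd A" "X + 1 dvd A"
    using assms(4,5) unfolding A by (simp_all add: dvd_mult dvd_mult2 dvd_power)
  obtain i where i: "i \<in> I" using assms(2) by blast
  have "P i dvd P i ^ h i" using assms(6)[OF i] by (intro dvd_power) auto
  also have "\<dots> dvd (\<Prod>i\<in>I. P i ^ h i)" using assms(1) i by (rule dvd_prodI)
  finally have PiA: "P i dvd A" unfolding A by (rule dvd_mult)
  have good: "good_prime q" if q: "irreducible q" "q dvd A" for q
  proof -
    have "prime q" using q(1) by (simp add: prime_bit_poly_iff)
    then consider "q dvd X" | "q dvd X + 1" | j where "j \<in> I" "q dvd P j"
      using q(2) assms(1) unfolding A by (auto simp: prime_dvd_mult_iff prime_dvd_prod_iff dest: prime_dvd_power)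
    then show ?thesis
      using q(1) irreducible_dvd_irreducible[OF q(1)] irreducible_X irrP assms(3)
      unfolding good_prime_def by cases metis+
  qed
  \<comment> \<open>Common to both halves. The inner \<open>a\<close> and \<open>b\<close> are new:
    they are read off from the normal form of A.\<close>
  have form: "\<exists>a b h1 h2 h3 k3. A = smono a b h1 h2 h2 h3 k3 \<and> balanced_by \<delta> a b h1 h2 h3 k3
      \<and> odd_part (a + \<delta>) \<in> {1, 3, 5, 7} \<and> odd_part (b + \<delta>) \<in> {1, 3, 5, 7} \<and> h1 + h2 + h3 + k3 > 0"
    if f: "sigma_like \<delta> f" and ind: "indecomposable_fixed f A" for \<delta> f
  proof -
    have fx: "fixed f A" using ind by (simp add: indecomposable_fixed_def)
    then have "A \<noteq> 0" by (simp add: fixed_def)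
    have small: "q \<in> small_primes" if "irreducible q" "q dvd A" for q
      using indecomposable_fixed_prime_factors_small[OF f ind good XA(1) that] .
    obtain a b h1 h2 k2 h3 k3 where S: "A = smono a b h1 h2 k2 h3 k3" using eq_smonoI[OF \<open>A \<noteq> 0\<close> small] .
    have bal: "odd_part (a + \<delta>) \<in> {0, 1, 3, 5, 7}" "odd_part (b + \<delta>) \<in> {0, 1, 3, 5, 7}" "k2 = h2"
      "balanced_by \<delta> a b h1 h2 h3 k3"
      using fx fixed_smono_iff[OF f] balanced_iff unfolding S by blast+
    have pos: "a > 0" "b > 0"
      using multiplicity_pos_bit_poly[OF irreducible_X(1) XA(1) \<open>A \<noteq> 0\<close>]
        multiplicity_pos_bit_poly[OF irreducible_X(2) XA(2) \<open>A \<noteq> 0\<close>]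
      unfolding S by (simp_all add: multiplicity_smono small_primes_def small_exp_simps)
    \<comment> \<open>Here the nonempty index set is used: some \<open>P i\<close> divides A, so A
      is not a monomial in X and X + 1.\<close>
    have "h1 + h2 + h3 + k3 > 0"
    proof (rule ccontr)
      assume "\<not> ?thesis"
      then have "A = X ^ a * (X + 1) ^ b" using bal(3) by (simp add: S smono_def)
      then show False using PiA mersenne_prime_not_dvd_monomial[OF assms(3)[OF i]] by metis
    qed
    moreover have "odd_part (a + \<delta>) \<noteq> 0" "odd_part (b + \<delta>) \<noteq> 0" using pos by (auto simp: odd_part_0_iff)
    then have "odd_part (a + \<delta>) \<in> {1, 3, 5, 7}" "odd_part (b + \<delta>) \<in> {1, 3, 5, 7}"
      using bal(1,2) by (metis insert_iff)+
    moreover have "A = smono a b h1 h2 h2 h3 k3" using S bal(3) by simp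
    ultimately show ?thesis using bal(4) by blast
  qed
  have "A \<in> P_set" if ind: "indecomposable_fixed sigma A"
  proof -
    obtain a b h1 h2 h3 k3 where S: "A = smono a b h1 h2 h2 h3 k3" and bal: "balanced_by 1 a b h1 h2 h3 k3"
      "odd_part (a + 1) \<in> {1, 3, 5, 7}" "odd_part (b + 1) \<in> {1, 3, 5, 7}" "h1 + h2 + h3 + k3 > 0"
      using form[OF sigma_like_sigma ind] by blast
    have "odd_part (a + 1) \<in> {0, 1, 3, 5, 7}" "odd_part (b + 1) \<in> {0, 1, 3, 5, 7}" using bal by auto
    note perfect_exponents[OF this bal(1,4)]
    then show ?thesis unfolding P_set_eq S by (elim insertE emptyE; simp)
  qed
  moreover have "\<exists>n::nat. \<exists>B \<in> Pu_set \<union> bar ` Pu_set. A = B ^ (2 ^ n)" if ind: "indecomposable_fixed sigma_star A"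
  proof -
    obtain a b h1 h2 h3 k3 where S: "A = smono a b h1 h2 h2 h3 k3" and bal: "balanced_by 0 a b h1 h2 h3 k3"
      "odd_part a \<in> {1, 3, 5, 7}" "odd_part b \<in> {1, 3, 5, 7}" "h1 + h2 + h3 + k3 > 0"
      using form[OF sigma_like_sigma_star ind] unfolding add_0_right by blast
    obtain k a' b' h1' h2' h3' k3' where
      e: "a = 2 ^ k * a'" "b = 2 ^ k * b'" "h1 = 2 ^ k * h1'" "h2 = 2 ^ k * h2'" "h3 = 2 ^ k * h3'" "k3 = 2 ^ k * k3'"
      and mem: "(a', b', h1', h2', h3', k3') \<in> {(3,3,2,0,0,0), (5,5,0,0,1,1), (5,7,0,1,1,0), (7,5,0,1,0,1), (7,7,0,2,0,0),
      (3,2,1,0,0,0), (2,3,1,0,0,0), (5,6,2,0,1,0), (6,5,2,0,0,1), (7,6,2,1,0,0), (6,7,2,1,0,0), (5,4,0,0,1,0),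
      (4,5,0,0,0,1), (7,4,0,1,0,0), (4,7,0,1,0,0)}"
      by (rule unitary_perfect_exponents[OF bal(2,3,1,4)])
    have "A = smono a' b' h1' h2' h2' h3' k3' ^ (2 ^ k)"
      unfolding S e smono_power by (simp only: mult.commute)
    moreover have "smono a' b' h1' h2' h2' h3' k3' \<in> Pu_set \<union> bar ` Pu_set"
      using mem unfolding Pu_set_eq by (elim insertE emptyE; simp)
    ultimately show ?thesis by blast
  qed
  ultimately show ?thesis
    unfolding indecomposable_perfect_iff_fixed indecomposable_unitary_perfect_iff_fixed
    using P_set_indecomposable Pu_set_indecomposable by blast
qed

end
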